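(* Let $n>2$ and $m\ge 1$ be integers. The following identities hold as identities of meromorphic functions of $s\in\mathbb{C}$ (i.e. for all $s$ away from the poles). (i) If $n$ is even, then $$I_m(s)=(n-1)_m^2\,\frac{\Gamma(\frac n2)\,\Gamma(s+2n-1)\,\Gamma(m+\frac n2-1)\,\Gamma(s+n)}{\Gamma(m)\,\Gamma(m+n-1)\,\Gamma(s+\frac{3n}{2})\,\Gamma(m+s+\frac{3n}{2}-1)}\;{}_4F_3\!\left(\begin{matrix}\frac n2,\ s-m+\frac n2+1,\ 1-\frac n2,\ s+n\\ s+\frac{3n}{2},\ 2-m-\frac n2,\ s+\frac n2+1\end{matrix};1\right).$$ (ii) If $n$ is odd, then $$\begin{aligned}I_m(s)&=\frac{(n-1)_m^2}{(n+s)_m}\,\frac{\Gamma(s+\frac n2+1)\,\Gamma(s+2n-1)\,\Gamma(1-m-\frac n2)}{\Gamma(s-m+\frac n2+1)\,\Gamma(1-\frac n2)\,\Gamma(m+2n+s-1)}\\&\qquad\times{}_4F_3\!\left(\begin{matrix}n+s,\ m+n-1,\ m+s+\frac{3n}{2}-1,\ m\\ m+n+s,\ m+\frac n2,\ m+2n+s-1\end{matrix};1\right)\\&\quad+(n-1)_m^2\,\frac{\Gamma(\frac n2)\,\Gamma(s+2n-1)\,\Gamma(m+\frac n2-1)\,\Gamma(s+n)}{\Gamma(m)\,\Gamma(m+n-1)\,\Gamma(s+\frac{3n}{2})\,\Gamma(m+s+\frac{3n}{2}-1)}\\&\qquad\times{}_4F_3\!\left(\begin{matrix}\frac n2,\ s-m+\frac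 n2+1,\ 1-\frac n2,\ s+n\\ s+\frac{3n}{2},\ 2-m-\frac n2,\ s+\frac n2+1\end{matrix};1\right).\end{aligned}$$
   Context: $(a)_\ell=a(a+1)\cdots(a+\ell-1)$ is the Pochhammer symbol, $(a)_0=1$. The generalized hypergeometric series is $${}_pF_q\!\left(\begin{matrix}a_1,\dots,a_p\\ b_1,\dots,b_q\end{matrix};z\right)=\sum_{\ell\ge0}\frac{(a_1)_\ell\cdots(a_p)_\ell}{(b_1)_\ell\cdots(b_q)_\ell}\frac{z^\ell}{\ell!}.$$ If some numerator parameter is a non-positive integer $-N$ and a denominator parameter is a non-positive integer $-M$ with $N\le M$, the symbol denotes the finite sum over $0\le\ell\le N$. The function $1/\Gamma$ is taken to be $0$ at non-positive integers. For integers $n>2$ and $m\ge0$ put $$S_m(t)=\frac{(n-1)_m}{(\frac n2)_m}\,{}_2F_1\!\left(\begin{matrix}m,\ 1-\frac n2\\ m+\frac n2\end{matrix};t\right),$$ and for $s>-1$ (or $\operatorname{Re}s>-1$) $$I_m(s)=\frac{\Gamma(\frac n2+s+1)}{\Gamma(\frac n2)\,\Gamma(s+1)}\int_0^1t^{m+\frac n2-1}(1-t)^sS_m(t)^2\,dt.$$ The function $I_m$ extends to a meromorphic function on $\mathbb{C}$, still denoted $I_m(s)$. *)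

theory Defs
  imports "HOL-Complex_Analysis.Complex_Analysis"
begin

(* Only values of the hypergeometric series are needed, so no radius of convergence enters:
   at z = 1 this is just the sum of the coefficients.  If a numerator parameter is -N, all terms
   of index greater than N vanish (also those where a denominator parameter -M makes the
   denominator zero, since x / 0 = 0), so that for N \<le> M the series is the finite sum over
   0 \<le> l \<le> N, as the lemma below records. *)
definition hypergeometric :: "'a list \<Rightarrow> 'a list \<Rightarrow> 'a \<Rightarrow> 'a :: {banach, real_normed_field}"
  where "hypergeometric as bs z = eval_fps (fps_hypergeo as bs 1) z"

lemma hypergeometric_terminating:
  fixes as bs :: "'a :: {banach, real_normed_field} list"
  assumes "- of_nat N \<in> set as"
  shows "hypergeometric as bs z =
    (\<Sum>l\<le>N. (\<Prod>a\<leftarrow>as. pochhammer a l) / (\<Prod>b\<leftarrow>bs. pochhammer b l) * z ^ l / fact l)"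
proof -
  have foldr_eq: "foldr (\<lambda>a r. r * pochhammer a l) xs c = c * (\<Prod>a\<leftarrow>xs. pochhammer a l)"
    for xs :: "'a list" and c l
    by (induction xs) (simp_all add: ac_simps)
  have coeff: "fps_hypergeo as bs 1 $ l =
      (\<Prod>a\<leftarrow>as. pochhammer a l) / (\<Prod>b\<leftarrow>bs. pochhammer b l) / fact l" for l
    by (simp add: fps_hypergeo_nth_alt foldr_eq del: fps_hypergeo_nth)
  have zero: "(\<Prod>a\<leftarrow>as. pochhammer a l) = 0" if "l > N" for l
    using assms that
    by (auto simp: prod_list_zero_iff image_iff pochhammer_of_nat_eq_0_iff intro!: bexI[of _ "- of_nat N"])
  have "(\<Sum>l. fps_hypergeo as bs 1 $ l * z ^ l) = (\<Sum>l\<le>N. fps_hypergeo as bs 1 $ l * z ^ l)"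
    by (rule suminf_finite) (auto simp: coeff zero simp del: fps_hypergeo_nth)
  thus ?thesis
    by (simp add: hypergeometric_def eval_fps_def coeff field_simps del: fps_hypergeo_nth)
qed

(* The symbol is meaningful: a non-positive integer -M among the denominator parameters is only
   permitted together with some numerator parameter -N such that N \<le> M. *)
definition hypergeometric_defined :: "'a :: field_char_0 list \<Rightarrow> 'a list \<Rightarrow> bool"
  where "hypergeometric_defined as bs \<longleftrightarrow>
    (\<forall>M. - of_nat M \<in> set bs \<longrightarrow> (\<exists>N\<le>M. - of_nat N \<in> set as))"

definition S_fun :: "nat \<Rightarrow> nat \<Rightarrow> real \<Rightarrow> real"
  where "S_fun n m t =
    pochhammer (real n - 1) m / pochhammer (real n / 2) m *
    hypergeometric [real m, 1 - real n / 2] [real m + real n / 2] t"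

definition I_integral :: "nat \<Rightarrow> nat \<Rightarrow> complex \<Rightarrow> complex"
  where "I_integral n m s =
    Gamma (of_nat n / 2 + s + 1) / (Gamma (of_nat n / 2) * Gamma (s + 1)) *
    (LBINT t:{0<..<1}. of_real (t powr (real m + real n / 2 - 1)) *
                        of_real (1 - t) powr s * of_real ((S_fun n m t)\<^sup>2))"

(* The meromorphic continuation; it is unique, because nicely meromorphic functions are
   continuous at all non-poles and take the value 0 at their poles. *)
definition I_mero :: "nat \<Rightarrow> nat \<Rightarrow> complex \<Rightarrow> complex"
  where "I_mero n m =
    (THE F. F nicely_meromorphic_on UNIV \<and> (\<forall>s. Re s > -1 \<longrightarrow> F s = I_integral n m s))"

(* In the right-hand sides below, division by a value of Gamma at a pole yields 0, because
   Gamma is 0 there and x / 0 = 0; this is the convention that 1/Gamma vanishes at the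
   non-positive integers. *)

definition A_num :: "nat \<Rightarrow> nat \<Rightarrow> complex \<Rightarrow> complex list" where
  "A_num n m s =
    [of_nat n / 2, s - of_nat m + of_nat n / 2 + 1, 1 - of_nat n / 2, s + of_nat n]"

definition A_den :: "nat \<Rightarrow> nat \<Rightarrow> complex \<Rightarrow> complex list" where
  "A_den n m s = [s + 3 * of_nat n / 2, 2 - of_nat m - of_nat n / 2, s + of_nat n / 2 + 1]"

definition A_term :: "nat \<Rightarrow> nat \<Rightarrow> complex \<Rightarrow> complex" where
  "A_term n m s =
    (pochhammer (of_nat n - 1) m)\<^sup>2 *
    (Gamma (of_nat n / 2) * Gamma (s + 2 * of_nat n - 1) *
     Gamma (of_nat m + of_nat n / 2 - 1) * Gamma (s + of_nat n)) /
    (Gamma (of_nat m) * Gamma (of_nat m + of_nat n - 1) *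
     Gamma (s + 3 * of_nat n / 2) * Gamma (of_nat m + s + 3 * of_nat n / 2 - 1)) *
    hypergeometric (A_num n m s) (A_den n m s) 1"

definition B_num :: "nat \<Rightarrow> nat \<Rightarrow> complex \<Rightarrow> complex list" where
  "B_num n m s =
    [of_nat n + s, of_nat m + of_nat n - 1, of_nat m + s + 3 * of_nat n / 2 - 1, of_nat m]"

definition B_den :: "nat \<Rightarrow> nat \<Rightarrow> complex \<Rightarrow> complex list" where
  "B_den n m s =
    [of_nat m + of_nat n + s, of_nat m + of_nat n / 2, of_nat m + 2 * of_nat n + s - 1]"

definition B_term :: "nat \<Rightarrow> nat \<Rightarrow> complex \<Rightarrow> complex" where
  "B_term n m s =
    (pochhammer (of_nat n - 1) m)\<^sup>2 / pochhammer (of_nat n + s) m *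
    (Gamma (s + of_nat n / 2 + 1) * Gamma (s + 2 * of_nat n - 1) *
     Gamma (1 - of_nat m - of_nat n / 2)) /
    (Gamma (s - of_nat m + of_nat n / 2 + 1) * Gamma (1 - of_nat n / 2) *
     Gamma (of_nat m + 2 * of_nat n + s - 1)) *
    hypergeometric (B_num n m s) (B_den n m s) 1"

(* The points s at which every factor of the respective expression is defined: no Gamma factor in
   a numerator is at a pole, no Pochhammer symbol in a denominator vanishes, and the
   hypergeometric symbol is meaningful.  The Gamma factors independent of s are never at a pole
   in the cases where the terms are used. *)

definition A_regular :: "nat \<Rightarrow> nat \<Rightarrow> complex \<Rightarrow> bool" where
  "A_regular n m s \<longleftrightarrow>
    s + 2 * of_nat n - 1 \<notin> \<int>\<^sub>\<le>\<^sub>0 \<and> s + of_nat n \<notin> \<int>\<^sub>\<le>\<^sub>0 \<and>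
    hypergeometric_defined (A_num n m s) (A_den n m s)"

definition B_regular :: "nat \<Rightarrow> nat \<Rightarrow> complex \<Rightarrow> bool" where
  "B_regular n m s \<longleftrightarrow>
    pochhammer (of_nat n + s) m \<noteq> 0 \<and>
    s + of_nat n / 2 + 1 \<notin> \<int>\<^sub>\<le>\<^sub>0 \<and> s + 2 * of_nat n - 1 \<notin> \<int>\<^sub>\<le>\<^sub>0 \<and>
    hypergeometric_defined (B_num n m s) (B_den n m s)"

end

theory Submission
  imports Defs
begin

text \<open>
  Put \<open>p = n / 2\<close>, \<open>c = m + p\<close>, \<open>F = 2F1(m, 1 - p; c; t)\<close> and \<open>f = 2F1(p, 1 - p; c; t)\<close>.
  Up to elementary factors \<open>I_m(s)\<close> is the integral of \<open>t^(c-1) (1-t)^s F^2\<close>.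
  Since \<open>F(t) = (1-t)^(p-1) f(-t/(1-t))\<close>, the square moments of \<open>F\<close> and those of \<open>f\<close>
  (with \<open>s\<close> replaced by \<open>s + p - m\<close>) satisfy, up to a quotient of Gamma functions, the same
  second order recurrence in \<open>s\<close>. Both are minimal solutions with the same leading asymptotics
  as \<open>s\<close> tends to infinity, so they agree by a Casoratian argument.
  In the integral of \<open>f^2\<close>, one factor \<open>f\<close> is expanded at \<open>t = 1\<close> by the connection formula, whose
  two local solutions have exponents \<open>0\<close> and \<open>c - 1\<close>; the moments of the other factor are
  given by the Gauss summation formula. The two local solutions produce the two balanced 4F3 series.
  For even \<open>n\<close>, \<open>f\<close> is a polynomial and only the first local solution occurs.
  This proves the identities for large real \<open>s\<close>; the rest is analytic continuation.
\<close>

subsection \<open>Growth of hypergeometric coefficients and Gauss summation\<close>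

text \<open>The detour from F to f is forced by odd \<open>n\<close>. The local exponents of F at t
  = 1 are 0 and 2p - 1 = n - 1; their difference is an integer, and for odd \<open>n\<close> the
  expansion of F there contains a logarithm. For f the difference is c - 1 = m + p - 1, a
  half-integer for odd \<open>n\<close>, so the connection formula has its generic form. The map t
  -> t/(t-1) exchanges the points 1 and infinity and with them the exponent differences 2p - 1 and m
  + p - 1. It takes (0,1) to the negative axis, so it carries over the differential equation but not
  the integrals. What survives is the recurrence of the moments: the squares of the two differences
  occur in its outer coefficients, exchanged between F and f, and a quotient of Gamma functions
  repairs exactly this. Both 4F3 series are balanced: their terms are O(l^(-2)) for every s. Divided
  by two Gamma functions of s they become entire, which makes the continuation explicit. Equality at
  each single regular point also requires that no pole sits there; the condition on the parameters
  of the symbol excludes the poles of a Gamma factor hidden in the series.\<close>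

lemma pos_not_nonpos_Ints [simp]: "0 < x \<Longrightarrow> (x :: real) \<notin> \<int>\<^sub>\<le>\<^sub>0"
  by (auto elim!: nonpos_Ints_cases)

text \<open>Euler's limit for 1/Gamma, taken four times: the powers of n cancel because the
  parameter sums agree. \<open>rGamma_series\<close> at n contains the Pochhammer symbol of length n
  + 1, hence the final index shift. With \<open>rGamma\<close> for the numerator parameters the
  limit is also correct when these are non-positive integers.\<close>

lemma pochhammer_pair_quotient_tendsto:
  fixes u1 u2 v1 v2 :: "'a :: Gamma"
  assumes v: "v1 \<notin> \<int>\<^sub>\<le>\<^sub>0" "v2 \<notin> \<int>\<^sub>\<le>\<^sub>0" and sum_eq: "u1 + u2 = v1 + v2"
  shows "(\<lambda>n. pochhammer u1 n * pochhammer u2 n / (pochhammer v1 n * pochhammer v2 n))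
      \<longlonglongrightarrow> Gamma v1 * Gamma v2 * rGamma u1 * rGamma u2"
proof -
  have "(\<lambda>n. rGamma_series u1 n * rGamma_series u2 n / (rGamma_series v1 n * rGamma_series v2 n))
      \<longlonglongrightarrow> rGamma u1 * rGamma u2 / (rGamma v1 * rGamma v2)"
    using v by (intro tendsto_intros) (auto simp: rGamma_eq_zero_iff)
  also have "rGamma u1 * rGamma u2 / (rGamma v1 * rGamma v2) = Gamma v1 * Gamma v2 * rGamma u1 * rGamma u2"
    by (simp add: Gamma_def field_simps)
  also have "(\<lambda>n. rGamma_series u1 n * rGamma_series u2 n / (rGamma_series v1 n * rGamma_series v2 n)) =
    (\<lambda>n. pochhammer u1 (Suc n) * pochhammer u2 (Suc n) / (pochhammer v1 (Suc n) * pochhammer v2 (Suc n)))"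
  proof
    fix n :: nat
    define E where "E = (\<lambda>z::'a. exp (z * of_real (ln (of_nat n))))"
    have "E u1 * E u2 = E v1 * E v2"
      unfolding E_def exp_add [symmetric] distrib_right [symmetric] sum_eq ..
    moreover have "E z \<noteq> 0" for z by (simp add: E_def)
    ultimately show "rGamma_series u1 n * rGamma_series u2 n / (rGamma_series v1 n * rGamma_series v2 n) =
        pochhammer u1 (Suc n) * pochhammer u2 (Suc n) / (pochhammer v1 (Suc n) * pochhammer v2 (Suc n))"
      unfolding rGamma_series_def Suc_eq_plus1 E_def by (simp add: divide_simps)
  qed
  finally show ?thesis
    by (subst (asm) filterlim_sequentially_Suc)
qed

lemma pochhammer_quotient_tendsto:
  fixes u v :: real
  assumes "v \<notin> \<int>\<^sub>\<le>\<^sub>0"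
  shows "(\<lambda>n. pochhammer u n / pochhammer v n * (real n + 1) powr (v - u)) \<longlonglongrightarrow> rGamma u * Gamma v"
proof -
  \<comment> \<open>The weight of the claim, \<open>real n + 1\<close> so that it is positive at n =
    0, becomes n + 2 at index n + 1, whereas \<open>rGamma_series\<close> carries n itself; this
    ratio accounts for the difference.\<close>
  have "(\<lambda>n. real n / (real n + 2)) \<longlonglongrightarrow> 1"
    by real_asymp
  hence "(\<lambda>n. (real n / (real n + 2)) powr (u - v)) \<longlonglongrightarrow> 1 powr (u - v)"
    by (intro tendsto_intros) auto
  hence "(\<lambda>n. rGamma_series u n / rGamma_series v n * (real n / (real n + 2)) powr (u - v))
      \<longlonglongrightarrow> rGamma u / rGamma v * 1 powr (u - v)"
    using assms by (intro tendsto_mult tendsto_divide rGamma_series_LIMSEQ) (auto simp: rGamma_eq_zero_iff)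
  also have "rGamma u / rGamma v * 1 powr (u - v) = rGamma u * Gamma v"
    by (simp add: Gamma_def field_simps)
  finally have "(\<lambda>n. pochhammer u (Suc n) / pochhammer v (Suc n) * (real (Suc n) + 1) powr (v - u))
      \<longlonglongrightarrow> rGamma u * Gamma v"
  proof (rule Lim_transform_eventually)
    show "\<forall>\<^sub>F n in sequentially. rGamma_series u n / rGamma_series v n * (real n / (real n + 2)) powr (u - v) =
        pochhammer u (Suc n) / pochhammer v (Suc n) * (real (Suc n) + 1) powr (v - u)"
      using eventually_gt_at_top [of 0]
    proof eventually_elim
      case (elim n)
      have "exp (z * ln (real n)) = real n powr z" for z
        using elim by (simp add: powr_def)
      moreover have "real n powr v = real n powr u * real n powr (v - u)"
        by (simp flip: powr_add)
      moreover have "real (Suc n) + 1 = real n + 2" by simp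
      moreover have "(real n + 2) powr (v - u) * (real n + 2) powr (u - v) = 1"
        by (simp flip: powr_add)
      moreover have "real n powr (v - u) * real n powr (u - v) = 1"
        using elim by (simp flip: powr_add)
      ultimately show ?case
        using elim unfolding rGamma_series_def
        by (simp add: powr_divide divide_simps) (simp add: algebra_simps)
    qed
  qed
  thus ?thesis
    by (subst (asm) filterlim_sequentially_Suc [where f = "\<lambda>n. pochhammer u n / pochhammer v n * (real n + 1) powr (v - u)"])
qed

lemma Gamma_add_of_nat: "x > 0 \<Longrightarrow> Gamma (x + real n) = Gamma x * pochhammer x n"
  by (simp add: pochhammer_Gamma Gamma_eq_zero_iff)

lemma pochhammer_quotient_bound:
  fixes u v :: real
  assumes "v \<notin> \<int>\<^sub>\<le>\<^sub>0"
  obtains C where "C > 0" "\<And>n. \<bar>pochhammer u n / pochhammer v n\<bar> \<le> C * (real n + 1) powr (u - v)"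
proof -
  from pochhammer_quotient_tendsto [OF assms, of u]
  have "Bseq (\<lambda>n. pochhammer u n / pochhammer v n * (real n + 1) powr (v - u))"
    by (intro convergent_imp_Bseq convergentI)
  then obtain C where C: "C > 0" "\<And>n. norm (pochhammer u n / pochhammer v n * (real n + 1) powr (v - u)) \<le> C"
    by (auto elim: BseqE)
  have "\<bar>pochhammer u n / pochhammer v n\<bar> \<le> C * (real n + 1) powr (u - v)" for n
  proof -
    have "\<bar>pochhammer u n / pochhammer v n\<bar> =
        norm (pochhammer u n / pochhammer v n * (real n + 1) powr (v - u)) * (real n + 1) powr (u - v)"
      by (simp add: abs_mult powr_diff field_simps)
    also have "\<dots> \<le> C * (real n + 1) powr (u - v)"
      by (intro mult_right_mono C) auto
    finally show ?thesis .
  qed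
  with C(1) show ?thesis by (rule that)
qed

lemma summable_real_powr_shift:
  "summable (\<lambda>n. (real n + 1) powr a) \<longleftrightarrow> a < -1"
  using summable_Suc_iff [of "\<lambda>n. real n powr a"] summable_real_powr_iff [of a]
  by (simp add: add_ac)

definition hyp_coeff :: "real \<Rightarrow> real \<Rightarrow> real \<Rightarrow> nat \<Rightarrow> real" where
  "hyp_coeff a b c n = pochhammer a n * pochhammer b n / (pochhammer c n * fact n)"

lemma hyp_coeff_0 [simp]: "hyp_coeff a b c 0 = 1"
  by (simp add: hyp_coeff_def)

lemma hyp_coeff_bound:
  assumes "c \<notin> \<int>\<^sub>\<le>\<^sub>0"
  obtains C where "C > 0" "\<And>n. \<bar>hyp_coeff a b c n\<bar> \<le> C * (real n + 1) powr (a + b - c - 1)"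
proof -
  obtain C1 where C1: "C1 > 0" "\<And>n. \<bar>pochhammer a n / pochhammer c n\<bar> \<le> C1 * (real n + 1) powr (a - c)"
    using pochhammer_quotient_bound [OF assms] by blast
  obtain C2 where C2: "C2 > 0" "\<And>n. \<bar>pochhammer b n / pochhammer 1 n\<bar> \<le> C2 * (real n + 1) powr (b - 1)"
    using pochhammer_quotient_bound [of 1] by auto
  have "\<bar>hyp_coeff a b c n\<bar> \<le> C1 * C2 * (real n + 1) powr (a + b - c - 1)" for n
  proof -
    have "\<bar>hyp_coeff a b c n\<bar> = \<bar>pochhammer a n / pochhammer c n\<bar> * \<bar>pochhammer b n / pochhammer 1 n\<bar>"
      by (simp add: hyp_coeff_def abs_mult flip: pochhammer_fact)
    also have "\<dots> \<le> (C1 * (real n + 1) powr (a - c)) * (C2 * (real n + 1) powr (b - 1))"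
      by (intro mult_mono C1 C2) (use C1 in auto)
    also have "\<dots> = C1 * C2 * ((real n + 1) powr (a - c) * (real n + 1) powr (b - 1))"
      by (simp add: mult_ac)
    also have "(real n + 1) powr (a - c) * (real n + 1) powr (b - 1) = (real n + 1) powr (a + b - c - 1)"
      by (simp flip: powr_add add: algebra_simps)
    finally show ?thesis .
  qed
  with C1(1) C2(1) show ?thesis by (intro that[of "C1 * C2"]) auto
qed

lemma hyp_coeff_abs_summable:
  assumes "c \<notin> \<int>\<^sub>\<le>\<^sub>0" "c - a - b > 0"
  shows "summable (\<lambda>n. \<bar>hyp_coeff a b c n\<bar>)"
proof -
  obtain C where C: "C > 0" "\<And>n. \<bar>hyp_coeff a b c n\<bar> \<le> C * (real n + 1) powr (a + b - c - 1)"
    using hyp_coeff_bound [OF assms(1)] by blast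
  have "summable (\<lambda>n. C * (real n + 1) powr (a + b - c - 1))"
    using assms(2) by (intro summable_mult) (simp add: summable_real_powr_shift)
  thus ?thesis
    by (rule summable_comparison_test') (use C in auto)
qed

lemma hyp_coeff_summable:
  assumes "c \<notin> \<int>\<^sub>\<le>\<^sub>0" "c - a - b > 0"
  shows "summable (hyp_coeff a b c)"
  using hyp_coeff_abs_summable [OF assms] by (rule summable_rabs_cancel)

lemma hyp_coeff_Suc:
  assumes "c + real n \<noteq> 0"
  shows "hyp_coeff a b c (Suc n) * ((real n + 1) * (c + real n)) = (a + real n) * (b + real n) * hyp_coeff a b c n"
  using assms by (auto simp: hyp_coeff_def pochhammer_Suc divide_simps)

lemma not_nonpos_Ints_add_nat: "c \<notin> \<int>\<^sub>\<le>\<^sub>0 \<Longrightarrow> c + real n \<noteq> 0"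
  by (metis add_eq_0_iff2 minus_of_nat_in_nonpos_Ints of_nat_in_nonpos_Ints_iff)

lemma not_nonpos_Ints_plus: "c \<notin> \<int>\<^sub>\<le>\<^sub>0 \<Longrightarrow> c + of_nat n \<notin> (\<int>\<^sub>\<le>\<^sub>0 :: 'a :: ring_char_0 set)"
  by (metis add_diff_cancel_right' nonpos_Ints_diff_Nats of_nat_in_Nats)

text \<open>The difference of the two sides telescopes along \<open>n * hyp_coeff a b c n\<close>.\<close>

lemma hyp_sum_contiguous:
  assumes c: "c \<notin> \<int>\<^sub>\<le>\<^sub>0" and pos: "c - a - b > 0"
  shows "(c - a) * (c - b) * suminf (hyp_coeff a b (c + 1)) = c * (c - a - b) * suminf (hyp_coeff a b c)"
proof -
  define t where "t = hyp_coeff a b c"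
  define V where "V = (\<lambda>n. real n * t n)"
  have cn: "c + real n \<noteq> 0" for n using not_nonpos_Ints_add_nat [OF c] .
  obtain C where C: "C > 0" "\<And>n. \<bar>t n\<bar> \<le> C * (real n + 1) powr (a + b - c - 1)"
    using hyp_coeff_bound [OF c] unfolding t_def by blast
  have V0: "V \<longlonglongrightarrow> 0"
  proof (rule Lim_null_comparison)
    show "\<forall>\<^sub>F n in sequentially. norm (V n) \<le> C * (real n + 1) powr (a + b - c)"
    proof (intro always_eventually allI)
      fix n
      have "norm (V n) \<le> (real n + 1) * (C * (real n + 1) powr (a + b - c - 1))"
        unfolding V_def using C(1) by (subst norm_mult, intro mult_mono) (use C(2) in auto)
      also have "(real n + 1) * (C * (real n + 1) powr (a + b - c - 1)) =
          C * ((real n + 1) powr 1 * (real n + 1) powr (a + b - c - 1))"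
        by simp
      also have "(real n + 1) powr 1 * (real n + 1) powr (a + b - c - 1) = (real n + 1) powr (a + b - c)"
        unfolding powr_add [symmetric] by (simp add: algebra_simps)
      finally show "norm (V n) \<le> C * (real n + 1) powr (a + b - c)" .
    qed
    have "(\<lambda>n. C * (real n + 1) powr (a + b - c)) \<longlonglongrightarrow> C * 0"
      by (intro tendsto_mult tendsto_const tendsto_neg_powr)
         (use pos in simp, real_asymp)
    thus "(\<lambda>n. C * (real n + 1) powr (a + b - c)) \<longlonglongrightarrow> 0" by simp
  qed
  have s1: "summable t" unfolding t_def by (rule hyp_coeff_summable [OF c pos])
  have c1: "c + 1 \<notin> \<int>\<^sub>\<le>\<^sub>0" using not_nonpos_Ints_plus [OF c, of 1] by simp
  have s2: "summable (hyp_coeff a b (c + 1))"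
    by (rule hyp_coeff_summable [OF c1]) (use pos in simp)
  have "(\<lambda>n. - c * (V (Suc n) - V n)) sums (- c * (0 - V 0))"
    by (intro sums_mult telescope_sums V0)
  moreover have "- c * (V (Suc n) - V n) = c * (c - a - b) * t n - (c - a) * (c - b) * hyp_coeff a b (c + 1) n" for n
  proof -
    have "hyp_coeff a b (c + 1) n * (c + real n) = c * t n"
    proof -
      have "pochhammer (c + 1) n * c = pochhammer c n * (c + real n)"
        using pochhammer_rec [of c n] pochhammer_rec' [of c n] by (simp add: mult_ac)
      moreover have "pochhammer c n \<noteq> 0" "pochhammer (c + 1) n \<noteq> 0"
        using c c1 pochhammer_eq_0_imp_nonpos_Int by auto
      ultimately show ?thesis
        unfolding t_def hyp_coeff_def by (simp add: divide_simps) (simp add: algebra_simps)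
    qed
    hence h: "hyp_coeff a b (c + 1) n = c * t n / (c + real n)"
      using cn [of n] by (simp add: field_simps)
    have "t (Suc n) * (real n + 1) = (a + real n) * (b + real n) * t n / (c + real n)"
      using hyp_coeff_Suc [OF cn, of a b n] cn [of n] unfolding t_def by (simp add: field_simps)
    hence "V (Suc n) = (a + real n) * (b + real n) * t n / (c + real n)"
      by (simp add: V_def algebra_simps)
    moreover have "V n = real n * t n" by (simp add: V_def)
    ultimately show ?thesis unfolding h using cn [of n]
      by (simp add: divide_simps) (simp add: algebra_simps)
  qed
  ultimately have "(\<lambda>n. c * (c - a - b) * t n - (c - a) * (c - b) * hyp_coeff a b (c + 1) n) sums 0"
    by (simp add: V_def)
  moreover have "(\<lambda>n. c * (c - a - b) * t n - (c - a) * (c - b) * hyp_coeff a b (c + 1) n) sums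
      (c * (c - a - b) * suminf t - (c - a) * (c - b) * suminf (hyp_coeff a b (c + 1)))"
    by (intro sums_diff sums_mult summable_sums s1 s2)
  ultimately have "c * (c - a - b) * suminf t - (c - a) * (c - b) * suminf (hyp_coeff a b (c + 1)) = 0"
    by (rule sums_unique2 [symmetric])
  thus ?thesis by (simp add: t_def)
qed

text \<open>All terms but the zeroth are O(1/c) uniformly. The factor \<open>c0 / x\<close> comes
  from the first factor of the Pochhammer symbol in the denominator, and the remaining factors only
  grow with the parameter, so the tail is dominated by a fixed convergent series.\<close>

lemma hyp_sum_tendsto_1:
  assumes c: "c \<notin> \<int>\<^sub>\<le>\<^sub>0" and pos: "c - a - b > 0"
  shows "(\<lambda>N. suminf (hyp_coeff a b (c + real N))) \<longlonglongrightarrow> 1"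
proof -
  \<comment> \<open>\<open>c\<close> may be negative; the comparison starts at a shifted parameter
    \<open>c0\<close>, from which on all Pochhammer symbols in the denominators are
    positive.\<close>
  obtain N0 :: nat where N0: "real N0 > \<bar>c\<bar>" using reals_Archimedean2 by blast
  define c0 where "c0 = c + real N0"
  have c0: "c0 > 0" using N0 by (simp add: c0_def)
  have s: "summable (\<lambda>n. \<bar>hyp_coeff a b (x) n\<bar>)" if "x \<ge> c0" for x
    by (rule hyp_coeff_abs_summable) (use that c0 pos in \<open>auto simp: c0_def\<close>)
  define K where "K = (\<Sum>n. \<bar>hyp_coeff a b c0 (Suc n)\<bar>)"
  have bound: "\<bar>suminf (hyp_coeff a b x) - 1\<bar> \<le> c0 / x * K" if x: "x \<ge> c0" for x
  proof -
    have sx: "summable (\<lambda>n. \<bar>hyp_coeff a b x (Suc n)\<bar>)"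
      using s [OF x] by (subst summable_Suc_iff)
    have "suminf (hyp_coeff a b x) = (\<Sum>n. hyp_coeff a b x (Suc n)) + 1"
      using suminf_split_head [of "hyp_coeff a b x"] summable_rabs_cancel [OF s [OF x]] by simp
    hence "\<bar>suminf (hyp_coeff a b x) - 1\<bar> \<le> (\<Sum>n. \<bar>hyp_coeff a b x (Suc n)\<bar>)"
      using summable_rabs [OF sx] by simp
    also have "\<dots> \<le> (\<Sum>n. c0 / x * \<bar>hyp_coeff a b c0 (Suc n)\<bar>)"
    proof (rule suminf_le)
      fix n
      have p1: "pochhammer c0 n \<le> pochhammer (x::real) n" if "x \<ge> c0" for x n
        using that c0 by (simp add: pochhammer_prod prod_mono)
      have "pochhammer c0 (Suc n) * (x / c0) = x * pochhammer (c0 + 1) n"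
        using c0 by (simp add: pochhammer_rec)
      also have "\<dots> \<le> x * pochhammer (x + 1) n"
        using x c0 by (intro mult_left_mono) (simp_all add: pochhammer_prod prod_mono)
      finally have le: "pochhammer c0 (Suc n) * (x / c0) \<le> pochhammer x (Suc n)"
        by (simp add: pochhammer_rec)
      have pp: "pochhammer c0 (Suc n) > 0" "pochhammer x (Suc n) > 0"
        using c0 x by (auto intro!: pochhammer_pos)
      have "1 / pochhammer x (Suc n) \<le> c0 / x * (1 / pochhammer c0 (Suc n))"
        using le pp c0 x by (simp add: field_simps)
      hence "\<bar>pochhammer a (Suc n) * pochhammer b (Suc n) / fact (Suc n)\<bar> * (1 / pochhammer x (Suc n)) \<le>
          \<bar>pochhammer a (Suc n) * pochhammer b (Suc n) / fact (Suc n)\<bar> * (c0 / x * (1 / pochhammer c0 (Suc n)))"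
        by (intro mult_left_mono) auto
      thus "\<bar>hyp_coeff a b x (Suc n)\<bar> \<le> c0 / x * \<bar>hyp_coeff a b c0 (Suc n)\<bar>"
        using pp unfolding hyp_coeff_def by (simp add: abs_mult mult_ac)
    next
      show "summable (\<lambda>n. c0 / x * \<bar>hyp_coeff a b c0 (Suc n)\<bar>)"
        using s [of c0] by (intro summable_mult) (subst summable_Suc_iff, simp)
    qed (fact sx)
    also have "\<dots> = c0 / x * K"
      unfolding K_def using s [of c0] by (intro suminf_mult) (subst summable_Suc_iff, simp)
    finally show ?thesis .
  qed
  have "(\<lambda>N. suminf (hyp_coeff a b (c + real N)) - 1) \<longlonglongrightarrow> 0"
  proof (rule Lim_null_comparison)
    show "\<forall>\<^sub>F N in sequentially. norm (suminf (hyp_coeff a b (c + real N)) - 1) \<le> c0 / (c + real N) * K"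
      using eventually_ge_at_top [of N0] by eventually_elim (auto simp only: real_norm_def c0_def intro!: bound [unfolded c0_def])
    show "(\<lambda>N. c0 / (c + real N) * K) \<longlonglongrightarrow> 0" by real_asymp
  qed
  thus ?thesis by (simp add: LIM_zero_iff)
qed

text \<open>The contiguous relation raises \<open>c\<close> by one at the cost of a rational factor.
  After N steps these factors form a quotient of Pochhammer symbols whose parameter sums agree, (c -
  a) + (c - b) = c + (c - a - b), so it tends to the Gamma quotient, while the remaining sum tends
  to 1.\<close>

theorem Gauss_hypergeometric_sums:
  assumes c: "c \<notin> \<int>\<^sub>\<le>\<^sub>0" and pos: "c - a - b > 0"
  shows "hyp_coeff a b c sums (Gamma c * Gamma (c - a - b) * rGamma (c - a) * rGamma (c - b))"
proof -
  define S where "S = (\<lambda>N. suminf (hyp_coeff a b (c + real N)))"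
  define R where "R = (\<lambda>N. pochhammer (c - a) N * pochhammer (c - b) N / (pochhammer c N * pochhammer (c - a - b) N))"
  have pos': "c - a - b \<notin> \<int>\<^sub>\<le>\<^sub>0" using pos by auto
  have SR: "S 0 = R N * S N" for N
  proof (induction N)
    case (Suc N)
    define x where "x = c + real N"
    have x: "x \<notin> \<int>\<^sub>\<le>\<^sub>0" using not_nonpos_Ints_plus [OF c, of N] by (simp add: x_def)
    have "(x - a) * (x - b) * S (Suc N) = x * (x - a - b) * S N"
      using hyp_sum_contiguous [OF x, of a b] pos by (simp add: S_def x_def add_ac)
    moreover have "x \<noteq> 0" "x - a - b \<noteq> 0" using x pos by (auto simp: x_def)
    ultimately have "S N = (x - a) * (x - b) / (x * (x - a - b)) * S (Suc N)"
      by (simp add: divide_simps)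
    moreover have "R (Suc N) = R N * ((x - a) * (x - b) / (x * (x - a - b)))"
    proof -
      have eqs: "c - a + real N = x - a" "c - b + real N = x - b"
                "c - a - b + real N = x - a - b" "c + real N = x"
        by (simp_all add: x_def)
      show ?thesis
        unfolding R_def pochhammer_Suc eqs by (simp add: mult_ac)
    qed
    ultimately show ?case using Suc.IH by simp
  qed (simp add: R_def)
  have "(\<lambda>N. R N * S N) \<longlonglongrightarrow> Gamma c * Gamma (c - a - b) * rGamma (c - a) * rGamma (c - b) * 1"
    unfolding R_def S_def
    by (intro tendsto_mult [OF pochhammer_pair_quotient_tendsto hyp_sum_tendsto_1]) (use assms pos' in auto)
  hence "S 0 = Gamma c * Gamma (c - a - b) * rGamma (c - a) * rGamma (c - b)"
    unfolding SR [symmetric] by (simp add: LIMSEQ_const_iff)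
  thus ?thesis
    using summable_sums [OF hyp_coeff_summable [OF c pos]] by (simp add: S_def)
qed

subsection \<open>Moments of squares of solutions of the hypergeometric equation\<close>

lemma powr_add_one: "x \<ge> 0 \<Longrightarrow> x powr (y + 1) = x * x powr (y::real)"
  by (cases "x = 0") (auto simp: powr_add)

text \<open>The integrand is the derivative of t^u (1-t)^d Q(t), whose boundary values vanish since
  both exponents are positive. The three moment identities below are instances of it.\<close>

lemma has_integral_powr_total_derivative:
  fixes Q Q1 :: "real \<Rightarrow> real"
  assumes u: "u > 0" and d: "d > 0"
    and cont: "continuous_on {0..1} Q"
    and deriv: "\<And>t. 0 < t \<Longrightarrow> t < 1 \<Longrightarrow> (Q has_real_derivative Q1 t) (at t)"
  shows "((\<lambda>t. t powr (u - 1) * (1 - t) powr (d - 1) * ((u * (1 - t) - d * t) * Q t + t * (1 - t) * Q1 t))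
      has_integral 0) {0..1}"
    (is "(?g has_integral _) _")
proof -
  define U where "U = (\<lambda>t. t powr u * (1 - t) powr d * Q t)"
  have "(?g has_integral (U 1 - U 0)) {0..1}"
  proof (rule fundamental_theorem_of_calculus_interior)
    show "continuous_on {0..1} U"
      unfolding U_def using u d by (intro continuous_intros continuous_on_powr' cont) auto
    fix t :: real assume t: "t \<in> {0<..<1}"
    have p1: "t powr u = t * t powr (u - 1)" "(1 - t) powr d = (1 - t) * (1 - t) powr (d - 1)"
      using powr_add_one [of t "u - 1"] powr_add_one [of "1 - t" "d - 1"] t by auto
    have "(U has_real_derivative
        (u * t powr (u - 1) * (1 - t) powr d - t powr u * (d * (1 - t) powr (d - 1))) * Q t
        + t powr u * (1 - t) powr d * Q1 t) (at t)"
      unfolding U_def using t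
      by (auto intro!: derivative_eq_intros deriv simp: algebra_simps)
    also have "(u * t powr (u - 1) * (1 - t) powr d - t powr u * (d * (1 - t) powr (d - 1))) * Q t
        + t powr u * (1 - t) powr d * Q1 t = ?g t"
      unfolding p1 by (simp add: algebra_simps)
    finally show "(U has_vector_derivative ?g t) (at t)"
      by (simp add: has_real_derivative_iff_has_vector_derivative)
  qed simp
  thus ?thesis using u d by (simp add: U_def)
qed

text \<open>
  In self-adjoint form the equation reads \<open>(\<rho> t (1-t) G')' = a b \<rho> G\<close> with
  \<open>\<rho> = t^(c-1) (1-t)^(-\<kappa>)\<close> and \<open>\<kappa> = c - a - b\<close>. The moments below are indexed by the exponent \<open>r\<close> in the
  weight \<open>\<rho> (1-t)^r\<close>; this makes the recurrences for \<open>F\<close> and \<open>f\<close> comparable.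
\<close>

locale hypergeometric_ode =
  fixes a b c :: real and G G1 G2 :: "real \<Rightarrow> real"
  assumes c_gt_1: "c > 1"
    and cont_G: "continuous_on {0..1} G" and cont_G1: "continuous_on {0..1} G1"
    and deriv_G: "\<And>t. 0 < t \<Longrightarrow> t < 1 \<Longrightarrow> (G has_real_derivative G1 t) (at t)"
    and deriv_G1: "\<And>t. 0 < t \<Longrightarrow> t < 1 \<Longrightarrow> (G1 has_real_derivative G2 t) (at t)"
    and ode: "\<And>t. 0 < t \<Longrightarrow> t < 1 \<Longrightarrow> t * (1 - t) * G2 t + (c - (a + b + 1) * t) * G1 t - a * b * G t = 0"
begin

definition \<kappa> where "\<kappa> = c - a - b"

definition sq_moment :: "real \<Rightarrow> real" where
  "sq_moment r = integral {0..1} (\<lambda>t. t powr (c - 1) * (1 - t) powr (r - \<kappa>) * (G t)\<^sup>2)"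

text \<open>Compared with \<open>sq_moment\<close> the weight here and in
  \<open>deriv_moment\<close> has an extra factor t (1-t), the one that stands next to G' in the
  self-adjoint form. It makes the family of moments closed under integration by parts.\<close>

definition mixed_moment :: "real \<Rightarrow> real" where
  "mixed_moment r = integral {0..1} (\<lambda>t. t powr c * (1 - t) powr (r + 1 - \<kappa>) * (G t * G1 t))"

definition deriv_moment :: "real \<Rightarrow> real" where
  "deriv_moment r = integral {0..1} (\<lambda>t. t powr c * (1 - t) powr (r + 1 - \<kappa>) * (G1 t)\<^sup>2)"

lemma has_integral_sq_moment:
  assumes "r - \<kappa> > 0"
  shows "((\<lambda>t. t powr (c - 1) * (1 - t) powr (r - \<kappa>) * (G t)\<^sup>2) has_integral sq_moment r) {0..1}"
  unfolding sq_moment_def using assms c_gt_1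
  by (intro integrable_integral integrable_continuous_real continuous_intros continuous_on_powr' cont_G) auto

lemma has_integral_mixed_moment:
  assumes "r + 1 - \<kappa> > 0"
  shows "((\<lambda>t. t powr c * (1 - t) powr (r + 1 - \<kappa>) * (G t * G1 t)) has_integral mixed_moment r) {0..1}"
  unfolding mixed_moment_def using assms c_gt_1
  by (intro integrable_integral integrable_continuous_real continuous_intros continuous_on_powr' cont_G cont_G1) auto

lemma has_integral_deriv_moment:
  assumes "r + 1 - \<kappa> > 0"
  shows "((\<lambda>t. t powr c * (1 - t) powr (r + 1 - \<kappa>) * (G1 t)\<^sup>2) has_integral deriv_moment r) {0..1}"
  unfolding deriv_moment_def using assms c_gt_1
  by (intro integrable_integral integrable_continuous_real continuous_intros continuous_on_powr' cont_G1) auto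

text \<open>Integrate the derivative of t^c (1-t)^(r+1-\<kappa>) G^2, and write t as 1 - (1-t) to
  return to moments with indices r and r + 1.\<close>

lemma mixed_moment_eq:
  assumes r: "r - \<kappa> > 0"
  shows "(\<kappa> - 1 - r) * sq_moment r + (c - \<kappa> + 1 + r) * sq_moment (r + 1) + 2 * mixed_moment r = 0"
proof -
  have "((\<lambda>t. t powr (c - 1) * (1 - t) powr (r - \<kappa> + 1 - 1) *
      ((c * (1 - t) - (r - \<kappa> + 1) * t) * (G t)\<^sup>2 + t * (1 - t) * (2 * G t * G1 t))) has_integral 0) {0..1}"
    (is "(?f has_integral _) _")
    by (rule has_integral_powr_total_derivative)
       (use r c_gt_1 in \<open>auto intro!: derivative_eq_intros deriv_G continuous_intros cont_G\<close>)
  also have "?this \<longleftrightarrow> ((\<lambda>t. (\<kappa> - 1 - r) * (t powr (c - 1) * (1 - t) powr (r - \<kappa>) * (G t)\<^sup>2) +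
      (c - \<kappa> + 1 + r) * (t powr (c - 1) * (1 - t) powr (r + 1 - \<kappa>) * (G t)\<^sup>2) +
      2 * (t powr c * (1 - t) powr (r + 1 - \<kappa>) * (G t * G1 t))) has_integral 0) {0..1}"
    (is "_ \<longleftrightarrow> (?g has_integral _) _")
  proof (rule has_integral_cong)
    fix t :: real assume t: "t \<in> {0..1}"
    have p: "t powr c = t * t powr (c - 1)" "(1 - t) powr (r + 1 - \<kappa>) = (1 - t) * (1 - t) powr (r - \<kappa>)"
            "r - \<kappa> + 1 - 1 = r - \<kappa>"
      using powr_add_one [of t "c - 1"] powr_add_one [of "1 - t" "r - \<kappa>"] t
      by (auto simp: algebra_simps)
    show "?f t = ?g t"
      unfolding p by (simp add: algebra_simps)
  qed
  finally show ?thesis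
    using r by (elim has_integral_unique [rotated])
               (intro has_integral_add has_integral_mult_right has_integral_sq_moment has_integral_mixed_moment; simp)
qed

text \<open>Integrate the derivative of t^c (1-t)^(r+1-\<kappa>) G G' and remove G'' by the
  equation. By self-adjointness only differentiating (1-t)^r leaves a term in G G', whence the
  coefficient r.\<close>

lemma deriv_moment_eq:
  assumes r: "r - \<kappa> > 0"
  shows "deriv_moment r + a * b * sq_moment r - r * mixed_moment (r - 1) = 0"
proof -
  have "((\<lambda>t. t powr (c - 1) * (1 - t) powr (r - \<kappa> + 1 - 1) *
      ((c * (1 - t) - (r - \<kappa> + 1) * t) * (G t * G1 t) + t * (1 - t) * (G1 t * G1 t + G2 t * G t))) has_integral 0) {0..1}"
    (is "(?f has_integral _) _")
    by (rule has_integral_powr_total_derivative)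
       (use r c_gt_1 in \<open>auto intro!: derivative_eq_intros deriv_G deriv_G1 continuous_intros cont_G cont_G1\<close>)
  also have "?this \<longleftrightarrow> ((\<lambda>t. t powr c * (1 - t) powr (r + 1 - \<kappa>) * (G1 t)\<^sup>2 +
      a * b * (t powr (c - 1) * (1 - t) powr (r - \<kappa>) * (G t)\<^sup>2) -
      r * (t powr c * (1 - t) powr (r - 1 + 1 - \<kappa>) * (G t * G1 t))) has_integral 0) {0..1}"
    (is "_ \<longleftrightarrow> (?g has_integral _) _")
  proof (rule has_integral_spike_eq [of "{0, 1}"])
    fix t :: real assume t: "t \<in> {0..1} - {0, 1}"
    have p: "t powr c = t * t powr (c - 1)" "(1 - t) powr (r + 1 - \<kappa>) = (1 - t) * (1 - t) powr (r - \<kappa>)"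
            "r - \<kappa> + 1 - 1 = r - \<kappa>" "r - 1 + 1 - \<kappa> = r - \<kappa>"
      using powr_add_one [of t "c - 1"] powr_add_one [of "1 - t" "r - \<kappa>"] t
      by (auto simp: algebra_simps)
    have o: "t * (1 - t) * G2 t = a * b * G t - (c - (a + b + 1) * t) * G1 t"
      using ode [of t] t by auto
    have k: "\<kappa> = c - a - b" by (fact \<kappa>_def)
    have e: "(c * (1 - t) - (r - \<kappa> + 1) * t) * (G t * G1 t) + t * (1 - t) * (G1 t * G1 t + G2 t * G t) =
        t * (1 - t) * (G1 t)\<^sup>2 + a * b * (G t)\<^sup>2 - r * t * (G t * G1 t)"
      using o k by algebra
    show "?g t = ?f t"
      unfolding e p by (simp add: algebra_simps)
  qed simp
  finally show ?thesis
    using r by (elim has_integral_unique [rotated])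
      (intro has_integral_add has_integral_diff has_integral_mult_right has_integral_sq_moment
             has_integral_mixed_moment has_integral_deriv_moment; simp)
qed

text \<open>Same method with t^(c+1) (1-t)^(r+2-\<kappa>) G'^2. One more power of t (1-t) than
  before is needed to absorb the G'' that arises from G'^2.\<close>

lemma deriv_moment_step:
  assumes r: "r - \<kappa> > 0"
  shows "(r + 1 + \<kappa> - c) * deriv_moment (r + 1) - (r + \<kappa>) * deriv_moment r + 2 * (a * b) * mixed_moment r = 0"
proof -
  have "((\<lambda>t. t powr (c + 1 - 1) * (1 - t) powr (r + 2 - \<kappa> - 1) *
      (((c + 1) * (1 - t) - (r + 2 - \<kappa>) * t) * (G1 t)\<^sup>2 + t * (1 - t) * (2 * G1 t * G2 t))) has_integral 0) {0..1}"
    (is "(?f has_integral _) _")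
    by (rule has_integral_powr_total_derivative)
       (use r c_gt_1 in \<open>auto intro!: derivative_eq_intros deriv_G1 continuous_intros cont_G1\<close>)
  also have "?this \<longleftrightarrow> ((\<lambda>t. (r + 1 + \<kappa> - c) * (t powr c * (1 - t) powr (r + 1 + 1 - \<kappa>) * (G1 t)\<^sup>2) -
      (r + \<kappa>) * (t powr c * (1 - t) powr (r + 1 - \<kappa>) * (G1 t)\<^sup>2) +
      2 * (a * b) * (t powr c * (1 - t) powr (r + 1 - \<kappa>) * (G t * G1 t))) has_integral 0) {0..1}"
    (is "_ \<longleftrightarrow> (?g has_integral _) _")
  proof (rule has_integral_spike_eq [of "{0, 1}"])
    fix t :: real assume t: "t \<in> {0..1} - {0, 1}"
    have p: "(1 - t) powr (r + 1 + 1 - \<kappa>) = (1 - t) * (1 - t) powr (r + 1 - \<kappa>)"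
            "r + 2 - \<kappa> - 1 = r + 1 - \<kappa>" "c + 1 - 1 = c"
      using powr_add_one [of "1 - t" "r + 1 - \<kappa>"] t
      by (auto simp: algebra_simps)
    have o: "t * (1 - t) * G2 t = a * b * G t - (c - (a + b + 1) * t) * G1 t"
      using ode [of t] t by auto
    have k: "\<kappa> = c - a - b" by (fact \<kappa>_def)
    have e: "((c + 1) * (1 - t) - (r + 2 - \<kappa>) * t) * (G1 t)\<^sup>2 + t * (1 - t) * (2 * G1 t * G2 t) =
        (r + 1 + \<kappa> - c) * (1 - t) * (G1 t)\<^sup>2 - (r + \<kappa>) * (G1 t)\<^sup>2 + 2 * (a * b) * (G t * G1 t)"
      using o k by algebra
    show "?g t = ?f t"
      unfolding e p by (simp add: algebra_simps)
  qed simp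
  finally show ?thesis
    using r by (elim has_integral_unique [rotated])
      (intro has_integral_add has_integral_diff has_integral_mult_right
             has_integral_mixed_moment has_integral_deriv_moment; simp)
qed

text \<open>\<open>mixed_moment\<close> is a combination of two consecutive square moments, and
  \<open>deriv_moment\<close> a combination of a mixed and a square moment; inserting both into
  \<open>deriv_moment_step\<close> leaves three consecutive square moments. The hypothesis makes the
  relations available down to index r - 1.\<close>

lemma sq_moment_recurrence:
  assumes "r - 1 - \<kappa> > 0"
  shows "(2 * (r + 1 + \<kappa> - c) * (a * b) + ((r + 1 + \<kappa> - c) * (r + 1) + 2 * (a * b)) * (r + 1 + c - \<kappa>)) * sq_moment (r + 1)
      - ((r + \<kappa>) * r * (r + c - \<kappa>) + 2 * (a * b) * (r + \<kappa>) + ((r + 1 + \<kappa> - c) * (r + 1) + 2 * (a * b)) * (r + 1 - \<kappa>)) * sq_moment r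
      + (r + \<kappa>) * r * (r - \<kappa>) * sq_moment (r - 1) = 0"
proof -
  have 1: "2 * mixed_moment r = (r + 1 - \<kappa>) * sq_moment r - (r + 1 + c - \<kappa>) * sq_moment (r + 1)"
    using mixed_moment_eq [of r] assms by (simp add: algebra_simps)
  have 2: "2 * mixed_moment (r - 1) = (r - \<kappa>) * sq_moment (r - 1) - (r + c - \<kappa>) * sq_moment r"
    using mixed_moment_eq [of "r - 1"] assms by (simp add: algebra_simps)
  have 3: "deriv_moment r = r * mixed_moment (r - 1) - a * b * sq_moment r"
    using deriv_moment_eq [of r] assms by simp
  have 4: "deriv_moment (r + 1) = (r + 1) * mixed_moment r - a * b * sq_moment (r + 1)"
    using deriv_moment_eq [of "r + 1"] assms by simp
  have 5: "(r + 1 + \<kappa> - c) * deriv_moment (r + 1) - (r + \<kappa>) * deriv_moment r + 2 * (a * b) * mixed_moment r = 0"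
    using deriv_moment_step [of r] assms by simp
  show ?thesis using 1 2 3 4 5 by algebra
qed

end

subsection \<open>Hypergeometric series on the unit interval\<close>

lemma continuous_on_power_series_unit_interval:
  fixes y :: "nat \<Rightarrow> real"
  assumes "summable (\<lambda>n. \<bar>y n\<bar>)"
  shows "continuous_on {0..1} (\<lambda>t. \<Sum>n. y n * t ^ n)"
proof -
  have "uniform_limit {0..1} (\<lambda>N t. \<Sum>n<N. y n * t ^ n) (\<lambda>t. \<Sum>n. y n * t ^ n) sequentially"
  proof (rule Weierstrass_m_test [where M = "\<lambda>n. \<bar>y n\<bar>"])
    fix n and t :: real assume "t \<in> {0..1}"
    thus "norm (y n * t ^ n) \<le> \<bar>y n\<bar>"
      by (simp add: abs_mult mult_left_le power_le_one)
  qed fact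
  thus ?thesis
    by (rule uniform_limit_theorem [rotated]) (auto intro!: always_eventually continuous_intros)
qed

lemma summable_power_series_unit_interval:
  fixes y :: "nat \<Rightarrow> real"
  assumes "summable (\<lambda>n. \<bar>y n\<bar>)" "\<bar>t\<bar> \<le> 1"
  shows "summable (\<lambda>n. y n * t ^ n)"
  by (rule summable_comparison_test' [OF assms(1), of 0])
     (use assms(2) in \<open>simp add: abs_mult power_abs mult_left_le power_le_one\<close>)

text \<open>The recurrence is assumed in multiplied form, without division by n + c, so that the
  lemma also covers a terminating series with a non-positive integer as lower parameter. The
  equation is then obtained by comparing coefficients.\<close>

lemma power_series_hypergeometric_ode:
  fixes x :: "nat \<Rightarrow> real"
  assumes rec: "\<And>n. (real n + 1) * (real n + c) * x (Suc n) = (real n + a) * (real n + b) * x n"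
    and sm: "\<And>t. \<bar>t\<bar> < 1 \<Longrightarrow> summable (\<lambda>n. x n * t ^ n)"
    and t: "\<bar>t\<bar> < 1"
  shows "((\<lambda>t. \<Sum>n. x n * t ^ n) has_real_derivative (\<Sum>n. diffs x n * t ^ n)) (at t)"
    and "((\<lambda>t. \<Sum>n. diffs x n * t ^ n) has_real_derivative (\<Sum>n. diffs (diffs x) n * t ^ n)) (at t)"
    and "t * (1 - t) * (\<Sum>n. diffs (diffs x) n * t ^ n) + (c - (a + b + 1) * t) * (\<Sum>n. diffs x n * t ^ n)
        - a * b * (\<Sum>n. x n * t ^ n) = 0"
proof -
  have sm1: "summable (\<lambda>n. diffs x n * t ^ n)" if "\<bar>t\<bar> < 1" for t
    using termdiff_converges [of t 1 x] sm that by simp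
  have sm2: "summable (\<lambda>n. diffs (diffs x) n * t ^ n)"
    using termdiff_converges [of t 1 "diffs x"] sm1 t by simp
  show "((\<lambda>t. \<Sum>n. x n * t ^ n) has_real_derivative (\<Sum>n. diffs x n * t ^ n)) (at t)"
    by (rule termdiffs_strong' [where K = 1]) (use sm t in auto)
  show "((\<lambda>t. \<Sum>n. diffs x n * t ^ n) has_real_derivative (\<Sum>n. diffs (diffs x) n * t ^ n)) (at t)"
    by (rule termdiffs_strong' [where K = 1]) (use sm1 t in auto)
  define u u1 u2 where "u = (\<Sum>n. x n * t ^ n)" "u1 = (\<Sum>n. diffs x n * t ^ n)" "u2 = (\<Sum>n. diffs (diffs x) n * t ^ n)"
  have s0: "(\<lambda>n. x n * t ^ n) sums u" and s1: "(\<lambda>n. diffs x n * t ^ n) sums u1"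
   and s2: "(\<lambda>n. diffs (diffs x) n * t ^ n) sums u2"
    using sm [OF t] sm1 [OF t] sm2 by (auto simp: u_u1_u2_def)
  \<comment> \<open>Multiplication by t shifts the index by one; the factor \<open>real n\<close>
    makes the new zeroth term vanish. The same holds for \<open>sE\<close> and
    \<open>sB\<close>.\<close>
  have sA: "(\<lambda>n. real n * (real n + 1) * x (Suc n) * t ^ n) sums (t * u2)"
    using sums_Suc [where f = "\<lambda>n. real n * (real n + 1) * x (Suc n) * t ^ n" and l = "t * u2"]
          sums_mult [OF s2, of t] by (simp add: diffs_def mult_ac add_ac)
  have sE: "(\<lambda>n. real n * x n * t ^ n) sums (t * u1)"
    using sums_Suc [where f = "\<lambda>n. real n * x n * t ^ n" and l = "t * u1"]
          sums_mult [OF s1, of t] by (simp add: diffs_def mult_ac add_ac)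
  have sB: "(\<lambda>n. real n * (real n - 1) * x n * t ^ n) sums (t * (t * u2))"
    using sums_Suc [where f = "\<lambda>n. real n * (real n - 1) * x n * t ^ n" and l = "t * (t * u2)"]
          sums_mult [OF sA, of t] by (simp add: mult_ac add_ac)
  have "(\<lambda>n. real n * (real n + 1) * x (Suc n) * t ^ n - real n * (real n - 1) * x n * t ^ n
      + c * (diffs x n * t ^ n) - (a + b + 1) * (real n * x n * t ^ n) - a * b * (x n * t ^ n))
      sums (t * u2 - t * (t * u2) + c * u1 - (a + b + 1) * (t * u1) - a * b * u)"
    (is "?S sums _")
    by (intro sums_add sums_diff sums_mult sA sB sE s0 s1)
  also have "?S = (\<lambda>n. 0)"
  proof
    fix n
    have "?S n = ((real n + 1) * (real n + c) * x (Suc n) - (real n + a) * (real n + b) * x n) * t ^ n"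
      by (simp add: diffs_def algebra_simps)
    thus "?S n = 0"
      using rec [of n] by simp
  qed
  finally have "t * u2 - t * (t * u2) + c * u1 - (a + b + 1) * (t * u1) - a * b * u = 0"
    by (simp add: sums_iff)
  thus "t * (1 - t) * (\<Sum>n. diffs (diffs x) n * t ^ n) + (c - (a + b + 1) * t) * (\<Sum>n. diffs x n * t ^ n)
      - a * b * (\<Sum>n. x n * t ^ n) = 0"
    unfolding u_u1_u2_def [symmetric] by (simp add: algebra_simps)
qed

definition hyp_fun :: "real \<Rightarrow> real \<Rightarrow> real \<Rightarrow> real \<Rightarrow> real" where
  "hyp_fun a b c t = (\<Sum>n. hyp_coeff a b c n * t ^ n)"

definition hyp_fun1 :: "real \<Rightarrow> real \<Rightarrow> real \<Rightarrow> real \<Rightarrow> real" where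
  "hyp_fun1 a b c t = (\<Sum>n. diffs (hyp_coeff a b c) n * t ^ n)"

definition hyp_fun2 :: "real \<Rightarrow> real \<Rightarrow> real \<Rightarrow> real \<Rightarrow> real" where
  "hyp_fun2 a b c t = (\<Sum>n. diffs (diffs (hyp_coeff a b c)) n * t ^ n)"

lemma hyp_fun_0 [simp]: "hyp_fun a b c 0 = 1"
  by (simp add: hyp_fun_def)

lemma hyp_coeff_rec:
  assumes "c \<notin> \<int>\<^sub>\<le>\<^sub>0"
  shows "(real n + 1) * (real n + c) * hyp_coeff a b c (Suc n) = (real n + a) * (real n + b) * hyp_coeff a b c n"
  using hyp_coeff_Suc [OF not_nonpos_Ints_add_nat [OF assms], of a b n] by (simp add: algebra_simps)

lemma summable_diffs_hyp_coeff:
  assumes c: "c \<notin> \<int>\<^sub>\<le>\<^sub>0" and \<kappa>: "c - a - b > 1"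
  shows "summable (\<lambda>n. \<bar>diffs (hyp_coeff a b c) n\<bar>)"
proof -
  obtain C where C: "C > 0" "\<And>n. \<bar>hyp_coeff a b c n\<bar> \<le> C * (real n + 1) powr (a + b - c - 1)"
    using hyp_coeff_bound [OF c] by blast
  have "summable (\<lambda>n. C * (real (Suc n) + 1) powr (a + b - c))"
    using \<kappa> by (intro summable_mult, subst summable_Suc_iff) (simp add: summable_real_powr_shift)
  thus ?thesis
  proof (rule summable_comparison_test')
    fix n
    have "norm \<bar>diffs (hyp_coeff a b c) n\<bar> \<le> (real (Suc n) + 1) * (C * (real (Suc n) + 1) powr (a + b - c - 1))"
      unfolding diffs_def real_norm_def abs_abs abs_mult
      by (intro mult_mono C(2)) (use C(1) in auto)
    also have "\<dots> = C * ((real (Suc n) + 1) * (real (Suc n) + 1) powr (a + b - c - 1))"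
      by simp
    also have "(real (Suc n) + 1) * (real (Suc n) + 1) powr (a + b - c - 1) = (real (Suc n) + 1) powr (a + b - c)"
      using powr_add_one [of "real (Suc n) + 1" "a + b - c - 1"] by simp
    finally show "norm \<bar>diffs (hyp_coeff a b c) n\<bar> \<le> C * (real (Suc n) + 1) powr (a + b - c)" .
  qed
qed

text \<open>The gap c - a - b > 1, rather than > 0, makes the differentiated series absolutely
  convergent at t = 1, so that the derivative is continuous on the closed interval. For F the gap is
  2p - 1 \<ge> 2, for f it is m + p - 1 \<ge> 3/2.\<close>

lemma hypergeometric_ode_hyp_fun:
  assumes c: "c > 1" and \<kappa>: "c - a - b > 1"
  shows "hypergeometric_ode a b c (hyp_fun a b c) (hyp_fun1 a b c) (hyp_fun2 a b c)"
proof
  have c': "c \<notin> \<int>\<^sub>\<le>\<^sub>0" using c by auto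
  have s: "summable (\<lambda>n. \<bar>hyp_coeff a b c n\<bar>)"
    by (rule hyp_coeff_abs_summable) (use c' \<kappa> in auto)
  show "continuous_on {0..1} (hyp_fun a b c)" "continuous_on {0..1} (hyp_fun1 a b c)"
    unfolding hyp_fun_def hyp_fun1_def
    by (intro continuous_on_power_series_unit_interval s summable_diffs_hyp_coeff c' \<kappa>)+
  fix t :: real assume t: "0 < t" "t < 1"
  have sm: "\<And>t. \<bar>t\<bar> < 1 \<Longrightarrow> summable (\<lambda>n. hyp_coeff a b c n * t ^ n)"
    using summable_power_series_unit_interval [OF s] by simp
  have t': "\<bar>t\<bar> < 1" using t by simp
  note ode = power_series_hypergeometric_ode [OF hyp_coeff_rec [OF c'] sm t']
  show "(hyp_fun a b c has_real_derivative hyp_fun1 a b c t) (at t)"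
    unfolding hyp_fun_def [abs_def] hyp_fun1_def by (rule ode(1))
  show "(hyp_fun1 a b c has_real_derivative hyp_fun2 a b c t) (at t)"
    unfolding hyp_fun1_def [abs_def] hyp_fun2_def by (rule ode(2))
  show "t * (1 - t) * hyp_fun2 a b c t + (c - (a + b + 1) * t) * hyp_fun1 a b c t - a * b * hyp_fun a b c t = 0"
    unfolding hyp_fun_def [abs_def] hyp_fun1_def hyp_fun2_def by (rule ode(3))
qed fact

text \<open>The linear bound at t = 0 yields the asymptotics of the moments, the uniform bound the
  domination in the termwise integration.\<close>

lemma hyp_fun_near_0:
  assumes c: "c \<notin> \<int>\<^sub>\<le>\<^sub>0" and \<kappa>: "c - a - b > 0"
  shows "\<exists>K\<ge>0. \<forall>t\<in>{0..1}. \<bar>(hyp_fun a b c t)\<^sup>2 - 1\<bar> \<le> K * t \<and> \<bar>hyp_fun a b c t\<bar> \<le> K + 1"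
proof -
  have s: "summable (\<lambda>n. \<bar>hyp_coeff a b c n\<bar>)" by (rule hyp_coeff_abs_summable [OF assms])
  hence s': "summable (\<lambda>n. \<bar>hyp_coeff a b c (Suc n)\<bar>)" by (subst summable_Suc_iff)
  define L where "L = (\<Sum>n. \<bar>hyp_coeff a b c (Suc n)\<bar>)"
  have L: "L \<ge> 0" unfolding L_def by (rule suminf_nonneg [OF s']) simp
  have b1: "\<bar>hyp_fun a b c t - 1\<bar> \<le> L * t" if t: "0 \<le> t" "t \<le> 1" for t
  proof -
    have sm: "summable (\<lambda>n. hyp_coeff a b c n * t ^ n)"
      by (rule summable_power_series_unit_interval [OF s]) (use t in auto)
    have "hyp_fun a b c t - 1 = (\<Sum>n. hyp_coeff a b c (Suc n) * t ^ Suc n)"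
      using suminf_split_head [OF sm] by (simp add: hyp_fun_def)
    also have "\<bar>\<dots>\<bar> \<le> (\<Sum>n. \<bar>hyp_coeff a b c (Suc n)\<bar> * t)"
    proof (subst real_norm_def [symmetric], rule norm_suminf_le)
      fix n
      have "t ^ Suc n \<le> t" using t by (simp add: mult_left_le power_le_one)
      thus "norm (hyp_coeff a b c (Suc n) * t ^ Suc n) \<le> \<bar>hyp_coeff a b c (Suc n)\<bar> * t"
        using t by (auto simp: abs_mult intro: mult_left_mono)
    qed (intro summable_mult2 s')
    also have "\<dots> = L * t" unfolding L_def by (rule suminf_mult2 [OF s', symmetric])
    finally show ?thesis .
  qed
  show ?thesis
  proof (intro exI [of _ "L * (L + 2)"] conjI ballI)
    fix t :: real assume "t \<in> {0..1}"
    hence t: "0 \<le> t" "t \<le> 1" by auto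
    define x where "x = hyp_fun a b c t"
    have x: "\<bar>x - 1\<bar> \<le> L * t" using b1 [OF t] by (simp add: x_def)
    have Lt: "L * t \<le> L" using L t by (simp add: mult_left_le)
    have "\<bar>x\<^sup>2 - 1\<bar> = \<bar>x - 1\<bar> * \<bar>x + 1\<bar>"
      by (simp add: power2_eq_square algebra_simps flip: abs_mult)
    also have "\<dots> \<le> (L * t) * (L + 2)"
      using x Lt L t by (intro mult_mono) auto
    finally show "\<bar>(hyp_fun a b c t)\<^sup>2 - 1\<bar> \<le> L * (L + 2) * t" by (simp add: x_def mult_ac)
    have "\<bar>x\<bar> \<le> L + 1" using x Lt by linarith
    also have "L + 1 \<le> L * (L + 2) + 1" using L by (simp add: algebra_simps)
    finally show "\<bar>hyp_fun a b c t\<bar> \<le> L * (L + 2) + 1" by (simp add: x_def)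
  qed (use L in simp)
qed

section \<open>Asymptotics of the square moments and the Casoratian argument\<close>

context hypergeometric_ode
begin

text \<open>For large r the weight concentrates at t = 0, where G^2 = 1, so the moment is close to
  the Beta integral of the weight. The error O(t) costs the factor Beta(c+1, .) / Beta(c, .), which
  is c / (c + r - \<kappa> + 1).\<close>

lemma sq_moment_asymp:
  assumes K: "\<And>t. t \<in> {0..1} \<Longrightarrow> \<bar>(G t)\<^sup>2 - 1\<bar> \<le> K * t" and r: "r - \<kappa> > 0"
  shows "\<bar>sq_moment r / Beta c (r - \<kappa> + 1) - 1\<bar> \<le> K * c / (c + r - \<kappa> + 1)"
proof -
  let ?W = "\<lambda>t. t powr (c - 1) * (1 - t) powr (r - \<kappa>)"
  define B where "B = Beta c (r - \<kappa> + 1)"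
  have B: "B > 0" unfolding B_def Beta_def using r c_gt_1
    by (intro divide_pos_pos mult_pos_pos Gamma_real_pos) auto
  have i1: "(?W has_integral B) {0..1}"
    using has_integral_Beta_real [of c "r - \<kappa> + 1"] r c_gt_1 by (simp add: B_def)
  have i2: "((\<lambda>t. K * (t powr (c + 1 - 1) * (1 - t) powr (r - \<kappa> + 1 - 1))) has_integral K * Beta (c + 1) (r - \<kappa> + 1)) {0..1}"
    using r c_gt_1 by (intro has_integral_mult_right has_integral_Beta_real) auto
  have d: "((\<lambda>t. ?W t * (G t)\<^sup>2 - ?W t)
      has_integral (sq_moment r - B)) {0..1}"
    by (intro has_integral_diff has_integral_sq_moment r i1)
  have "norm (sq_moment r - B) \<le> K * Beta (c + 1) (r - \<kappa> + 1)"
    unfolding integral_unique [OF d, symmetric] integral_unique [OF i2, symmetric]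
  proof (rule integral_norm_bound_integral)
    fix t :: real assume t: "t \<in> {0..1}"
    have p: "t powr (c + 1 - 1) = t * t powr (c - 1)" using powr_add_one [of t "c - 1"] t by simp
    have "norm (?W t * (G t)\<^sup>2 - ?W t) =
        \<bar>?W t * ((G t)\<^sup>2 - 1)\<bar>"
      by (simp add: algebra_simps)
    also have "\<dots> = ?W t * \<bar>(G t)\<^sup>2 - 1\<bar>"
      by (simp add: abs_mult)
    also have "\<dots> \<le> ?W t * (K * t)"
      using K [OF t] t by (intro mult_left_mono) auto
    finally show "norm (?W t * (G t)\<^sup>2 - ?W t)
        \<le> K * (t powr (c + 1 - 1) * (1 - t) powr (r - \<kappa> + 1 - 1))"
      unfolding p by (simp add: mult_ac)
  qed (use d i2 in \<open>auto simp: integrable_on_def\<close>)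
  also have "Beta (c + 1) (r - \<kappa> + 1) = B * c / (c + r - \<kappa> + 1)"
  proof -
    have "(c + (r - \<kappa> + 1)) * Beta (c + 1) (r - \<kappa> + 1) = c * B"
      unfolding B_def by (rule Beta_plus1_left) (use c_gt_1 in auto)
    thus ?thesis using r c_gt_1 by (simp add: field_simps)
  qed
  finally have le: "\<bar>sq_moment r - B\<bar> \<le> K * (B * c / (c + r - \<kappa> + 1))" by simp
  have "\<bar>sq_moment r / B - 1\<bar> = \<bar>sq_moment r - B\<bar> / B"
    using B by (simp add: abs_if field_simps)
  also have "\<dots> \<le> K * (B * c / (c + r - \<kappa> + 1)) / B"
    using le B by (intro divide_right_mono) auto
  also have "\<dots> = K * c / (c + r - \<kappa> + 1)" using B by simp
  finally show ?thesis unfolding B_def .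
qed

end

text \<open>
  The Casoratian satisfies a first order recurrence by which it could only decay like \<open>N^(-3)\<close>,
  whereas the bounds on \<open>M\<close> and \<open>Y\<close> make it \<open>O(N^(-5))\<close>.
\<close>

lemma real_seq_casoratian_zero:
  fixes M Y B :: "nat \<Rightarrow> real" and v h x :: real
  assumes x: "x > 0" "x > v" "x > -v" "x \<ge> h\<^sup>2"
    and recM: "\<And>N. (x + real N + 2) * ((x + real N + 2)\<^sup>2 - v\<^sup>2) * M (N + 2) - B N * M (N + 1)
        + (x + real N + 1) * ((x + real N + 1)\<^sup>2 - h\<^sup>2) * M N = 0"
    and recY: "\<And>N. (x + real N + 2) * ((x + real N + 2)\<^sup>2 - v\<^sup>2) * Y (N + 2) - B N * Y (N + 1)
        + (x + real N + 1) * ((x + real N + 1)\<^sup>2 - h\<^sup>2) * Y N = 0"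
    and bM: "\<And>N. \<bar>M N\<bar> \<le> C * (real N + 1) powr (-5/2)"
    and bY: "\<And>N. \<bar>Y N\<bar> \<le> D * (real N + 1) powr (-5/2)"
  shows "M (N + 1) * Y N = M N * Y (N + 1)"
proof -
  define W where "W = (\<lambda>N. M (N + 1) * Y N - M N * Y (N + 1))"
  define u where "u = (\<lambda>N. (x + real N + 1) * ((x + real N + 1)\<^sup>2 - v\<^sup>2))"
  \<comment> \<open>The recurrence multiplies |W| u by (r^2 - h^2) / (r^2 - v^2) in each step, where
    r = x + N + 1, and this may be less than 1. The additional factor x + N grows by r / (r - 1),
    which outweighs h^2 / r^2 as soon as r \<ge> h^2. Hence V is nondecreasing.\<close>
  define V where "V = (\<lambda>N. \<bar>W N\<bar> * u N * (x + real N))"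
  have sq: "(x + real N + 1)\<^sup>2 > v\<^sup>2" for N
  proof -
    have "\<bar>v\<bar> < x + real N + 1" using x by auto
    hence "\<bar>v\<bar> ^ 2 < (x + real N + 1) ^ 2" by (intro power_strict_mono) auto
    thus ?thesis by simp
  qed
  have u: "u N > 0" for N
    unfolding u_def using x sq [of N] by (intro mult_pos_pos) auto
  have step: "u (Suc N) * W (Suc N) = (x + real N + 1) * ((x + real N + 1)\<^sup>2 - h\<^sup>2) * W N" for N
  proof -
    have "u (Suc N) = (x + real N + 2) * ((x + real N + 2)\<^sup>2 - v\<^sup>2)"
      by (simp add: u_def add_ac)
    moreover have "W (Suc N) = M (N + 2) * Y (N + 1) - M (N + 1) * Y (N + 2)"
      by (simp add: W_def)
    ultimately show ?thesis
      using recM [of N] recY [of N] unfolding W_def by algebra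
  qed
  have mono: "V N \<le> V (Suc N)" for N
  proof -
    define r where "r = x + real N + 1"
    have r: "r \<ge> 1" "r \<ge> h\<^sup>2" using x by (auto simp: r_def)
    have "h\<^sup>2 * r \<le> r * r" using r by (intro mult_right_mono) auto
    hence "(r\<^sup>2 - v\<^sup>2) * (r - 1) \<le> (r\<^sup>2 - h\<^sup>2) * r"
    proof -
      have "(r\<^sup>2 - v\<^sup>2) * (r - 1) \<le> r\<^sup>2 * (r - 1)" using r by (intro mult_right_mono) auto
      also have "\<dots> \<le> (r\<^sup>2 - h\<^sup>2) * r"
        using \<open>h\<^sup>2 * r \<le> r * r\<close> by (simp add: algebra_simps power2_eq_square)
      finally show ?thesis .
    qed
    hence "\<bar>W N\<bar> * r * ((r\<^sup>2 - v\<^sup>2) * (r - 1)) \<le> \<bar>W N\<bar> * r * ((r\<^sup>2 - h\<^sup>2) * r)"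
      using r by (intro mult_left_mono) auto
    also have "\<dots> \<le> \<bar>r * (r\<^sup>2 - h\<^sup>2) * W N\<bar> * r"
      using r by (auto simp: abs_mult mult_ac intro!: mult_left_mono)
    also have "r * (r\<^sup>2 - h\<^sup>2) * W N = u (Suc N) * W (Suc N)"
      using step [of N] by (simp add: r_def)
    also have "\<bar>u (Suc N) * W (Suc N)\<bar> * r = V (Suc N)"
      using u [of "Suc N"] by (simp add: V_def abs_mult r_def mult_ac add_ac)
    also have "\<bar>W N\<bar> * r * ((r\<^sup>2 - v\<^sup>2) * (r - 1)) = V N"
      by (simp add: V_def u_def r_def mult_ac add_ac)
    finally show ?thesis .
  qed
  have CD: "C \<ge> 0" "D \<ge> 0" using bM [of 0] bY [of 0] by auto
  let ?b = "\<lambda>N. (real N + 1) powr (-5) * ((x + real N + 1) ^ 3 * (x + real N))"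
  have "V \<longlonglongrightarrow> 0"
  proof (rule Lim_null_comparison)
    show "\<forall>\<^sub>F N in sequentially. norm (V N) \<le>
        2 * C * D * ?b N"
    proof (intro always_eventually allI)
      fix N
      have mono5: "(real (N + 1) + 1) powr (-5/2) \<le> (real N + 1) powr (-5/2)"
        by (intro powr_mono2') auto
      have bM1: "\<bar>M (N + 1)\<bar> \<le> C * (real N + 1) powr (-5/2)"
        using bM [of "N + 1"] mult_left_mono [OF mono5 CD(1)] by linarith
      have bY1: "\<bar>Y (N + 1)\<bar> \<le> D * (real N + 1) powr (-5/2)"
        using bY [of "N + 1"] mult_left_mono [OF mono5 CD(2)] by linarith
      have "\<bar>M (N + 1)\<bar> * \<bar>Y N\<bar> \<le> (C * (real N + 1) powr (-5/2)) * (D * (real N + 1) powr (-5/2))"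
        by (intro mult_mono bM1 bY) (use CD in auto)
      moreover have "\<bar>M N\<bar> * \<bar>Y (N + 1)\<bar> \<le> (C * (real N + 1) powr (-5/2)) * (D * (real N + 1) powr (-5/2))"
        by (intro mult_mono bM bY1) (use CD in auto)
      moreover have "(C * (real N + 1) powr (-5/2)) * (D * (real N + 1) powr (-5/2)) =
          C * D * ((real N + 1) powr (-5/2) * (real N + 1) powr (-5/2))" by simp
      moreover have "(real N + 1) powr (-5/2) * (real N + 1) powr (-5/2) = (real N + 1) powr (-5)"
        by (simp flip: powr_add)
      ultimately have W: "\<bar>W N\<bar> \<le> 2 * C * D * (real N + 1) powr (-5)"
        unfolding W_def abs_mult [symmetric] by (smt (verit, ccfv_SIG) mult.assoc mult_2 distrib_right)
      have "u N \<le> (x + real N + 1) * (x + real N + 1)\<^sup>2"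
        unfolding u_def using x by (intro mult_left_mono) auto
      also have "\<dots> = (x + real N + 1) ^ 3" by (simp add: eval_nat_numeral)
      finally have a: "u N \<le> (x + real N + 1) ^ 3" .
      have "norm (V N) = \<bar>W N\<bar> * u N * (x + real N)"
        using u [of N] x by (simp add: V_def abs_mult)
      also have "\<dots> \<le> (2 * C * D * (real N + 1) powr (-5)) * (x + real N + 1) ^ 3 * (x + real N)"
        using u [of N] x CD by (intro mult_mono W a mult_nonneg_nonneg) auto
      finally show "norm (V N) \<le> 2 * C * D * ?b N"
        by (simp add: mult_ac)
    qed
    have "?b \<longlonglongrightarrow> 0"
      by real_asymp
    from tendsto_mult_left [OF this, of "2 * C * D"]
    show "(\<lambda>N. 2 * C * D * ?b N) \<longlonglongrightarrow> 0"
      by simp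
  qed
  \<comment> \<open>A nondecreasing sequence with limit 0 is nowhere positive, while V is
    nonnegative by construction.\<close>
  moreover have "incseq V" by (rule incseq_SucI) (fact mono)
  ultimately have "V n \<le> 0" for n by (intro incseq_le)
  hence "V N \<le> 0" .
  hence "W N = 0"
    using u [of N] x by (auto simp: V_def mult_le_0_iff)
  thus ?thesis by (simp add: W_def)
qed

subsection \<open>Transformation of the square moments\<close>

lemma Gamma_pair_quotient_tendsto_1:
  fixes u1 u2 v1 v2 :: real
  assumes pos: "u1 > 0" "u2 > 0" "v1 > 0" "v2 > 0" and sum_eq: "u1 + u2 = v1 + v2"
  shows "(\<lambda>n. Gamma (u1 + real n) * Gamma (u2 + real n) / (Gamma (v1 + real n) * Gamma (v2 + real n))) \<longlonglongrightarrow> 1"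
proof -
  have nz: "u1 \<notin> \<int>\<^sub>\<le>\<^sub>0" "u2 \<notin> \<int>\<^sub>\<le>\<^sub>0" "v1 \<notin> \<int>\<^sub>\<le>\<^sub>0" "v2 \<notin> \<int>\<^sub>\<le>\<^sub>0"
    using pos by auto
  have g: "Gamma u1 > 0" "Gamma u2 > 0" "Gamma v1 > 0" "Gamma v2 > 0" using pos by auto
  have "(\<lambda>n. Gamma u1 * Gamma u2 / (Gamma v1 * Gamma v2) *
      (pochhammer u1 n * pochhammer u2 n / (pochhammer v1 n * pochhammer v2 n)))
      \<longlonglongrightarrow> Gamma u1 * Gamma u2 / (Gamma v1 * Gamma v2) * (Gamma v1 * Gamma v2 * rGamma u1 * rGamma u2)"
    by (intro tendsto_mult tendsto_const pochhammer_pair_quotient_tendsto nz sum_eq)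
  also have "Gamma u1 * Gamma u2 / (Gamma v1 * Gamma v2) * (Gamma v1 * Gamma v2 * rGamma u1 * rGamma u2) = 1"
    using g by (simp add: rGamma_inverse_Gamma field_simps)
  finally show ?thesis
    by (simp add: Gamma_add_of_nat pos mult_ac)
qed

lemma Beta_real_shift_bound:
  fixes c x :: real
  assumes "c > 0" "x > 0"
  obtains C where "C > 0" "\<And>n. Beta c (x + real n) \<le> C * (real n + 1) powr (- c)"
proof -
  have "c + x \<notin> \<int>\<^sub>\<le>\<^sub>0" using assms by auto
  then obtain C where C: "C > 0" "\<And>n. \<bar>pochhammer x n / pochhammer (c + x) n\<bar> \<le> C * (real n + 1) powr (x - (c + x))"
    using pochhammer_quotient_bound by blast
  have "Beta c (x + real n) \<le> Beta c x * C * (real n + 1) powr (- c)" for n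
  proof -
    have "Beta c (x + real n) = Beta c x * (pochhammer x n / pochhammer (c + x) n)"
      using Gamma_add_of_nat [of "c + x" n] assms by (simp add: Beta_def Gamma_add_of_nat add.assoc)
    also have "\<dots> \<le> Beta c x * (C * (real n + 1) powr (x - (c + x)))"
    proof (intro mult_left_mono)
      show "pochhammer x n / pochhammer (c + x) n \<le> C * (real n + 1) powr (x - (c + x))"
        using C(2) [of n] by linarith
      show "Beta c x \<ge> 0" using assms by (simp add: Beta_def)
    qed
    finally show ?thesis by simp
  qed
  moreover have "Beta c x * C > 0" using assms C by (simp add: Beta_def)
  ultimately show ?thesis by (rule that [rotated])
qed

context
  fixes m p :: real
  assumes m: "m \<ge> 1" and p: "p \<ge> 3/2"
begin

interpretation F: hypergeometric_ode m "1 - p" "m + p"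
  "hyp_fun m (1 - p) (m + p)" "hyp_fun1 m (1 - p) (m + p)" "hyp_fun2 m (1 - p) (m + p)"
  by (rule hypergeometric_ode_hyp_fun) (use m p in auto)

interpretation f: hypergeometric_ode p "1 - p" "m + p"
  "hyp_fun p (1 - p) (m + p)" "hyp_fun1 p (1 - p) (m + p)" "hyp_fun2 p (1 - p) (m + p)"
  by (rule hypergeometric_ode_hyp_fun) (use m p in auto)

lemma \<kappa>_eqs: "F.\<kappa> = 2 * p - 1" "f.\<kappa> = m + p - 1"
  by (simp_all add: F.\<kappa>_def f.\<kappa>_def)

text \<open>A solution g of the first order recurrence g(r+1) / g(r) = ((r+1)^2 - (2p-1)^2) /
  ((r+1)^2 - (m+p-1)^2), normalized such that it is asymptotic to the quotient of the Beta integrals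
  belonging to F and f.\<close>

definition gauge_factor :: "real \<Rightarrow> real" where
  "gauge_factor r = Gamma (r + 2 - 2 * p) * Gamma (r + 2 * p) / (Gamma (r + 2 - m - p) * Gamma (r + m + p))"

lemma gauge_factor_step:
  assumes "r > 2 * p" "r > m + p"
  shows "gauge_factor (r + 1) * ((r + 2 - m - p) * (r + m + p)) = gauge_factor r * ((r + 2 - 2 * p) * (r + 2 * p))"
proof -
  have G: "Gamma (x + 1) = x * Gamma x" if "x > 0" for x :: real
    using that by (intro Gamma_plus1) auto
  have e: "r + 1 + 2 - 2 * p = (r + 2 - 2 * p) + 1" "r + 1 + 2 * p = (r + 2 * p) + 1"
          "r + 1 + 2 - m - p = (r + 2 - m - p) + 1" "r + 1 + m + p = (r + m + p) + 1"
    by simp_all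
  have pos: "r + 2 - 2 * p > 0" "r + 2 * p > 0" "r + 2 - m - p > 0" "r + m + p > 0"
    using assms m p by auto
  hence "Gamma (r + 2 - m - p) > 0" "Gamma (r + m + p) > 0" by auto
  thus ?thesis
    unfolding gauge_factor_def e G [OF pos(1)] G [OF pos(2)] G [OF pos(3)] G [OF pos(4)]
    using pos by (simp add: divide_simps)
qed

text \<open>2p - 1 and m + p - 1 are the exponent differences of the equation of F at 1 and at
  infinity. For f they are interchanged, and (r + 2p)(r + 2 - 2p) in \<open>f_recurrence\<close> is
  (r+1)^2 - (2p-1)^2. The middle coefficients of the two recurrences coincide.\<close>

lemma F_recurrence:
  assumes "r > 2 * p"
  shows "(r + 1) * ((r + 1)\<^sup>2 - (m + p - 1)\<^sup>2) * F.sq_moment (r + 1)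
      - (2 * r + 1) * (r * (r + 1) + 2 * p * (1 - p)) * F.sq_moment r
      + r * (r\<^sup>2 - (2 * p - 1)\<^sup>2) * F.sq_moment (r - 1) = 0"
  using F.sq_moment_recurrence [of r] assms unfolding \<kappa>_eqs by simp algebra

lemma f_recurrence:
  assumes "r > m + p"
  shows "(r + 1) * (r + 2 * p) * (r + 2 - 2 * p) * f.sq_moment (r + 1)
      - (2 * r + 1) * (r * (r + 1) + 2 * p * (1 - p)) * f.sq_moment r
      + r * (r\<^sup>2 - (m + p - 1)\<^sup>2) * f.sq_moment (r - 1) = 0"
  using f.sq_moment_recurrence [of r] assms unfolding \<kappa>_eqs by simp algebra

lemma gauged_recurrence:
  assumes r: "r - 1 > 2 * p" "r - 1 > m + p"
  shows "(r + 1) * ((r + 1)\<^sup>2 - (m + p - 1)\<^sup>2) * (gauge_factor (r + 1) * f.sq_moment (r + 1))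
      - (2 * r + 1) * (r * (r + 1) + 2 * p * (1 - p)) * (gauge_factor r * f.sq_moment r)
      + r * (r\<^sup>2 - (2 * p - 1)\<^sup>2) * (gauge_factor (r - 1) * f.sq_moment (r - 1)) = 0"
proof -
  have "(r + 1)\<^sup>2 - (m + p - 1)\<^sup>2 = (r + 2 - m - p) * (r + m + p)"
    by (simp add: power2_eq_square algebra_simps)
  hence 1: "((r + 1)\<^sup>2 - (m + p - 1)\<^sup>2) * gauge_factor (r + 1) = gauge_factor r * ((r + 2 * p) * (r + 2 - 2 * p))"
    using gauge_factor_step [of r] r by (simp add: mult_ac)
  have e: "r - 1 + 1 = r" "r - 1 + 2 - m - p = r - (m + p - 1)" "r - 1 + m + p = r + (m + p - 1)"
          "r - 1 + 2 - 2 * p = r - (2 * p - 1)" "r - 1 + 2 * p = r + (2 * p - 1)"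
    by simp_all
  have sq: "r\<^sup>2 - x\<^sup>2 = (r - x) * (r + x)" for x
    by (simp add: power2_eq_square algebra_simps)
  have 2: "(r\<^sup>2 - (2 * p - 1)\<^sup>2) * gauge_factor (r - 1) = gauge_factor r * (r\<^sup>2 - (m + p - 1)\<^sup>2)"
    using gauge_factor_step [of "r - 1"] r unfolding e sq by (simp add: mult_ac)
  have "(r + 1) * ((r + 1)\<^sup>2 - (m + p - 1)\<^sup>2) * (gauge_factor (r + 1) * f.sq_moment (r + 1))
      - (2 * r + 1) * (r * (r + 1) + 2 * p * (1 - p)) * (gauge_factor r * f.sq_moment r)
      + r * (r\<^sup>2 - (2 * p - 1)\<^sup>2) * (gauge_factor (r - 1) * f.sq_moment (r - 1)) =
      (r + 1) * (((r + 1)\<^sup>2 - (m + p - 1)\<^sup>2) * gauge_factor (r + 1)) * f.sq_moment (r + 1)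
      - (2 * r + 1) * (r * (r + 1) + 2 * p * (1 - p)) * (gauge_factor r * f.sq_moment r)
      + r * ((r\<^sup>2 - (2 * p - 1)\<^sup>2) * gauge_factor (r - 1)) * f.sq_moment (r - 1)"
    by (simp only: mult.assoc)
  also have "\<dots> = gauge_factor r * ((r + 1) * (r + 2 * p) * (r + 2 - 2 * p) * f.sq_moment (r + 1)
      - (2 * r + 1) * (r * (r + 1) + 2 * p * (1 - p)) * f.sq_moment r
      + r * (r\<^sup>2 - (m + p - 1)\<^sup>2) * f.sq_moment (r - 1))"
    unfolding 1 2 by algebra
  also have "\<dots> = 0" using f_recurrence [of r] r by simp
  finally show ?thesis .
qed

text \<open>Vanishing of the Casoratian means that the quotient of the two sequences does not depend
  on N; its value is its limit 1.\<close>

theorem sq_moment_transformation: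
  obtains r0 where "r0 > 2 * p" "r0 > m + p"
    "\<And>r. r \<ge> r0 \<Longrightarrow> F.sq_moment r = gauge_factor r * f.sq_moment r"
proof -
  have c: "m + p \<notin> \<int>\<^sub>\<le>\<^sub>0" using m p by auto
  obtain K where K: "K \<ge> 0" "\<And>t. t \<in> {0..1} \<Longrightarrow> \<bar>(hyp_fun m (1 - p) (m + p) t)\<^sup>2 - 1\<bar> \<le> K * t"
  proof -
    have "m + p - m - (1 - p) > 0" using p by simp
    from hyp_fun_near_0 [OF c this] show ?thesis using that by metis
  qed
  obtain L where L: "L \<ge> 0" "\<And>t. t \<in> {0..1} \<Longrightarrow> \<bar>(hyp_fun p (1 - p) (m + p) t)\<^sup>2 - 1\<bar> \<le> L * t"
  proof -
    have "m + p - p - (1 - p) > 0" using m p by simp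
    from hyp_fun_near_0 [OF c this] show ?thesis using that by metis
  qed
  \<comment> \<open>The first summands keep all Gamma arguments positive, (2p-1)^2 is the condition
    x \<ge> h^2 of the Casoratian lemma, and the last two bring the relative errors of both moments
    below 1. The factor 2 covers the denominator r + 2 + m - p, which exceeds r / 2.\<close>
  define r0 where "r0 = 1 + 2 * p + (m + p) + (2 * p - 1)\<^sup>2 + 2 * (K * (m + p)) + 2 * (L * (m + p))"
  have nn: "(2 * p - 1)\<^sup>2 \<ge> 0" "K * (m + p) \<ge> 0" "L * (m + p) \<ge> 0"
    using K(1) L(1) m p by auto
  have r0: "r0 > 2 * p + 1" "r0 > m + p + 1" "r0 \<ge> (2 * p - 1)\<^sup>2"
    "r0 > 2 * (K * (m + p))" "r0 > 2 * (L * (m + p))"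
    using nn m p unfolding r0_def by linarith+
  define bF where "bF = (\<lambda>r. Beta (m + p) (r + 2 - 2 * p))"
  define bf where "bf = (\<lambda>r. Beta (m + p) (r + 2 - m - p))"
  have eF: "\<bar>F.sq_moment r / bF r - 1\<bar> \<le> K * (m + p) / (r + 2 + m - p)" if "r \<ge> r0" for r
    using F.sq_moment_asymp [OF K(2), of r] that r0 unfolding bF_def \<kappa>_eqs by (simp add: algebra_simps)
  have ef: "\<bar>f.sq_moment r / bf r - 1\<bar> \<le> L * (m + p) / (r + 2)" if "r \<ge> r0" for r
    using f.sq_moment_asymp [OF L(2), of r] that r0 unfolding bf_def \<kappa>_eqs by (simp add: algebra_simps)
  have bpos: "bF r > 0" "bf r > 0" "gauge_factor r > 0" if "r \<ge> r0" for r
    using that r0 m p unfolding bF_def bf_def gauge_factor_def Beta_def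
    by (auto intro!: divide_pos_pos mult_pos_pos Gamma_real_pos)
  have pos: "F.sq_moment r > 0 \<and> F.sq_moment r \<le> 2 * bF r \<and> f.sq_moment r > 0" if r: "r \<ge> r0" for r
  proof -
    have "K * (m + p) / (r + 2 + m - p) < 1" "L * (m + p) / (r + 2) < 1"
      using r r0 nn m p by (auto simp: divide_simps)
    hence "\<bar>F.sq_moment r / bF r - 1\<bar> < 1" "\<bar>f.sq_moment r / bf r - 1\<bar> < 1"
      using eF [OF r] ef [OF r] by linarith+
    hence "F.sq_moment r / bF r > 0" "F.sq_moment r / bF r \<le> 2" "f.sq_moment r / bf r > 0" by linarith+
    thus ?thesis using bpos [OF r] by (simp add: zero_less_divide_iff divide_simps)
  qed
  have "F.sq_moment r = gauge_factor r * f.sq_moment r" if r: "r \<ge> r0" for r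
  proof -
    define M where "M = (\<lambda>N. F.sq_moment (r + real N))"
    define Y where "Y = (\<lambda>N. gauge_factor (r + real N) * f.sq_moment (r + real N))"
    have MY: "M N > 0" "Y N > 0" for N
      using pos [of "r + real N"] bpos [of "r + real N"] r by (auto simp: M_def Y_def)
    have lim: "(\<lambda>N. Y N / M N) \<longlonglongrightarrow> 1"
    proof -
      have l1: "(\<lambda>N. M N / bF (r + real N)) \<longlonglongrightarrow> 1"
      proof (rule LIM_zero_cancel, rule Lim_null_comparison)
        show "\<forall>\<^sub>F N in sequentially. norm (M N / bF (r + real N) - 1) \<le> K * (m + p) / (r + real N + 2 + m - p)"
          unfolding M_def real_norm_def by (intro always_eventually allI eF) (use r in auto)
        show "(\<lambda>N. K * (m + p) / (r + real N + 2 + m - p)) \<longlonglongrightarrow> 0" by real_asymp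
      qed
      have l2: "(\<lambda>N. f.sq_moment (r + real N) / bf (r + real N)) \<longlonglongrightarrow> 1"
      proof (rule LIM_zero_cancel, rule Lim_null_comparison)
        show "\<forall>\<^sub>F N in sequentially. norm (f.sq_moment (r + real N) / bf (r + real N) - 1) \<le> L * (m + p) / (r + real N + 2)"
          unfolding real_norm_def by (intro always_eventually allI ef) (use r in auto)
        show "(\<lambda>N. L * (m + p) / (r + real N + 2)) \<longlonglongrightarrow> 0" by real_asymp
      qed
      \<comment> \<open>Four of the Gamma functions in this product cancel. The remaining pairs have
        equal sums, (r + 2p) + (r + 2 + m - p) = (r + m + p) + (r + 2), so the limit is exactly
        1.\<close>
      have l3: "(\<lambda>N. gauge_factor (r + real N) * bf (r + real N) / bF (r + real N)) \<longlonglongrightarrow> 1"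
      proof -
        have "(\<lambda>N. Gamma (r + 2 * p + real N) * Gamma (r + 2 + m - p + real N) /
            (Gamma (r + m + p + real N) * Gamma (r + 2 + real N))) \<longlonglongrightarrow> 1"
          (is "?L \<longlonglongrightarrow> _")
          by (rule Gamma_pair_quotient_tendsto_1) (use r r0 m p in auto)
        also have "?L = (\<lambda>N. gauge_factor (r + real N) * bf (r + real N) / bF (r + real N))"
          (is "_ = ?R")
        proof
          fix N
          define x where "x = r + real N"
          have x: "x \<ge> r0" using r by (simp add: x_def)
          have e: "r + 2 * p + real N = x + 2 * p" "r + 2 + m - p + real N = x + 2 + m - p"
                  "r + m + p + real N = x + m + p" "r + 2 + real N = x + 2" "r + real N = x"
                  "m + p + (x + 2 - 2 * p) = x + 2 + m - p" "m + p + (x + 2 - m - p) = x + 2"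
            by (simp_all add: x_def)
          have "Gamma (x + 2 - 2 * p) > 0" "Gamma (x + 2 - m - p) > 0" "Gamma (x + m + p) > 0" "Gamma (x + 2) > 0"
               "Gamma (m + p) > 0" "Gamma (x + 2 + m - p) > 0" "Gamma (x + 2 * p) > 0"
            using x r0 m p by (auto intro!: Gamma_real_pos)
          thus "?L N = ?R N"
            unfolding e gauge_factor_def bf_def bF_def Beta_def by (simp add: divide_simps)
        qed
        finally show ?thesis .
      qed
      have "(\<lambda>N. gauge_factor (r + real N) * bf (r + real N) / bF (r + real N) *
          (f.sq_moment (r + real N) / bf (r + real N)) / (M N / bF (r + real N))) \<longlonglongrightarrow> 1 * 1 / 1"
        (is "?L \<longlonglongrightarrow> _")
        by (intro tendsto_mult tendsto_divide l1 l2 l3) auto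
      also have "?L = (\<lambda>N. Y N / M N)"
      proof
        fix N
        show "?L N = Y N / M N"
          using bpos [of "r + real N"] r by (simp add: Y_def)
      qed
      finally show ?thesis by simp
    qed
    \<comment> \<open>The moments decay like N^(-(m+p)), and m + p \<ge> 5/2; two such factors beat
      the N^(-3) of the Casoratian.\<close>
    have bM: "\<exists>C. \<forall>N. \<bar>M N\<bar> \<le> C * (real N + 1) powr (-5/2)"
    proof -
      obtain C where C: "C > 0" "\<And>n. Beta (m + p) (r + 2 - 2 * p + real n) \<le> C * (real n + 1) powr (- (m + p))"
        using Beta_real_shift_bound [of "m + p" "r + 2 - 2 * p"] m p r r0 by auto
      have "\<bar>M N\<bar> \<le> 2 * C * (real N + 1) powr (-5/2)" for N
      proof -
        have "M N \<le> 2 * bF (r + real N)" using pos [of "r + real N"] r by (simp add: M_def)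
        also have "bF (r + real N) \<le> C * (real N + 1) powr (- (m + p))"
          using C(2) [of N] by (simp add: bF_def algebra_simps)
        also have "(real N + 1) powr (- (m + p)) \<le> (real N + 1) powr (-5/2)"
          using m p by (intro powr_mono) auto
        finally show ?thesis using MY(1) [of N] C(1) by simp
      qed
      thus ?thesis by blast
    qed
    then obtain C where C: "\<And>N. \<bar>M N\<bar> \<le> C * (real N + 1) powr (-5/2)" by blast
    \<comment> \<open>The convergent quotient is bounded, so the decay of \<open>Y\<close> follows
      from that of \<open>M\<close>.\<close>
    obtain D where D: "D > 0" "\<And>N. norm (Y N / M N) \<le> D"
      using convergent_imp_Bseq [OF convergentI [OF lim]] by (auto elim: BseqE)
    have bY: "\<bar>Y N\<bar> \<le> D * C * (real N + 1) powr (-5/2)" for N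
    proof -
      have "Y N \<le> D * M N" using D(2) [of N] MY [of N] by (simp add: field_simps)
      also have "M N \<le> C * (real N + 1) powr (-5/2)" using C [of N] by simp
      finally show ?thesis using MY [of N] D(1) by simp
    qed
    define B where "B = (\<lambda>N. (2 * (r + real N + 1) + 1) * ((r + real N + 1) * (r + real N + 2) + 2 * p * (1 - p)))"
    have cas: "M (N + 1) * Y N = M N * Y (N + 1)" for N
    proof (rule real_seq_casoratian_zero [where x = r and v = "m + p - 1" and h = "2 * p - 1" and B = B])
      fix N
      define x where "x = r + real N + 1"
      have e: "x + 1 = r + real N + 2" "x - 1 = r + real N" by (auto simp: x_def)
      show "(r + real N + 2) * ((r + real N + 2)\<^sup>2 - (m + p - 1)\<^sup>2) * M (N + 2) - B N * M (N + 1)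
          + (r + real N + 1) * ((r + real N + 1)\<^sup>2 - (2 * p - 1)\<^sup>2) * M N = 0"
        using F_recurrence [of x] r r0 unfolding M_def B_def e by (simp add: x_def add_ac)
      show "(r + real N + 2) * ((r + real N + 2)\<^sup>2 - (m + p - 1)\<^sup>2) * Y (N + 2) - B N * Y (N + 1)
          + (r + real N + 1) * ((r + real N + 1)\<^sup>2 - (2 * p - 1)\<^sup>2) * Y N = 0"
        using gauged_recurrence [of x] r r0 unfolding Y_def B_def e by (simp add: x_def add_ac)
    qed (use r r0 m p C bY in auto)
    have const: "Y N / M N = Y 0 / M 0" for N
    proof (induction N)
      case (Suc N)
      have "Y (Suc N) / M (Suc N) = Y N / M N"
        using cas [of N] MY(1) [of N] MY(1) [of "Suc N"] by (simp add: field_simps)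
      with Suc.IH show ?case by simp
    qed simp
    have "(\<lambda>N. Y N / M N) = (\<lambda>_. Y 0 / M 0)" using const by blast
    hence "Y 0 / M 0 = 1" using lim by (simp add: LIMSEQ_const_iff)
    thus ?thesis using MY(1) [of 0] by (simp add: M_def Y_def)
  qed
  with r0 show ?thesis by (intro that [of r0]) auto
qed

end

subsection \<open>Connection formula\<close>

lemma sums_binomial_negative:
  fixes w v :: real
  assumes "\<bar>w\<bar> < 1"
  shows "(\<lambda>n. pochhammer v n / fact n * w ^ n) sums ((1 - w) powr (- v))"
proof -
  have "(\<lambda>n. ((- v) gchoose n) * (- w) ^ n) sums ((1 + (- w)) powr (- v))"
    by (rule gen_binomial_real) (use assms in simp)
  also have "(\<lambda>n. ((- v) gchoose n) * (- w) ^ n) = (\<lambda>n. pochhammer v n / fact n * w ^ n)"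
  proof
    fix n
    have "(-1) ^ n * (- w) ^ n = w ^ n" by (simp flip: power_mult_distrib)
    thus "((- v) gchoose n) * (- w) ^ n = pochhammer v n / fact n * w ^ n"
      by (simp add: gbinomial_pochhammer mult_ac)
  qed
  finally show ?thesis by simp
qed

lemma summable_compare_binomial:
  fixes y :: "nat \<Rightarrow> real"
  assumes v: "v > 0" and lim: "(\<lambda>n. y n * fact n / pochhammer v n) \<longlonglongrightarrow> k" and w: "\<bar>w\<bar> < 1"
  shows "summable (\<lambda>n. y n * w ^ n)"
proof -
  obtain C where C: "C > 0" "\<And>n. norm (y n * fact n / pochhammer v n) \<le> C"
    using convergent_imp_Bseq [OF convergentI [OF lim]] by (auto elim: BseqE)
  have "summable (\<lambda>n. C * (pochhammer v n / fact n * \<bar>w\<bar> ^ n))"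
    by (intro summable_mult sums_summable [OF sums_binomial_negative]) (use w in simp)
  thus ?thesis
  proof (rule summable_comparison_test')
    fix n
    have pos: "pochhammer v n > 0" using v by (rule pochhammer_pos)
    hence "\<bar>y n\<bar> \<le> C * (pochhammer v n / fact n)"
      using C(2) [of n] by (simp add: abs_mult field_simps)
    hence "\<bar>y n\<bar> * \<bar>w\<bar> ^ n \<le> C * (pochhammer v n / fact n) * \<bar>w\<bar> ^ n"
      by (intro mult_right_mono) auto
    thus "norm (y n * w ^ n) \<le> C * (pochhammer v n / fact n * \<bar>w\<bar> ^ n)"
      by (simp add: abs_mult power_abs)
  qed
qed

text \<open>Comparison with the binomial series of (1-w)^(-v), whose coefficients are (v)_n / n!.
  Beyond some N the coefficients are within e/2 of k times the binomial ones, and the finitely many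
  others are annihilated by (1-w)^v. In the connection formula this detects the coefficient of a
  local solution from its growth at the opposite singularity.\<close>

lemma Abelian_binomial_limit:
  fixes y :: "nat \<Rightarrow> real"
  assumes v: "v > 0" and lim: "(\<lambda>n. y n * fact n / pochhammer v n) \<longlonglongrightarrow> k"
  shows "((\<lambda>w. (1 - w) powr v * (\<Sum>n. y n * w ^ n)) \<longlongrightarrow> k) (at_left 1)"
proof (rule tendstoI)
  fix e :: real assume e: "e > 0"
  define b where "b = (\<lambda>n. pochhammer v n / fact n)"
  have b: "b n > 0" for n unfolding b_def using pochhammer_pos [OF v] by simp
  from tendstoD [OF lim, of "e / 2"] e obtain N
    where "\<And>n. n \<ge> N \<Longrightarrow> dist (y n * fact n / pochhammer v n) k < e / 2"
    by (auto simp: eventually_sequentially)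
  hence N: "\<bar>y n / b n - k\<bar> < e / 2" if "n \<ge> N" for n using that by (simp add: b_def dist_norm)
  define A where "A = (\<Sum>n<N. \<bar>y n - k * b n\<bar>)"
  have bound: "\<bar>(1 - w) powr v * (\<Sum>n. y n * w ^ n) - k\<bar> \<le> (1 - w) powr v * A + e / 2"
    if w: "0 < w" "w < 1" for w
  proof -
    have sb: "(\<lambda>n. b n * w ^ n) sums ((1 - w) powr (- v))"
      unfolding b_def by (rule sums_binomial_negative) (use w in simp)
    have sy: "summable (\<lambda>n. y n * w ^ n)"
      by (rule summable_compare_binomial [OF v lim]) (use w in simp)
    have "(\<lambda>n. y n * w ^ n - k * (b n * w ^ n)) sums ((\<Sum>n. y n * w ^ n) - k * (1 - w) powr (- v))"
      by (intro sums_diff sums_mult sb summable_sums sy)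
    hence sd: "(\<lambda>n. (y n - k * b n) * w ^ n) sums ((\<Sum>n. y n * w ^ n) - k * (1 - w) powr (- v))"
      by (simp add: algebra_simps)
    have sA: "(\<lambda>n. (if n < N then \<bar>y n - k * b n\<bar> else 0) + e / 2 * (b n * w ^ n)) sums
        (A + e / 2 * (1 - w) powr (- v))"
      unfolding A_def using sums_If_finite [of "\<lambda>n. n < N" "\<lambda>n. \<bar>y n - k * b n\<bar>"]
      by (intro sums_add sums_mult sb) (simp add: lessThan_def)
    have "norm (\<Sum>n. (y n - k * b n) * w ^ n) \<le> (\<Sum>n. (if n < N then \<bar>y n - k * b n\<bar> else 0) + e / 2 * (b n * w ^ n))"
    proof (rule norm_suminf_le)
      fix n
      show "norm ((y n - k * b n) * w ^ n) \<le> (if n < N then \<bar>y n - k * b n\<bar> else 0) + e / 2 * (b n * w ^ n)"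
      proof (cases "n < N")
        case True
        have "\<bar>y n - k * b n\<bar> * w ^ n \<le> \<bar>y n - k * b n\<bar>"
          using w by (intro mult_left_le power_le_one) auto
        moreover have "e / 2 * (b n * w ^ n) \<ge> 0" using e b [of n] w by simp
        ultimately show ?thesis using True w by (simp add: abs_mult)
      next
        case False
        hence "\<bar>y n / b n - k\<bar> * b n \<le> e / 2 * b n" using N [of n] b [of n] by (intro mult_right_mono) auto
        also have "\<bar>y n / b n - k\<bar> * b n = \<bar>(y n / b n - k) * b n\<bar>" using b [of n] by (simp add: abs_mult)
        also have "(y n / b n - k) * b n = y n - k * b n" using b [of n] by (simp add: field_simps)
        finally have "\<bar>y n - k * b n\<bar> * w ^ n \<le> e / 2 * b n * w ^ n"
          using w by (intro mult_right_mono) auto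
        thus ?thesis using False w by (simp add: abs_mult mult_ac)
      qed
    qed (use sA in \<open>simp add: sums_iff\<close>)
    hence "\<bar>(\<Sum>n. y n * w ^ n) - k * (1 - w) powr (- v)\<bar> \<le> A + e / 2 * (1 - w) powr (- v)"
      using sd sA by (simp add: sums_iff)
    hence "(1 - w) powr v * \<bar>(\<Sum>n. y n * w ^ n) - k * (1 - w) powr (- v)\<bar> \<le>
        (1 - w) powr v * (A + e / 2 * (1 - w) powr (- v))"
      by (intro mult_left_mono) auto
    moreover have inv: "(1 - w) powr v * (1 - w) powr (- v) = 1"
      using w by (simp flip: powr_add)
    moreover have "(1 - w) powr v * \<bar>(\<Sum>n. y n * w ^ n) - k * (1 - w) powr (- v)\<bar> =
        \<bar>(1 - w) powr v * (\<Sum>n. y n * w ^ n) - k * ((1 - w) powr v * (1 - w) powr (- v))\<bar>"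
    proof -
      have "(1 - w) powr v * \<bar>(\<Sum>n. y n * w ^ n) - k * (1 - w) powr (- v)\<bar> =
          \<bar>(1 - w) powr v * ((\<Sum>n. y n * w ^ n) - k * (1 - w) powr (- v))\<bar>"
        by (simp only: abs_mult abs_of_nonneg [OF powr_ge_zero])
      thus ?thesis by (simp only: right_diff_distrib mult.left_commute)
    qed
    moreover have "(1 - w) powr v * (A + e / 2 * (1 - w) powr (- v)) =
        (1 - w) powr v * A + e / 2 * ((1 - w) powr v * (1 - w) powr (- v))"
      by (simp only: distrib_left mult.left_commute)
    ultimately show ?thesis by simp
  qed
  have "((\<lambda>w. (1 - w) powr v * A + e / 2) \<longlongrightarrow> (1 - 1) powr v * A + e / 2) (at_left 1)"
    using v by (intro tendsto_intros) (auto intro!: eventually_at_leftI [of 0])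
  hence "\<forall>\<^sub>F w in at_left 1. (1 - w) powr v * A + e / 2 < e"
    by (rule order_tendstoD) (use e in simp)
  moreover have "\<forall>\<^sub>F w in at_left (1::real). 0 < w \<and> w < 1"
    by (auto intro!: eventually_at_leftI [of 0])
  ultimately show "\<forall>\<^sub>F w in at_left 1. dist ((1 - w) powr v * (\<Sum>n. y n * w ^ n)) k < e"
    by eventually_elim (use bound in \<open>force simp: dist_norm\<close>)
qed

text \<open>Abel's identity: w^(2-c) (1-w)^c is the integrating factor of the hypergeometric
  equation with lower parameter 2 - c and upper parameters of sum 1.\<close>

lemma Wronskian_constant:
  fixes u u1 u2 v v1 v2 :: "real \<Rightarrow> real"
  assumes du: "\<And>w. 0 < w \<Longrightarrow> w < 1 \<Longrightarrow> (u has_real_derivative u1 w) (at w)"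
             "\<And>w. 0 < w \<Longrightarrow> w < 1 \<Longrightarrow> (u1 has_real_derivative u2 w) (at w)"
             "\<And>w. 0 < w \<Longrightarrow> w < 1 \<Longrightarrow> w * (1 - w) * u2 w + (2 - c - 2 * w) * u1 w - q * u w = 0"
      and dv: "\<And>w. 0 < w \<Longrightarrow> w < 1 \<Longrightarrow> (v has_real_derivative v1 w) (at w)"
             "\<And>w. 0 < w \<Longrightarrow> w < 1 \<Longrightarrow> (v1 has_real_derivative v2 w) (at w)"
             "\<And>w. 0 < w \<Longrightarrow> w < 1 \<Longrightarrow> w * (1 - w) * v2 w + (2 - c - 2 * w) * v1 w - q * v w = 0"
  shows "\<exists>k. \<forall>w\<in>{0<..<1}. w powr (2 - c) * (1 - w) powr c * (u w * v1 w - u1 w * v w) = k"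
proof (rule has_field_derivative_zero_constant)
  fix w :: real assume "w \<in> {0<..<1}"
  hence w: "0 < w" "w < 1" by auto
  have p: "w powr (2 - c) = w * w powr (1 - c)" "(1 - w) powr c = (1 - w) * (1 - w) powr (c - 1)"
    using powr_add_one [of w "1 - c"] powr_add_one [of "1 - w" "c - 1"] w by auto
  have "((\<lambda>w. w powr (2 - c) * (1 - w) powr c * (u w * v1 w - u1 w * v w)) has_real_derivative
      ((2 - c) * w powr (1 - c) * (1 - w) powr c - w powr (2 - c) * (c * (1 - w) powr (c - 1))) * (u w * v1 w - u1 w * v w)
      + w powr (2 - c) * (1 - w) powr c * (u w * v2 w - u2 w * v w)) (at w)"
    using w by (auto intro!: derivative_eq_intros du dv simp: algebra_simps)
  also have "((2 - c) * w powr (1 - c) * (1 - w) powr c - w powr (2 - c) * (c * (1 - w) powr (c - 1))) * (u w * v1 w - u1 w * v w)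
      + w powr (2 - c) * (1 - w) powr c * (u w * v2 w - u2 w * v w) =
      w powr (1 - c) * (1 - w) powr (c - 1) * ((2 - c - 2 * w) * (u w * v1 w - u1 w * v w) + w * (1 - w) * (u w * v2 w - u2 w * v w))"
    unfolding p by (simp add: algebra_simps)
  also have "(2 - c - 2 * w) * (u w * v1 w - u1 w * v w) + w * (1 - w) * (u w * v2 w - u2 w * v w) = 0"
    using du(3) [OF w] dv(3) [OF w] by algebra
  finally show "((\<lambda>w. w powr (2 - c) * (1 - w) powr c * (u w * v1 w - u1 w * v w)) has_real_derivative 0) (at w within {0<..<1})"
    by (simp add: has_field_derivative_at_within)
qed auto

text \<open>For a + b = 1 the sums match, (c - a) + (c - b) = c + (c - 1). The limit is the value of
  2F1(a, b; c) at 1, so it serves both as connection coefficient and as growth constant of the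
  second local solution.\<close>

lemma hyp_coeff_Euler_tendsto:
  fixes a b c :: real
  assumes "a + b = 1" "c > 1"
  shows "(\<lambda>n. hyp_coeff (c - a) (c - b) c n * fact n / pochhammer (c - 1) n)
      \<longlonglongrightarrow> Gamma c * Gamma (c - 1) * rGamma (c - a) * rGamma (c - b)"
proof -
  have "(\<lambda>n. pochhammer (c - a) n * pochhammer (c - b) n / (pochhammer c n * pochhammer (c - 1) n))
      \<longlonglongrightarrow> Gamma c * Gamma (c - 1) * rGamma (c - a) * rGamma (c - b)"
    by (intro pochhammer_pair_quotient_tendsto) (use assms in auto)
  thus ?thesis by (simp add: hyp_coeff_def mult_ac)
qed

text \<open>
  The coefficients \<open>x\<close> are those of \<open>2F1(a, b; 2 - c)\<close>, but they are only assumed to satisfy its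
  recurrence, so that \<open>2 - c\<close> may be a non-positive integer if the series terminates early enough.
\<close>

theorem hypergeometric_connection:
  fixes x :: "nat \<Rightarrow> real" and a b c K :: real
  assumes ab: "a + b = 1" and c: "c > 1" and ca: "c > a" and cb: "c > b"
    and x0: "x 0 = 1"
    and rec: "\<And>n. (real n + 1) * (real n + (2 - c)) * x (Suc n) = (real n + a) * (real n + b) * x n"
    and lim: "(\<lambda>n. x n * fact n / pochhammer (c - 1) n) \<longlonglongrightarrow> K"
    and w: "0 < w" "w < 1"
  shows "hyp_fun a b c (1 - w) =
      Gamma c * Gamma (c - 1) * rGamma (c - a) * rGamma (c - b) * (\<Sum>n. x n * w ^ n)
      - K * (w powr (c - 1) * (\<Sum>n. hyp_coeff (c - a) (c - b) c n * w ^ n))"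
proof -
  have c': "c \<notin> \<int>\<^sub>\<le>\<^sub>0" "c - 1 \<notin> \<int>\<^sub>\<le>\<^sub>0" using c by auto
  define f1 where "f1 = Gamma c * Gamma (c - 1) * rGamma (c - a) * rGamma (c - b)"
  have f1: "f1 > 0" unfolding f1_def rGamma_inverse_Gamma using c ca cb by (intro mult_pos_pos) auto
  define y where "y = hyp_coeff (c - a) (c - b) c"
  have cab: "c - a - b = c - 1" using ab by simp
  have f_at_1: "hyp_fun a b c 1 = f1"
    using Gauss_hypergeometric_sums [OF c'(1), of a b] c unfolding cab hyp_fun_def f1_def
    by (simp add: sums_iff)
  have limy: "(\<lambda>n. y n * fact n / pochhammer (c - 1) n) \<longlonglongrightarrow> f1"
    unfolding y_def f1_def by (rule hyp_coeff_Euler_tendsto [OF ab c])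
  have smx: "summable (\<lambda>n. x n * t ^ n)" if "\<bar>t\<bar> < 1" for t
    by (rule summable_compare_binomial [OF _ lim that]) (use c in simp)
  have smy: "summable (\<lambda>n. y n * t ^ n)" if "\<bar>t\<bar> < 1" for t
    by (rule summable_compare_binomial [OF _ limy that]) (use c in simp)
  have sma: "summable (\<lambda>n. \<bar>hyp_coeff a b c n\<bar>)"
    by (rule hyp_coeff_abs_summable) (use c c' cab in auto)
  have smf: "summable (\<lambda>n. hyp_coeff a b c n * t ^ n)" if "\<bar>t\<bar> < 1" for t
    by (rule summable_power_series_unit_interval [OF sma]) (use that in simp)
  have recy: "(real n + 1) * (real n + c) * y (Suc n) = (real n + (c - a)) * (real n + (c - b)) * y n" for n
    unfolding y_def by (rule hyp_coeff_rec [OF c'(1)])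
  have ab1: "a + b + 1 = 2" using ab by simp
  define g where "g = (\<lambda>t. \<Sum>n. x n * t ^ n)"
  define g1 where "g1 = (\<lambda>t. \<Sum>n. diffs x n * t ^ n)"
  define g2 where "g2 = (\<lambda>t. \<Sum>n. diffs (diffs x) n * t ^ n)"
  have G: "(g has_real_derivative g1 t) (at t)" "(g1 has_real_derivative g2 t) (at t)"
     "t * (1 - t) * g2 t + (2 - c - 2 * t) * g1 t - a * b * g t = 0" if "\<bar>t\<bar> < 1" for t
    using power_series_hypergeometric_ode [OF rec smx that] unfolding g_def g1_def g2_def ab1 by simp_all
  define h where "h = (\<lambda>t. \<Sum>n. y n * t ^ n)"
  define h1 where "h1 = (\<lambda>t. \<Sum>n. diffs y n * t ^ n)"
  define h2 where "h2 = (\<lambda>t. \<Sum>n. diffs (diffs y) n * t ^ n)"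
  have H: "(h has_real_derivative h1 t) (at t)" "(h1 has_real_derivative h2 t) (at t)"
     "t * (1 - t) * h2 t + (c - ((c - a) + (c - b) + 1) * t) * h1 t - (c - a) * (c - b) * h t = 0" if "\<bar>t\<bar> < 1" for t
    using power_series_hypergeometric_ode [OF recy smy that] unfolding h_def h1_def h2_def by simp_all
  have Fd: "(hyp_fun a b c has_real_derivative hyp_fun1 a b c t) (at t)"
     "(hyp_fun1 a b c has_real_derivative hyp_fun2 a b c t) (at t)"
     "t * (1 - t) * hyp_fun2 a b c t + (c - 2 * t) * hyp_fun1 a b c t - a * b * hyp_fun a b c t = 0" if "\<bar>t\<bar> < 1" for t
    using power_series_hypergeometric_ode [OF hyp_coeff_rec [OF c'(1)] smf that]
    unfolding hyp_fun_def [abs_def] hyp_fun1_def [abs_def] hyp_fun2_def [abs_def] ab1 by simp_all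
  \<comment> \<open>Reflection t = 1 - w replaces the lower parameter c by a + b + 1 - c = 2 - c, so
    that \<open>v\<close> solves the same equation as \<open>g\<close>.\<close>
  define v where "v = (\<lambda>w. hyp_fun a b c (1 - w))"
  define v1 where "v1 = (\<lambda>w. - hyp_fun1 a b c (1 - w))"
  define v2 where "v2 = (\<lambda>w. hyp_fun2 a b c (1 - w))"
  have V: "(v has_real_derivative v1 t) (at t)" "(v1 has_real_derivative v2 t) (at t)"
     "t * (1 - t) * v2 t + (2 - c - 2 * t) * v1 t - a * b * v t = 0" if "0 < t" "t < 1" for t
  proof -
    have d: "((-) 1 has_real_derivative -1) (at t)" by (auto intro!: derivative_eq_intros)
    have "\<bar>1 - t\<bar> < 1" using that by simp
    note F = Fd [OF this]
    show "(v has_real_derivative v1 t) (at t)"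
      using DERIV_chain2 [OF F(1) d] by (simp add: v_def v1_def)
    show "(v1 has_real_derivative v2 t) (at t)"
      using DERIV_minus [OF DERIV_chain2 [OF F(2) d]] by (simp add: v1_def v2_def)
    show "t * (1 - t) * v2 t + (2 - c - 2 * t) * v1 t - a * b * v t = 0"
      using F(3) by (simp add: v_def v1_def v2_def algebra_simps)
  qed
  \<comment> \<open>The local solution with exponent c - 1 at w = 0; substituting it into the
    equation of \<open>g\<close> leaves the hypergeometric equation of \<open>h\<close> times a
    power of w.\<close>
  define z where "z = (\<lambda>w. w powr (c - 1) * h w)"
  define z1 where "z1 = (\<lambda>w. w powr (c - 2) * ((c - 1) * h w + w * h1 w))"
  define z2 where "z2 = (\<lambda>w. w powr (c - 3) * ((c - 2) * ((c - 1) * h w + w * h1 w)) + w powr (c - 2) * ((c - 1) * h1 w + h1 w + w * h2 w))"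
  have Z: "(z has_real_derivative z1 t) (at t)" "(z1 has_real_derivative z2 t) (at t)"
     "t * (1 - t) * z2 t + (2 - c - 2 * t) * z1 t - a * b * z t = 0" if t: "0 < t" "t < 1" for t
  proof -
    have t': "\<bar>t\<bar> < 1" using t by simp
    have p: "t powr (c - 1) = t * (t * t powr (c - 3))" "t powr (c - 2) = t * t powr (c - 3)"
      using powr_add_one [of t "c - 2"] powr_add_one [of t "c - 3"] t by auto
    show "(z has_real_derivative z1 t) (at t)"
      unfolding z_def z1_def using t H(1) [OF t']
      by (auto intro!: derivative_eq_intros simp: p algebra_simps)
    show "(z1 has_real_derivative z2 t) (at t)"
      unfolding z1_def z2_def using t H(1,2) [OF t']
      by (auto intro!: derivative_eq_intros simp: p algebra_simps)
    have e: "(c - a) + (c - b) + 1 = 2 * c" "(c - a) * (c - b) = c * (c - 1) + a * b"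
      using ab by algebra+
    have "t * (1 - t) * z2 t + (2 - c - 2 * t) * z1 t - a * b * z t =
      t powr (c - 3) * (t * t) * (t * (1 - t) * h2 t + (c - 2 * c * t) * h1 t - (c * (c - 1) + a * b) * h t)"
      unfolding z_def z1_def z2_def p by (simp add: algebra_simps)
    thus "t * (1 - t) * z2 t + (2 - c - 2 * t) * z1 t - a * b * z t = 0"
      using H(3) [OF t'] unfolding e by simp
  qed
  have G': "(g has_real_derivative g1 t) (at t)" "(g1 has_real_derivative g2 t) (at t)"
     "t * (1 - t) * g2 t + (2 - c - 2 * t) * g1 t - a * b * g t = 0" if "0 < t" "t < 1" for t
    using G [of t] that by auto
  define P where "P = (\<lambda>w. w powr (2 - c) * (1 - w) powr c)"
  obtain kvg where kvg: "\<And>w. w \<in> {0<..<1} \<Longrightarrow> P w * (v w * g1 w - v1 w * g w) = kvg"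
    using Wronskian_constant [OF V G'] unfolding P_def by blast
  obtain kvz where kvz: "\<And>w. w \<in> {0<..<1} \<Longrightarrow> P w * (v w * z1 w - v1 w * z w) = kvz"
    using Wronskian_constant [OF V Z] unfolding P_def by blast
  obtain kgz where kgz: "\<And>w. w \<in> {0<..<1} \<Longrightarrow> P w * (g w * z1 w - g1 w * z w) = kgz"
    using Wronskian_constant [OF G' Z] unfolding P_def by blast
  have near0: "\<forall>\<^sub>F w in at_right (0::real). w \<in> {0<..<1}"
    by (auto intro!: eventually_at_rightI [of 0 1])
  have near1: "\<forall>\<^sub>F w in at_left (1::real). w \<in> {0<..<1}"
    by (auto intro!: eventually_at_leftI [of 0])
  have c0: "(g \<longlongrightarrow> 1) (at_right 0)" "(g1 \<longlongrightarrow> g1 0) (at_right 0)"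
           "(h \<longlongrightarrow> 1) (at_right 0)" "(h1 \<longlongrightarrow> h1 0) (at_right 0)"
  proof -
    have g0: "g 0 = 1" "h 0 = 1" by (simp_all add: g_def h_def x0 y_def)
    have right: "(\<phi> \<longlongrightarrow> \<phi> 0) (at_right 0)" if "(\<phi> has_real_derivative D) (at 0)" for \<phi> D
      using DERIV_isCont [OF that] by (auto simp: isCont_def filterlim_at_split)
    show "(g \<longlongrightarrow> 1) (at_right 0)"
      using right [OF G(1) [of 0]] unfolding g0 by simp
    show "(h \<longlongrightarrow> 1) (at_right 0)"
      using right [OF H(1) [of 0]] unfolding g0 by simp
    show "(g1 \<longlongrightarrow> g1 0) (at_right 0)"
      using right [OF G(2) [of 0]] by simp
    show "(h1 \<longlongrightarrow> h1 0) (at_right 0)"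
      using right [OF H(2) [of 0]] by simp
  qed
  \<comment> \<open>The constant is read off as w tends to 0. The powers of w cancel before the
    limit is taken, since individually they may diverge.\<close>
  have kgz_eq: "kgz = c - 1"
  proof -
    have "((\<lambda>w. (1 - w) powr c * (g w * ((c - 1) * h w + w * h1 w) - g1 w * (w * h w))) \<longlongrightarrow>
        (1 - 0) powr c * (1 * ((c - 1) * 1 + 0 * h1 0) - g1 0 * (0 * 1))) (at_right 0)"
      by (intro tendsto_intros c0) auto
    moreover have "\<forall>\<^sub>F w in at_right 0. (1 - w) powr c * (g w * ((c - 1) * h w + w * h1 w) - g1 w * (w * h w)) = kgz"
      using near0
    proof eventually_elim
      case (elim w)
      have "w powr (2 - c) * w powr (c - 2) = 1" using elim by (simp flip: powr_add)
      moreover have "w powr (c - 1) = w * w powr (c - 2)" using powr_add_one [of w "c - 2"] elim by simp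
      ultimately have "kgz = (w powr (2 - c) * w powr (c - 2)) * ((1 - w) powr c * (g w * ((c - 1) * h w + w * h1 w) - g1 w * (w * h w)))"
        using kgz [OF elim] unfolding P_def z_def z1_def by (simp add: algebra_simps)
      thus ?case using \<open>w powr (2 - c) * w powr (c - 2) = 1\<close> by simp
    qed
    ultimately have "((\<lambda>w. kgz) \<longlongrightarrow> (1 - 0) powr c * (1 * ((c - 1) * 1 + 0 * h1 0) - g1 0 * (0 * 1))) (at_right (0::real))"
      by (rule Lim_transform_eventually)
    thus ?thesis by (simp add: tendsto_const_iff)
  qed
  \<comment> \<open>Cramer's rule: v W(g,z) = g W(v,z) - z W(v,g), with all three weighted
    Wronskians constant.\<close>
  have comb: "v w * (c - 1) = g w * kvz - z w * kvg" if "w \<in> {0<..<1}" for w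
  proof -
    have "v w * (P w * (g w * z1 w - g1 w * z w)) =
        g w * (P w * (v w * z1 w - v1 w * z w)) - z w * (P w * (v w * g1 w - v1 w * g w))"
      by (simp add: algebra_simps)
    thus ?thesis unfolding kvg [OF that] kvz [OF that] kgz [OF that] kgz_eq .
  qed
  have contf: "continuous_on {0..1} (hyp_fun a b c)"
    unfolding hyp_fun_def by (rule continuous_on_power_series_unit_interval [OF sma])
  \<comment> \<open>As w tends to 0 the solution \<open>z\<close> vanishes because c > 1,
    \<open>g\<close> tends to 1, and \<open>v\<close> tends to the Gauss value
    \<open>f1\<close>.\<close>
  have kvz_eq: "kvz = f1 * (c - 1)"
  proof -
    have "continuous_on {0..1} v" unfolding v_def
      by (rule continuous_on_compose2 [OF contf]) (auto intro!: continuous_intros)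
    hence "(v \<longlongrightarrow> v 0) (at 0 within {0..1})" by (simp add: continuous_on_def)
    hence "(v \<longlongrightarrow> f1) (at_right 0)" using f_at_1 by (simp add: v_def at_within_Icc_at_right)
    hence "((\<lambda>w. v w * (c - 1)) \<longlongrightarrow> f1 * (c - 1)) (at_right 0)" by (intro tendsto_intros)
    moreover have "\<forall>\<^sub>F w in at_right 0. v w * (c - 1) = g w * kvz - w powr (c - 1) * h w * kvg"
      using near0 by eventually_elim (use comb in \<open>simp add: z_def\<close>)
    ultimately have "((\<lambda>w. g w * kvz - w powr (c - 1) * h w * kvg) \<longlongrightarrow> f1 * (c - 1)) (at_right 0)"
      by (rule Lim_transform_eventually)
    moreover have "((\<lambda>w. g w * kvz - w powr (c - 1) * h w * kvg) \<longlongrightarrow> 1 * kvz - 0 powr (c - 1) * 1 * kvg) (at_right 0)"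
      using c by (intro tendsto_intros c0) (auto intro!: eventually_at_rightI [of 0 1])
    ultimately have "f1 * (c - 1) = 1 * kvz - 0 powr (c - 1) * 1 * kvg"
      by (rule tendsto_unique [rotated]) simp
    thus ?thesis using c by simp
  qed
  define d where "d = - kvg / (c - 1)"
  have vw: "v w = f1 * g w + d * z w" if "w \<in> {0<..<1}" for w
    using comb [OF that] c unfolding kvz_eq d_def by (simp add: field_simps)
  \<comment> \<open>Multiply by (1-w)^(c-1) and let w tend to 1. The bounded function
    \<open>v\<close> contributes 0, while \<open>g\<close> and \<open>h\<close> contribute their
    Abelian limits \<open>K\<close> and \<open>f1\<close>; thus f1 K + d f1 = 0.\<close>
  have "d = - K"
  proof -
    have lg: "((\<lambda>w. (1 - w) powr (c - 1) * g w) \<longlongrightarrow> K) (at_left 1)"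
      unfolding g_def by (rule Abelian_binomial_limit [OF _ lim]) (use c in simp)
    have lh: "((\<lambda>w. (1 - w) powr (c - 1) * h w) \<longlongrightarrow> f1) (at_left 1)"
      unfolding h_def by (rule Abelian_binomial_limit [OF _ limy]) (use c in simp)
    have "continuous_on {0..1} v" unfolding v_def
      by (rule continuous_on_compose2 [OF contf]) (auto intro!: continuous_intros)
    hence "(v \<longlongrightarrow> v 1) (at 1 within {0..1})" by (simp add: continuous_on_def)
    hence lv: "(v \<longlongrightarrow> 1) (at_left 1)" by (simp add: v_def at_within_Icc_at_left)
    have "((\<lambda>w. (1 - w) powr (c - 1) * v w) \<longlongrightarrow> (1 - 1) powr (c - 1) * 1) (at_left 1)"
      using c by (intro tendsto_intros lv) (auto intro!: eventually_at_leftI [of 0])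
    hence l0: "((\<lambda>w. (1 - w) powr (c - 1) * v w) \<longlongrightarrow> 0) (at_left 1)" by simp
    have "((\<lambda>w. f1 * ((1 - w) powr (c - 1) * g w) + d * (w powr (c - 1) * ((1 - w) powr (c - 1) * h w)))
        \<longlongrightarrow> f1 * K + d * (1 powr (c - 1) * f1)) (at_left 1)"
      by (intro tendsto_intros lg lh) auto
    moreover have "\<forall>\<^sub>F w in at_left 1. f1 * ((1 - w) powr (c - 1) * g w) + d * (w powr (c - 1) * ((1 - w) powr (c - 1) * h w)) =
        (1 - w) powr (c - 1) * v w"
      using near1 by eventually_elim (simp add: vw z_def algebra_simps)
    ultimately have "((\<lambda>w. (1 - w) powr (c - 1) * v w) \<longlongrightarrow> f1 * K + d * (1 powr (c - 1) * f1)) (at_left 1)"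
      by (rule Lim_transform_eventually)
    with l0 have "0 = f1 * K + d * (1 powr (c - 1) * f1)"
      by (rule tendsto_unique [rotated]) simp
    hence "f1 * (K + d) = 0" by (simp add: algebra_simps)
    thus ?thesis using f1 by simp
  qed
  thus ?thesis
    using vw [of w] w by (simp add: v_def g_def z_def h_def f1_def y_def)
qed

subsection \<open>Termwise integration\<close>

text \<open>Interchange of sum and integral by summability of the L1 norms. The proof passes through
  the Lebesgue integral and returns to the gauge integral in which the moments are
  expressed.\<close>

lemma sums_integral_Icc:
  fixes u :: "nat \<Rightarrow> real \<Rightarrow> real"
  assumes cont: "\<And>l. continuous_on {0..1} (u l)"
    and bound: "\<And>l. integral {0..1} (\<lambda>t. \<bar>u l t\<bar>) \<le> B l" and B: "summable B"
    and abs: "\<And>t. t \<in> {0..1} \<Longrightarrow> summable (\<lambda>l. \<bar>u l t\<bar>)"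
    and U: "\<And>t. t \<in> {0..1} \<Longrightarrow> (\<lambda>l. u l t) sums U t"
  shows "U integrable_on {0..1}" and "(\<lambda>l. integral {0..1} (u l)) sums integral {0..1} U"
proof -
  define v where "v = (\<lambda>l t. indicator {0..1} t *\<^sub>R u l t)"
  have int: "integrable lborel (v l)" for l
    using borel_integrable_atLeastAtMost' [OF cont [of l]] by (simp add: set_integrable_def v_def)
  have eq: "set_lebesgue_integral lborel {0..1} (u l) = integral {0..1} (u l)" for l
    by (rule set_borel_integral_eq_integral) (rule borel_integrable_atLeastAtMost' [OF cont])
  have nrm: "(LINT t|lborel. norm (v l t)) = integral {0..1} (\<lambda>t. \<bar>u l t\<bar>)" for l
  proof -
    have "(LINT t|lborel. norm (v l t)) = set_lebesgue_integral lborel {0..1} (\<lambda>t. \<bar>u l t\<bar>)"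
      by (simp add: set_lebesgue_integral_def v_def abs_mult)
    also have "\<dots> = integral {0..1} (\<lambda>t. \<bar>u l t\<bar>)"
      by (rule set_borel_integral_eq_integral, rule borel_integrable_atLeastAtMost')
         (intro continuous_intros cont)
    finally show ?thesis .
  qed
  have s1: "AE t in lborel. summable (\<lambda>l. norm (v l t))"
    by (intro AE_I2) (auto simp: v_def indicator_def abs)
  have s2: "summable (\<lambda>l. LINT t|lborel. norm (v l t))"
    unfolding nrm
    by (rule summable_comparison_test' [OF B, of 0])
       (subst real_norm_def, subst abs_of_nonneg,
        auto intro!: bound Henstock_Kurzweil_Integration.integral_nonneg integrable_continuous_real continuous_intros cont)
  have vU: "(\<Sum>l. v l t) = indicator {0..1} t *\<^sub>R U t" for t
    using U [of t] by (auto simp: v_def indicator_def sums_iff)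
  have si: "set_integrable lborel {0..1} U"
    using integrable_suminf [OF int s1 s2] unfolding vU set_integrable_def .
  show "U integrable_on {0..1}" using set_borel_integral_eq_integral(1) [OF si] .
  have "(\<lambda>l. LINT t|lborel. v l t) sums (LINT t|lborel. (\<Sum>l. v l t))"
    by (rule sums_integral [OF int s1 s2])
  thus "(\<lambda>l. integral {0..1} (u l)) sums integral {0..1} U"
    unfolding vU unfolding v_def set_lebesgue_integral_def [symmetric] eq
      set_borel_integral_eq_integral(2) [OF si] .
qed

text \<open>The value of the integral of t^(c-1) (1-t)^d 2F1(a, b; c; t) over [0,1], as
  \<open>integral_hyp_moment\<close> shows.\<close>

definition hyp_moment :: "real \<Rightarrow> real \<Rightarrow> real \<Rightarrow> real \<Rightarrow> real" where
  "hyp_moment a b c d = Gamma c * Gamma (d + 1) * Gamma (c + d + 1 - a - b) *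
     rGamma (c + d + 1 - a) * rGamma (c + d + 1 - b)"

lemma powr_add_nat:
  fixes t a :: real
  assumes "t \<ge> 0" "a > 0"
  shows "t powr (a + real l) = t powr a * t ^ l"
  using assms by (cases "t = 0") (auto simp: powr_add powr_realpow)

text \<open>Termwise Beta integrals contribute (c)_l / (c+d+1)_l. The symbol (c)_l cancels the
  denominator of the series, which leaves a Gauss sum with lower parameter c + d + 1.\<close>

lemma integral_hyp_moment:
  assumes c: "c > 1" and cab: "c - a - b > 0" and d: "d > 0"
  shows "integral {0..1} (\<lambda>t. t powr (c - 1) * (1 - t) powr d * hyp_fun a b c t) = hyp_moment a b c d"
    (is "?I = _")
proof -
  let ?W = "\<lambda>t. t powr (c - 1) * (1 - t) powr d"
  have c': "c \<notin> \<int>\<^sub>\<le>\<^sub>0" "c + d + 1 \<notin> \<int>\<^sub>\<le>\<^sub>0" using c d by auto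
  have s: "summable (\<lambda>n. \<bar>hyp_coeff a b c n\<bar>)" by (rule hyp_coeff_abs_summable [OF c'(1) cab])
  define B where "B = Beta c (d + 1)"
  have B: "(?W has_integral B) {0..1}"
    using has_integral_Beta_real [of c "d + 1"] c d by (simp add: B_def)
  define u where "u = (\<lambda>l t. ?W t * (hyp_coeff a b c l * t ^ l))"
  have cont: "continuous_on {0..1} (u l)" for l
    unfolding u_def using d c by (intro continuous_intros continuous_on_powr') auto
  have ab: "\<bar>u l t\<bar> \<le> \<bar>hyp_coeff a b c l\<bar> * ?W t" if "t \<in> {0..1}" for l t
  proof -
    have "\<bar>u l t\<bar> = \<bar>hyp_coeff a b c l\<bar> * ?W t * t ^ l"
      using that by (simp add: u_def abs_mult)
    also have "\<dots> \<le> \<bar>hyp_coeff a b c l\<bar> * ?W t"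
      using that by (intro mult_left_le power_le_one mult_nonneg_nonneg) auto
    finally show ?thesis .
  qed
  have "(\<lambda>l. integral {0..1} (u l)) sums
      ?I"
  proof (rule sums_integral_Icc(2) [OF cont])
    fix l
    have "integral {0..1} (\<lambda>t. \<bar>u l t\<bar>) \<le> integral {0..1} (\<lambda>t. \<bar>hyp_coeff a b c l\<bar> * ?W t)"
      by (intro integral_le integrable_continuous_real continuous_intros cont ab continuous_on_powr')
         (use d c in auto)
    also have "\<dots> = \<bar>hyp_coeff a b c l\<bar> * B"
      using has_integral_mult_right [OF B] by (rule integral_unique)
    finally show "integral {0..1} (\<lambda>t. \<bar>u l t\<bar>) \<le> \<bar>hyp_coeff a b c l\<bar> * B" .
  next
    show "summable (\<lambda>l. \<bar>hyp_coeff a b c l\<bar> * B)" by (intro summable_mult2 s)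
  next
    fix t :: real assume t: "t \<in> {0..1}"
    show "summable (\<lambda>l. \<bar>u l t\<bar>)"
      by (rule summable_comparison_test' [OF summable_mult2 [OF s, of "?W t"], of 0])
         (use ab [OF t] in simp)
    show "(\<lambda>l. u l t) sums (?W t * hyp_fun a b c t)"
      unfolding u_def hyp_fun_def
      by (intro sums_mult summable_sums summable_power_series_unit_interval s) (use t in auto)
  qed
  moreover have "integral {0..1} (u l) = B * hyp_coeff a b (c + d + 1) l" for l
  proof -
    have "((\<lambda>t. hyp_coeff a b c l * (t powr (c + real l - 1) * (1 - t) powr (d + 1 - 1))) has_integral
        hyp_coeff a b c l * Beta (c + real l) (d + 1)) {0..1}"
      using c d by (intro has_integral_mult_right has_integral_Beta_real) auto
    moreover have "hyp_coeff a b c l * (t powr (c + real l - 1) * (1 - t) powr (d + 1 - 1)) = u l t"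
      if "t \<in> {0..1}" for t
      using powr_add_nat [of t "c - 1" l] that c by (simp add: u_def algebra_simps)
    ultimately have "(u l has_integral hyp_coeff a b c l * Beta (c + real l) (d + 1)) {0..1}"
      using has_integral_cong by (metis (no_types, lifting))
    hence "integral {0..1} (u l) = hyp_coeff a b c l * Beta (c + real l) (d + 1)"
      by (rule integral_unique)
    also have "Beta (c + real l) (d + 1) = B * (pochhammer c l / pochhammer (c + d + 1) l)"
    proof -
      have "Gamma c > 0" "Gamma (c + d + 1) > 0" "Gamma (c + d + 1 + real l) > 0"
        using c d by auto
      thus ?thesis unfolding Beta_def B_def pochhammer_Gamma [OF c'(1)] pochhammer_Gamma [OF c'(2)]
        by (simp add: add_ac)
    qed
    also have "hyp_coeff a b c l * (B * (pochhammer c l / pochhammer (c + d + 1) l)) = B * hyp_coeff a b (c + d + 1) l"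
      using pochhammer_pos [of c l] c by (simp add: hyp_coeff_def mult_ac)
    finally show ?thesis .
  qed
  ultimately have "(\<lambda>l. B * hyp_coeff a b (c + d + 1) l) sums
      ?I" by simp
  moreover have "(\<lambda>l. B * hyp_coeff a b (c + d + 1) l) sums
      (B * (Gamma (c + d + 1) * Gamma (c + d + 1 - a - b) * rGamma (c + d + 1 - a) * rGamma (c + d + 1 - b)))"
    by (intro sums_mult Gauss_hypergeometric_sums c') (use cab d in simp)
  ultimately have "?I =
      B * (Gamma (c + d + 1) * Gamma (c + d + 1 - a - b) * rGamma (c + d + 1 - a) * rGamma (c + d + 1 - b))"
    by (rule sums_unique2)
  also have "\<dots> = hyp_moment a b c d"
  proof -
    have "Gamma (c + d + 1) > 0" using c d by auto
    moreover have e: "c + (d + 1) = c + d + 1" by simp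
    ultimately show ?thesis unfolding B_def hyp_moment_def Beta_def e by simp
  qed
  finally show ?thesis .
qed

text \<open>The expanded series may diverge at t = 0. The interchange is nevertheless legitimate:
  the coefficients are O(l^(c-2)), and the weight t^(c-1) (1-t)^(q+l) has integral O(l^(-c)), so the
  L1 norms are O(l^(-2)).\<close>

lemma hyp_moment_series:
  assumes c: "c > 1" and ab: "a + b = 1" and q: "q > 0"
    and lim: "(\<lambda>n. x n * fact n / pochhammer (c - 1) n) \<longlonglongrightarrow> k"
  defines "U \<equiv> (\<lambda>t. t powr (c - 1) * (1 - t) powr q * hyp_fun a b c t * (\<Sum>l. x l * (1 - t) ^ l))"
  shows "U integrable_on {0..1}"
    and "(\<lambda>l. x l * hyp_moment a b c (q + real l)) sums integral {0..1} U"
proof -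
  have c': "c \<notin> \<int>\<^sub>\<le>\<^sub>0" using c by auto
  have cab: "c - a - b > 0" using c ab by simp
  have s: "summable (\<lambda>n. \<bar>hyp_coeff a b c n\<bar>)" by (rule hyp_coeff_abs_summable [OF c' cab])
  have contf: "continuous_on {0..1} (hyp_fun a b c)"
    unfolding hyp_fun_def by (rule continuous_on_power_series_unit_interval [OF s])
  obtain K where K: "K \<ge> 0" "\<And>t. t \<in> {0..1} \<Longrightarrow> \<bar>hyp_fun a b c t\<bar> \<le> K + 1"
    using hyp_fun_near_0 [OF c' cab] by blast
  define W where "W = (\<lambda>l t. t powr (c - 1) * (1 - t) powr (q + real l))"
  have W: "(W l has_integral Beta c (q + 1 + real l)) {0..1}" for l
    using has_integral_Beta_real [of c "q + 1 + real l"] c q by (simp add: W_def add_ac)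
  have Wc: "continuous_on {0..1} (W l)" for l
    unfolding W_def using q c by (intro continuous_intros continuous_on_powr') auto
  have Wn: "W l t \<ge> 0" if "t \<in> {0..1}" for l t using that by (simp add: W_def)
  define u where "u = (\<lambda>l t. x l * (W l t * hyp_fun a b c t))"
  have ub: "\<bar>u l t\<bar> \<le> \<bar>x l\<bar> * (K + 1) * W l t" if "t \<in> {0..1}" for l t
  proof -
    have "W l t * \<bar>hyp_fun a b c t\<bar> \<le> W l t * (K + 1)" by (rule mult_left_mono [OF K(2) [OF that] Wn [OF that]])
    hence "\<bar>x l\<bar> * (W l t * \<bar>hyp_fun a b c t\<bar>) \<le> \<bar>x l\<bar> * (W l t * (K + 1))"
      by (rule mult_left_mono) simp
    thus ?thesis using Wn [OF that, of l] by (simp add: u_def abs_mult mult_ac)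
  qed
  have cont: "continuous_on {0..1} (u l)" for l
    unfolding u_def by (intro continuous_intros Wc contf)
  obtain C1 where C1: "C1 > 0" "\<And>n. norm (x n * fact n / pochhammer (c - 1) n) \<le> C1"
    using convergent_imp_Bseq [OF convergentI [OF lim]] by (auto elim: BseqE)
  obtain C2 where C2: "C2 > 0" "\<And>n. \<bar>pochhammer (c - 1) n / pochhammer 1 n\<bar> \<le> C2 * (real n + 1) powr (c - 1 - 1)"
    using pochhammer_quotient_bound [of 1 "c - 1"] by auto
  obtain C3 where C3: "C3 > 0" "\<And>n. Beta c (q + 1 + real n) \<le> C3 * (real n + 1) powr (- c)"
    using Beta_real_shift_bound [of c "q + 1"] c q by auto
  have xb: "\<bar>x n\<bar> \<le> C1 * (C2 * (real n + 1) powr (c - 2))" for n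
  proof -
    have pos: "pochhammer (c - 1) n > 0" using c by (intro pochhammer_pos) simp
    hence "\<bar>x n\<bar> = norm (x n * fact n / pochhammer (c - 1) n) * \<bar>pochhammer (c - 1) n / pochhammer 1 n\<bar>"
      by (simp add: abs_mult flip: pochhammer_fact)
    also have "\<dots> \<le> C1 * (C2 * (real n + 1) powr (c - 1 - 1))"
      by (intro mult_mono C1 C2) (use C1 in auto)
    finally show ?thesis by simp
  qed
  have Bpos: "Beta c (q + 1 + real l) \<ge> 0" for l using c q by (simp add: Beta_def)
  have sB: "summable (\<lambda>l. \<bar>x l\<bar> * (K + 1) * Beta c (q + 1 + real l))"
  proof (rule summable_comparison_test')
    show "summable (\<lambda>l. (K + 1) * C1 * C2 * C3 * (real l + 1) powr (-2))"
      by (intro summable_mult) (simp add: summable_real_powr_shift)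
    fix l
    have "\<bar>x l\<bar> * Beta c (q + 1 + real l) \<le> (C1 * (C2 * (real l + 1) powr (c - 2))) * (C3 * (real l + 1) powr (- c))"
      by (intro mult_mono xb C3(2) Bpos) (use C1(1) C2(1) in auto)
    also have "\<dots> = C1 * C2 * C3 * ((real l + 1) powr (c - 2) * (real l + 1) powr (- c))" by (simp add: mult_ac)
    also have "(real l + 1) powr (c - 2) * (real l + 1) powr (- c) = (real l + 1) powr (-2)"
      by (simp flip: powr_add)
    finally have "(K + 1) * (\<bar>x l\<bar> * Beta c (q + 1 + real l)) \<le> (K + 1) * (C1 * C2 * C3 * (real l + 1) powr (-2))"
      using K(1) by (intro mult_left_mono) auto
    thus "norm (\<bar>x l\<bar> * (K + 1) * Beta c (q + 1 + real l)) \<le> (K + 1) * C1 * C2 * C3 * (real l + 1) powr (-2)"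
      using Bpos [of l] K(1) by (simp add: abs_mult mult_ac)
  qed
  have ib: "integral {0..1} (\<lambda>t. \<bar>u l t\<bar>) \<le> \<bar>x l\<bar> * (K + 1) * Beta c (q + 1 + real l)" for l
  proof -
    have "integral {0..1} (\<lambda>t. \<bar>u l t\<bar>) \<le> integral {0..1} (\<lambda>t. \<bar>x l\<bar> * (K + 1) * W l t)"
      by (intro integral_le integrable_continuous_real continuous_intros cont ub Wc)
    also have "\<dots> = \<bar>x l\<bar> * (K + 1) * Beta c (q + 1 + real l)"
      using has_integral_mult_right [OF W] by (rule integral_unique)
    finally show ?thesis .
  qed
  have ue: "u l t = t powr (c - 1) * (1 - t) powr q * hyp_fun a b c t * (x l * (1 - t) ^ l)" if "t \<in> {0..1}" for l t
    using powr_add_nat [of "1 - t" q l] that q by (simp add: u_def W_def mult_ac)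
  have sx: "summable (\<lambda>l. x l * w ^ l)" if "\<bar>w\<bar> < 1" for w
    by (rule summable_compare_binomial [OF _ lim that]) (use c in simp)
  have sums: "(\<lambda>l. u l t) sums U t \<and> summable (\<lambda>l. \<bar>u l t\<bar>)" if t: "t \<in> {0..1}" for t
  \<comment> \<open>At t = 0 nothing is known about convergence of the series in x, but the factor
    \<open>0 powr (c - 1)\<close> is 0, so every term and \<open>U\<close> itself vanish
    there.\<close>
  proof (cases "t = 0 \<or> t = 1")
    case True
    hence "U t = 0" "\<And>l. u l t = 0" using ue [OF t] by (auto simp: U_def)
    thus ?thesis by simp
  next
    case False
    hence t1: "\<bar>1 - t\<bar> < 1" using t by auto
    define r where "r = (\<bar>1 - t\<bar> + 1) / 2"
    have r: "\<bar>1 - t\<bar> < r" "\<bar>r\<bar> < 1" using t1 by (auto simp: r_def)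
    have "summable (\<lambda>l. norm (x l * (1 - t) ^ l))"
      by (rule powser_insidea [OF sx [OF r(2)]]) (use r in simp)
    hence "summable (\<lambda>l. \<bar>t powr (c - 1) * (1 - t) powr q * hyp_fun a b c t\<bar> * norm (x l * (1 - t) ^ l))"
      by (rule summable_mult)
    moreover have "(\<lambda>l. u l t) sums U t"
      unfolding ue [OF t] U_def by (intro sums_mult summable_sums sx t1)
    ultimately show ?thesis unfolding ue [OF t] by (simp add: abs_mult)
  qed
  show "U integrable_on {0..1}"
    by (rule sums_integral_Icc(1) [OF cont ib sB]) (use sums in auto)
  have "(\<lambda>l. integral {0..1} (u l)) sums integral {0..1} U"
    by (rule sums_integral_Icc(2) [OF cont ib sB]) (use sums in auto)
  moreover have "integral {0..1} (u l) = x l * hyp_moment a b c (q + real l)" for l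
    unfolding u_def W_def using integral_hyp_moment [OF c cab, of "q + real l"] q by simp
  ultimately show "(\<lambda>l. x l * hyp_moment a b c (q + real l)) sums integral {0..1} U" by simp
qed

theorem integral_hyp_fun_square:
  fixes x :: "nat \<Rightarrow> real" and a b c K :: real
  assumes ab: "a + b = 1" and c: "c > 1" and ca: "c > a" and cb: "c > b" and q: "q > 0"
    and x0: "x 0 = 1"
    and rec: "\<And>n. (real n + 1) * (real n + (2 - c)) * x (Suc n) = (real n + a) * (real n + b) * x n"
    and lim: "(\<lambda>n. x n * fact n / pochhammer (c - 1) n) \<longlonglongrightarrow> K"
  defines "y \<equiv> hyp_coeff (c - a) (c - b) c"
  shows "summable (\<lambda>l. x l * hyp_moment a b c (q + real l))"
    and "summable (\<lambda>l. y l * hyp_moment a b c (q + c - 1 + real l))"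
    and "integral {0..1} (\<lambda>t. t powr (c - 1) * (1 - t) powr q * (hyp_fun a b c t)\<^sup>2) =
        Gamma c * Gamma (c - 1) * rGamma (c - a) * rGamma (c - b) * (\<Sum>l. x l * hyp_moment a b c (q + real l))
        - K * (\<Sum>l. y l * hyp_moment a b c (q + c - 1 + real l))"
    (is "?I = ?J")
proof -
  define f1 where "f1 = Gamma c * Gamma (c - 1) * rGamma (c - a) * rGamma (c - b)"
  have c': "c \<notin> \<int>\<^sub>\<le>\<^sub>0" "c - 1 \<notin> \<int>\<^sub>\<le>\<^sub>0" using c by auto
  have limy: "(\<lambda>n. y n * fact n / pochhammer (c - 1) n) \<longlonglongrightarrow> f1"
    unfolding y_def f1_def by (rule hyp_coeff_Euler_tendsto [OF ab c])
  have qc: "q + c - 1 > 0" using c q by simp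
  define U where "U = (\<lambda>t. t powr (c - 1) * (1 - t) powr q * hyp_fun a b c t * (\<Sum>l. x l * (1 - t) ^ l))"
  define V where "V = (\<lambda>t. t powr (c - 1) * (1 - t) powr (q + c - 1) * hyp_fun a b c t * (\<Sum>l. y l * (1 - t) ^ l))"
  have U: "U integrable_on {0..1}" "(\<lambda>l. x l * hyp_moment a b c (q + real l)) sums integral {0..1} U"
    using hyp_moment_series [OF c ab q lim] by (simp_all add: U_def)
  have V: "V integrable_on {0..1}" "(\<lambda>l. y l * hyp_moment a b c (q + c - 1 + real l)) sums integral {0..1} V"
    using hyp_moment_series [OF c ab qc limy] by (simp_all add: V_def)
  show "summable (\<lambda>l. x l * hyp_moment a b c (q + real l))"
       "summable (\<lambda>l. y l * hyp_moment a b c (q + c - 1 + real l))"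
    using U V by (auto simp: sums_iff)
  have "?I = integral {0..1} (\<lambda>t. f1 * U t - K * V t)"
  proof (rule Henstock_Kurzweil_Integration.integral_cong)
    fix t :: real assume t: "t \<in> {0..1}"
    show "t powr (c - 1) * (1 - t) powr q * (hyp_fun a b c t)\<^sup>2 = f1 * U t - K * V t"
    proof (cases "t = 0 \<or> t = 1")
      case True
      thus ?thesis by (auto simp: U_def V_def)
    next
      case False
      hence w: "0 < 1 - t" "1 - t < 1" using t by auto
      have conn: "hyp_fun a b c t = f1 * (\<Sum>n. x n * (1 - t) ^ n) - K * ((1 - t) powr (c - 1) * (\<Sum>n. y n * (1 - t) ^ n))"
        using hypergeometric_connection [OF ab c ca cb x0 rec lim w] by (simp add: f1_def y_def)
      have pw: "(1 - t) powr (q + c - 1) = (1 - t) powr q * (1 - t) powr (c - 1)"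
        by (simp flip: powr_add add: algebra_simps)
      have "t powr (c - 1) * (1 - t) powr q * (hyp_fun a b c t)\<^sup>2 =
          t powr (c - 1) * (1 - t) powr q * hyp_fun a b c t * hyp_fun a b c t"
        by (simp add: power2_eq_square)
      also have "\<dots> = t powr (c - 1) * (1 - t) powr q * hyp_fun a b c t *
          (f1 * (\<Sum>n. x n * (1 - t) ^ n) - K * ((1 - t) powr (c - 1) * (\<Sum>n. y n * (1 - t) ^ n)))"
        by (subst (2) conn) (rule refl)
      also have "\<dots> = f1 * U t - K * V t"
        unfolding U_def V_def pw by (simp only: right_diff_distrib mult_ac)
      finally show ?thesis .
    qed
  qed
  also have "\<dots> = f1 * integral {0..1} U - K * integral {0..1} V"
    using U(1) V(1) by (simp add: Henstock_Kurzweil_Integration.integral_diff integrable_on_mult_right)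
  finally show "?I = ?J"
    using U(2) V(2) by (simp add: sums_iff f1_def)
qed

subsection \<open>The integral for large real s\<close>

definition hyper_term :: "'a :: field_char_0 list \<Rightarrow> 'a list \<Rightarrow> nat \<Rightarrow> 'a" where
  "hyper_term as bs l = (\<Prod>a\<leftarrow>as. pochhammer a l) / (\<Prod>b\<leftarrow>bs. pochhammer b l) / fact l"

lemma fps_hypergeo_nth_eq_hyper_term: "fps_hypergeo as bs 1 $ l = hyper_term as bs l"
proof -
  have "foldr (\<lambda>a r. r * pochhammer a l) xs c = c * (\<Prod>a\<leftarrow>xs. pochhammer a l)" for xs :: "'a list" and c
    by (induction xs) (simp_all add: ac_simps)
  thus ?thesis
    by (simp add: fps_hypergeo_nth_alt hyper_term_def del: fps_hypergeo_nth)
qed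

lemma hypergeometric_eq_suminf: "hypergeometric as bs z = (\<Sum>l. hyper_term as bs l * z ^ l)"
  by (simp add: hypergeometric_def eval_fps_def fps_hypergeo_nth_eq_hyper_term del: fps_hypergeo_nth)

lemma hyper_term_of_real:
  "hyper_term (map of_real as) (map of_real bs) l = (of_real (hyper_term as bs l) :: 'a :: {real_field, field_char_0})"
proof -
  have "(\<Prod>a\<leftarrow>map of_real xs. pochhammer (a :: 'a) l) = of_real (\<Prod>a\<leftarrow>xs. pochhammer a l)" for xs
    by (induction xs) (simp_all add: pochhammer_of_real)
  thus ?thesis by (simp add: hyper_term_def del: map_map)
qed

lemma hypergeometric_of_real_1:
  assumes "summable (hyper_term as bs)"
  shows "hypergeometric (map of_real as) (map of_real bs) 1 = complex_of_real (\<Sum>l. hyper_term as bs l)"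
  using assms by (simp add: hypergeometric_eq_suminf hyper_term_of_real suminf_of_real)

lemma S_fun_eq_hyp_fun:
  "S_fun n m t = pochhammer (real n - 1) m / pochhammer (real n / 2) m *
     hyp_fun (real m) (1 - real n / 2) (real m + real n / 2) t"
  by (simp add: S_fun_def hypergeometric_eq_suminf hyp_fun_def hyper_term_def hyp_coeff_def)

text \<open>The moment index is s + 2p - 1 because \<kappa> = 2p - 1 for F, so that the weight
  contains exactly (1-t)^s.\<close>

lemma I_integral_of_real:
  assumes n: "n > 2" and m: "m \<ge> 1" and s: "s > 0"
  defines "p \<equiv> real n / 2"
  shows "I_integral n m (of_real s) = complex_of_real (
    Gamma (p + s + 1) / (Gamma p * Gamma (s + 1)) * (pochhammer (real n - 1) m / pochhammer p m)\<^sup>2 *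
    hypergeometric_ode.sq_moment (real m) (1 - p) (real m + p) (hyp_fun (real m) (1 - p) (real m + p)) (s + 2 * p - 1))"
proof -
  have p: "p \<ge> 3/2" using n by (simp add: p_def)
  interpret F: hypergeometric_ode "real m" "1 - p" "real m + p"
    "hyp_fun (real m) (1 - p) (real m + p)" "hyp_fun1 (real m) (1 - p) (real m + p)" "hyp_fun2 (real m) (1 - p) (real m + p)"
    by (rule hypergeometric_ode_hyp_fun) (use m p in auto)
  define P where "P = pochhammer (real n - 1) m / pochhammer p m"
  define g where "g = (\<lambda>t. t powr (real m + p - 1) * (1 - t) powr s * (hyp_fun (real m) (1 - p) (real m + p) t)\<^sup>2)"
  have gc: "continuous_on {0..1} g"
    unfolding g_def using m p s by (intro continuous_intros continuous_on_powr' F.cont_G) auto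
  have si: "set_integrable lborel {0<..<1} g"
    by (rule set_integrable_subset [OF borel_integrable_atLeastAtMost' [OF gc]]) auto
  let ?f = "\<lambda>t. complex_of_real (t powr (real m + real n / 2 - 1)) *
      of_real (1 - t) powr complex_of_real s * of_real ((S_fun n m t)\<^sup>2)"
  have "(LBINT t:{0<..<1}. ?f t) = (LBINT t:{0<..<1}. complex_of_real (P\<^sup>2 * g t))"
  proof (rule set_lebesgue_integral_cong)
    show "\<forall>t. t \<in> {0<..<1} \<longrightarrow> ?f t = of_real (P\<^sup>2 * g t)"
    proof (intro allI impI)
      fix t :: real assume "t \<in> {0<..<1}"
      hence "complex_of_real (1 - t) powr complex_of_real s = of_real ((1 - t) powr s)"
        by (intro powr_of_real) auto
      moreover have "real n / 2 = p" by (simp add: p_def)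
      ultimately show "?f t = of_real (P\<^sup>2 * g t)"
        by (simp add: S_fun_eq_hyp_fun P_def g_def power_mult_distrib power_divide)
    qed
  qed auto
  also have "\<dots> = complex_of_real (LBINT t:{0<..<1}. P\<^sup>2 * g t)" by (rule set_integral_complex_of_real)
  also have "(LBINT t:{0<..<1}. P\<^sup>2 * g t) = P\<^sup>2 * (LBINT t:{0<..<1}. g t)" by simp
  also have "(LBINT t:{0<..<1}. g t) = integral {0<..<1} g"
    by (rule set_borel_integral_eq_integral(2) [OF si])
  also have "\<dots> = integral {0..1} g" by (rule integral_open_interval_real [symmetric])
  also have "\<dots> = F.sq_moment (s + 2 * p - 1)"
    unfolding g_def F.sq_moment_def F.\<kappa>_def by (simp add: algebra_simps)
  finally show ?thesis
    unfolding I_integral_def P_def [symmetric]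
    by (simp add: p_def flip: Gamma_complex_of_real)
qed

text \<open>For a + b = 1 the Gamma argument c + q + 1 - a - b is c + q. A moment thus contributes
  two numerator and two denominator parameters, and turns the 2F1 coefficients of a local solution
  into those of a 4F3.\<close>

lemma hyp_moment_add_nat:
  assumes ab: "a + b = 1" and q: "q > 0" and c: "c > 0" "c > a" "c > b"
  shows "hyp_moment a b c (q + real l) = hyp_moment a b c q *
    (pochhammer (q + 1) l * pochhammer (c + q) l / (pochhammer (c + q + 1 - a) l * pochhammer (c + q + 1 - b) l))"
proof -
  have R: "rGamma (x + real l) = rGamma x / pochhammer x l" if "x > 0" for x
    using pochhammer_rGamma [of x l] pochhammer_pos [OF that, of l] by (simp add: field_simps)
  have e: "q + real l + 1 = (q + 1) + real l" "c + (q + real l) + 1 - a - b = (c + q) + real l"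
     "c + (q + real l) + 1 - a = (c + q + 1 - a) + real l" "c + (q + real l) + 1 - b = (c + q + 1 - b) + real l"
     "c + q + 1 - a - b = c + q"
    using ab by auto
  have pos: "q + 1 > 0" "c + q > 0" "c + q + 1 - a > 0" "c + q + 1 - b > 0" using c q by auto
  show ?thesis
    unfolding hyp_moment_def e(2,5) unfolding e(1,3,4) Gamma_add_of_nat [OF pos(1)] Gamma_add_of_nat [OF pos(2)] R [OF pos(3)] R [OF pos(4)]
    by simp
qed

lemma A_term_of_real:
  fixes n m :: nat and s :: real
  defines "p \<equiv> real n / 2"
  assumes "summable (hyper_term [p, s - real m + p + 1, 1 - p, s + 2 * p] [s + 3 * p, 2 - real m - p, s + p + 1])" (is "summable ?T")
  shows "A_term n m (of_real s) = complex_of_real (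
    (pochhammer (real n - 1) m)\<^sup>2 *
    (Gamma p * Gamma (s + 4 * p - 1) * Gamma (real m + p - 1) * Gamma (s + 2 * p)) /
    (Gamma (real m) * Gamma (real m + 2 * p - 1) * Gamma (s + 3 * p) * Gamma (s + real m + 3 * p - 1)) *
    (\<Sum>l. ?T l))"
proof -
  have l: "A_num n m (of_real s) = map complex_of_real [p, s - real m + p + 1, 1 - p, s + 2 * p]"
          "A_den n m (of_real s) = map complex_of_real [s + 3 * p, 2 - real m - p, s + p + 1]"
    by (simp_all add: A_num_def A_den_def p_def)
  show ?thesis
    unfolding A_term_def l hypergeometric_of_real_1 [OF assms(2)]
    by (simp add: p_def algebra_simps flip: Gamma_complex_of_real pochhammer_of_real)
qed

lemma B_term_of_real:
  fixes n m :: nat and s :: real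
  defines "p \<equiv> real n / 2"
  assumes "summable (hyper_term [s + 2 * p, real m + 2 * p - 1, s + real m + 3 * p - 1, real m]
      [s + real m + 2 * p, real m + p, s + real m + 4 * p - 1])" (is "summable ?T")
  shows "B_term n m (of_real s) = complex_of_real (
    (pochhammer (real n - 1) m)\<^sup>2 / pochhammer (s + 2 * p) m *
    (Gamma (s + p + 1) * Gamma (s + 4 * p - 1) * Gamma (1 - real m - p)) /
    (Gamma (s - real m + p + 1) * Gamma (1 - p) * Gamma (s + real m + 4 * p - 1)) *
    (\<Sum>l. ?T l))"
proof -
  have l: "B_num n m (of_real s) = map complex_of_real [s + 2 * p, real m + 2 * p - 1, s + real m + 3 * p - 1, real m]"
          "B_den n m (of_real s) = map complex_of_real [s + real m + 2 * p, real m + p, s + real m + 4 * p - 1]"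
    by (simp_all add: B_num_def B_den_def p_def)
  show ?thesis
    unfolding B_term_def l hypergeometric_of_real_1 [OF assms(2)]
    by (simp add: p_def algebra_simps flip: Gamma_complex_of_real pochhammer_of_real)
qed

text \<open>
  Here \<open>2 - (m + p)\<close> may be a non-positive integer; the coefficients beyond \<open>l = k\<close> vanish, also
  where \<open>hyp_coeff\<close> divides by zero.
\<close>

lemma hyp_coeff_truncated_rec:
  assumes m: "m \<ge> 1" and p: "p = real k + 1"
  shows "(real l + 1) * (real l + (2 - (real m + p))) * hyp_coeff p (1 - p) (2 - (real m + p)) (Suc l) =
      (real l + p) * (real l + (1 - p)) * hyp_coeff p (1 - p) (2 - (real m + p)) l"
proof (cases "2 - (real m + p) + real l = 0")
  case False
  thus ?thesis using hyp_coeff_Suc [OF False, of p "1 - p"] by (simp add: algebra_simps)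
next
  case True
  hence "real l = real (m + k - 1)" using m p by (simp add: of_nat_diff)
  hence l: "l = m + k - 1" by (simp only: of_nat_eq_iff)
  have "(real l + (1 - p)) * hyp_coeff p (1 - p) (2 - (real m + p)) l = 0"
  proof (cases "l = k")
    case False
    hence "k < l" using l m by auto
    hence "pochhammer (1 - p) l = 0" unfolding p
      using pochhammer_of_nat_eq_0_iff [of k l, where 'a = real] by simp
    thus ?thesis by (simp add: hyp_coeff_def)
  qed (simp add: p)
  moreover have "real l + (2 - (real m + p)) = 0" using True by simp
  ultimately show ?thesis by (simp only: mult.assoc mult_zero_left mult_zero_right)
qed

lemma hyp_coeff_truncated_lim:
  assumes p: "p = real k + 1"
  shows "(\<lambda>l. hyp_coeff p (1 - p) c l * fact l / pochhammer d l) \<longlonglongrightarrow> 0"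
proof (rule tendsto_eventually)
  show "\<forall>\<^sub>F l in sequentially. hyp_coeff p (1 - p) c l * fact l / pochhammer d l = 0"
    using eventually_gt_at_top [of k]
  proof eventually_elim
    case (elim l)
    hence "pochhammer (1 - p) l = 0" unfolding p
      using pochhammer_of_nat_eq_0_iff [of k l, where 'a = real] by simp
    thus ?case by (simp add: hyp_coeff_def)
  qed
qed

theorem I_integral_large_real:
  fixes n m :: nat
  assumes n: "n > 2" and m: "m \<ge> 1"
  shows "\<exists>s0. \<forall>s\<ge>s0. I_integral n m (of_real s) =
      (if even n then A_term n m (of_real s) else B_term n m (of_real s) + A_term n m (of_real s))"
proof -
  define p where "p = real n / 2"
  define M where "M = real m"
  define c where "c = M + p"
  have p: "p \<ge> 3/2" using n by (simp add: p_def)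
  have M: "M \<ge> 1" using m by (simp add: M_def)
  have c: "c > 1" "c > p" "c > 1 - p" using p M by (auto simp: c_def)
  obtain r0 where r0: "r0 > 2 * p" "r0 > M + p" and
    tr: "\<And>r. r \<ge> r0 \<Longrightarrow> hypergeometric_ode.sq_moment M (1 - p) (M + p) (hyp_fun M (1 - p) (M + p)) r =
        gauge_factor M p r * hypergeometric_ode.sq_moment p (1 - p) (M + p) (hyp_fun p (1 - p) (M + p)) r"
    using sq_moment_transformation [OF M p] by metis
  interpret f: hypergeometric_ode p "1 - p" "M + p"
    "hyp_fun p (1 - p) (M + p)" "hyp_fun1 p (1 - p) (M + p)" "hyp_fun2 p (1 - p) (M + p)"
    by (rule hypergeometric_ode_hyp_fun) (use M p in auto)
  define x where "x = hyp_coeff p (1 - p) (2 - c)"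
  \<comment> \<open>The limit of the coefficients of the first local solution relative to (c-1)_l /
    l!. For even \<open>n\<close> these coefficients terminate and the limit is 0; the Gamma
    expression has its usual meaning only for odd \<open>n\<close>, since otherwise
    \<open>2 - c\<close> is a pole.\<close>
  define K where "K = (if even n then 0 else Gamma (2 - c) * Gamma (c - 1) * rGamma p * rGamma (1 - p))"
  have odd_nonint: "2 - c \<notin> \<int>\<^sub>\<le>\<^sub>0 \<and> 1 - c \<notin> \<int>\<^sub>\<le>\<^sub>0 \<and> 1 - p \<notin> \<int>\<^sub>\<le>\<^sub>0" if "odd n"
  proof -
    have "r - p \<notin> \<int>" if "r \<in> \<int>" for r
    proof
      assume "r - p \<in> \<int>"
      hence "p \<in> \<int>" using Ints_diff [OF that, of "r - p"] by simp
      then obtain i where "p = of_int i" by (auto elim: Ints_cases)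
      hence "real_of_int (int n) = of_int (2 * i)" by (simp add: p_def)
      hence "int n = 2 * i" by (simp only: of_int_eq_iff)
      thus False using \<open>odd n\<close> by (metis dvd_triv_left even_of_nat)
    qed
    from this [of "2 - M"] this [of "1 - M"] this [of 1] show ?thesis
      using nonpos_Ints_subset_Ints by (auto simp: c_def M_def diff_diff_add)
  qed
  have even_p: "\<exists>k. p = real k + 1" if "even n"
    using that n by (auto elim!: evenE simp: p_def of_nat_diff intro!: exI [of _ "n div 2 - 1"])
  have x0: "x 0 = 1" by (simp add: x_def)
  have rec: "(real l + 1) * (real l + (2 - c)) * x (Suc l) = (real l + p) * (real l + (1 - p)) * x l" for l
  proof (cases "even n")
    case True
    then obtain k where "p = real k + 1" using even_p by blast
    thus ?thesis unfolding x_def c_def M_def by (rule hyp_coeff_truncated_rec [OF m])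
  next
    case False
    thus ?thesis unfolding x_def using odd_nonint by (intro hyp_coeff_rec) auto
  qed
  have lim: "(\<lambda>l. x l * fact l / pochhammer (c - 1) l) \<longlonglongrightarrow> K"
  proof (cases "even n")
    case True
    then obtain k where "p = real k + 1" using even_p by blast
    from hyp_coeff_truncated_lim [OF this] show ?thesis using True by (simp add: x_def K_def)
  next
    case False
    have "c - 1 \<notin> \<int>\<^sub>\<le>\<^sub>0" using c by auto
    hence "(\<lambda>l. pochhammer p l * pochhammer (1 - p) l / (pochhammer (2 - c) l * pochhammer (c - 1) l)) \<longlonglongrightarrow>
        Gamma (2 - c) * Gamma (c - 1) * rGamma p * rGamma (1 - p)"
      using odd_nonint False by (intro pochhammer_pair_quotient_tendsto) auto
    thus ?thesis using False by (simp add: x_def K_def hyp_coeff_def mult_ac)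
  qed
  define y where "y = hyp_coeff M (M + 2 * p - 1) c"
  have yd: "y = hyp_coeff (c - p) (c - (1 - p)) c" by (simp add: y_def c_def algebra_simps)
  show ?thesis
  proof (intro exI allI impI)
    fix s :: real assume s: "s \<ge> r0 + M + p"
    \<comment> \<open>The exponent of 1 - t in the moment of f^2 with index s + 2p - 1, from which
      \<kappa> = M + p - 1 is subtracted.\<close>
    define q where "q = s + p - M"
    have q: "q > 0" and s0: "s > 0" using s r0 p M by (auto simp: q_def)
    define num den where "num = [p, s - M + p + 1, 1 - p, s + 2 * p]" and "den = [s + 3 * p, 2 - M - p, s + p + 1]"
    define numB denB where "numB = [s + 2 * p, M + 2 * p - 1, s + M + 3 * p - 1, M]"
      and "denB = [s + M + 2 * p, M + p, s + M + 4 * p - 1]"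
    define mA where "mA = hyp_moment p (1 - p) c q"
    define mB where "mB = hyp_moment p (1 - p) c (q + c - 1)"
    have mApos: "mA > 0" and mBpos: "mB > 0"
      unfolding mA_def mB_def hyp_moment_def rGamma_inverse_Gamma
      using c q p by (auto intro!: mult_pos_pos)
    \<comment> \<open>The parameters p, 1 - p and 2 - c come from the local solution, the other four
      from the moments. In \<open>termB\<close> the second local solution shifts the exponent to q +
      c - 1.\<close>
    have termA: "x l * hyp_moment p (1 - p) c (q + real l) = mA * hyper_term num den l" for l
    proof -
      have e: "q + 1 = s - M + p + 1" "c + q = s + 2 * p" "c + q + 1 - p = s + p + 1"
              "c + q + 1 - (1 - p) = s + 3 * p" "2 - c = 2 - M - p"
        by (auto simp: q_def c_def)
      have "hyp_moment p (1 - p) c (q + real l) = mA *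
        (pochhammer (q + 1) l * pochhammer (c + q) l / (pochhammer (c + q + 1 - p) l * pochhammer (c + q + 1 - (1 - p)) l))"
        unfolding mA_def using q c p by (intro hyp_moment_add_nat) auto
      thus ?thesis
        unfolding x_def hyp_coeff_def hyper_term_def num_def den_def e by (simp add: mult_ac add_ac)
    qed
    have termB: "y l * hyp_moment p (1 - p) c (q + c - 1 + real l) = mB * hyper_term numB denB l" for l
    proof -
      have e: "q + c - 1 + 1 = s + 2 * p" "c + (q + c - 1) = s + M + 3 * p - 1"
              "c + (q + c - 1) + 1 - p = s + M + 2 * p"
              "c + (q + c - 1) + 1 - (1 - p) = s + M + 4 * p - 1"
        by (auto simp: q_def c_def)
      have hm: "hyp_moment p (1 - p) c (q + c - 1 + real l) = mB *
        (pochhammer (q + c - 1 + 1) l * pochhammer (c + (q + c - 1)) l /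
        (pochhammer (c + (q + c - 1) + 1 - p) l * pochhammer (c + (q + c - 1) + 1 - (1 - p)) l))"
        unfolding mB_def using q c p by (intro hyp_moment_add_nat) auto
      have "pochhammer c l = pochhammer (M + p) l" by (simp add: c_def)
      thus ?thesis
        unfolding hm [unfolded e(3,4), unfolded e(1,2)] y_def hyp_coeff_def hyper_term_def numB_def denB_def
        by (simp add: mult_ac)
    qed
    note sq = integral_hyp_fun_square [of p "1 - p" c q x K, OF _ c q x0 rec lim, folded yd, simplified]
    have sA: "summable (hyper_term num den)"
      using sq(1) mApos unfolding termA by (simp add: summable_cmult_iff)
    have sB: "summable (hyper_term numB denB)"
      using sq(2) mBpos unfolding termB by (simp add: summable_cmult_iff)
    define SA where "SA = (\<Sum>l. hyper_term num den l)"
    define SB where "SB = (\<Sum>l. hyper_term numB denB l)"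
    define f1 where "f1 = Gamma c * Gamma (c - 1) * rGamma (c - p) * rGamma (c - (1 - p))"
    have N: "f.sq_moment (s + 2 * p - 1) = f1 * (mA * SA) - K * (mB * SB)"
    proof -
      have "f.sq_moment (s + 2 * p - 1) = integral {0..1} (\<lambda>t. t powr (c - 1) * (1 - t) powr q * (hyp_fun p (1 - p) c t)\<^sup>2)"
        unfolding f.sq_moment_def f.\<kappa>_def q_def c_def by (simp add: algebra_simps)
      also have "\<dots> = f1 * (mA * SA) - K * (mB * SB)"
        using sq(3) unfolding termA termB
        using sA sB by (simp add: suminf_mult f1_def SA_def SB_def)
      finally show ?thesis .
    qed
    have I: "I_integral n m (of_real s) = complex_of_real (
       Gamma (p + s + 1) / (Gamma p * Gamma (s + 1)) * (pochhammer (real n - 1) m / pochhammer p m)\<^sup>2 *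
       (gauge_factor M p (s + 2 * p - 1) * (f1 * (mA * SA) - K * (mB * SB))))"
      using I_integral_of_real [OF n m s0] tr [of "s + 2 * p - 1"] s p M N by (simp add: p_def M_def)
    show "I_integral n m (of_real s) =
        (if even n then A_term n m (of_real s) else B_term n m (of_real s) + A_term n m (of_real s))"
    proof -
      define P where "P = pochhammer (real n - 1) m"
      define pre where "pre = Gamma (p + s + 1) / (Gamma p * Gamma (s + 1)) * (P / pochhammer p m)\<^sup>2 * gauge_factor M p (s + 2 * p - 1)"
      have rG: "rGamma z = 1 / Gamma z" for z :: real by (simp add: rGamma_inverse_Gamma field_simps)
      have sp: "s + p - M > 0" "s + p + 1 - M > 0" using q by (auto simp: q_def)
      have pos: "Gamma (s + 1) > 0" "Gamma p > 0" "Gamma (s + p + 1) > 0" "Gamma c > 0" "Gamma (s - M + p + 1) > 0"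
          "Gamma (s + 2 * p) > 0" "Gamma (s + 3 * p) > 0" "Gamma (s + 4 * p - 1) > 0" "Gamma M > 0"
          "Gamma (M + 2 * p - 1) > 0" "Gamma (s + M + 3 * p - 1) > 0" "Gamma (M + p - 1) > 0"
          "Gamma (s + M + 2 * p) > 0" "Gamma (s + M + 4 * p - 1) > 0"
        using s0 p M sp c by (auto intro!: Gamma_real_pos)
      have pp: "pochhammer p m = Gamma c / Gamma p"
      proof -
        have "p \<notin> \<int>\<^sub>\<le>\<^sub>0" using p by auto
        thus ?thesis by (simp add: pochhammer_Gamma c_def M_def add.commute)
      qed
      have g: "gauge_factor M p (s + 2 * p - 1) = Gamma (s + 1) * Gamma (s + 4 * p - 1) / (Gamma (s - M + p + 1) * Gamma (s + M + 3 * p - 1))"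
      proof -
        have e: "s + 2 * p - 1 + 2 - 2 * p = s + 1" "s + 2 * p - 1 + 2 * p = s + 4 * p - 1"
                "s + 2 * p - 1 + 2 - M - p = s - M + p + 1" "s + 2 * p - 1 + M + p = s + M + 3 * p - 1"
          by simp_all
        show ?thesis unfolding gauge_factor_def [OF M p] e ..
      qed
      have mA': "mA = Gamma c * Gamma (s - M + p + 1) * Gamma (s + 2 * p) / (Gamma (s + p + 1) * Gamma (s + 3 * p))"
      proof -
        have e: "q + 1 = s - M + p + 1" "c + q + 1 - p - (1 - p) = s + 2 * p"
                "c + q + 1 - p = s + p + 1" "c + q + 1 - (1 - p) = s + 3 * p"
          by (simp_all add: q_def c_def)
        show ?thesis unfolding mA_def hyp_moment_def rG e(1,2) unfolding e(3,4) by simp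
      qed
      have mB': "mB = Gamma c * Gamma (s + 2 * p) * Gamma (s + M + 3 * p - 1) / (Gamma (s + M + 2 * p) * Gamma (s + M + 4 * p - 1))"
      proof -
        have e: "q + c - 1 + 1 = s + 2 * p" "c + (q + c - 1) + 1 - p - (1 - p) = s + M + 3 * p - 1"
                "c + (q + c - 1) + 1 - p = s + M + 2 * p" "c + (q + c - 1) + 1 - (1 - p) = s + M + 4 * p - 1"
          by (simp_all add: q_def c_def)
        show ?thesis unfolding mB_def hyp_moment_def rG e(1,2) unfolding e(3,4) by simp
      qed
      have f1': "f1 = Gamma c * Gamma (M + p - 1) / (Gamma M * Gamma (M + 2 * p - 1))"
      proof -
        have e: "c - 1 = M + p - 1" "c - p = M" "c - (1 - p) = M + 2 * p - 1" by (simp_all add: c_def)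
        show ?thesis unfolding f1_def rG e by simp
      qed
      have ps: "p + s + 1 = s + p + 1" by simp
      have A: "pre * (f1 * mA) = P\<^sup>2 *
          (Gamma p * Gamma (s + 4 * p - 1) * Gamma (M + p - 1) * Gamma (s + 2 * p)) /
          (Gamma M * Gamma (M + 2 * p - 1) * Gamma (s + 3 * p) * Gamma (s + M + 3 * p - 1))"
        unfolding pre_def pp g mA' f1' ps using pos by (simp add: power2_eq_square divide_simps)
      have A_eq: "A_term n m (of_real s) = complex_of_real (pre * (f1 * (mA * SA)))"
      proof -
        have "A_term n m (of_real s) = complex_of_real (pre * (f1 * mA) * SA)"
          unfolding A using A_term_of_real [of n s m] sA
          by (simp add: p_def M_def num_def den_def P_def SA_def)
        thus ?thesis by (simp add: mult_ac)
      qed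
      have I': "I_integral n m (of_real s) = complex_of_real (pre * (f1 * (mA * SA)) - pre * (K * (mB * SB)))"
        unfolding I pre_def P_def by (simp add: algebra_simps)
      show ?thesis
      proof (cases "even n")
        case True
        thus ?thesis unfolding I' A_eq by (simp add: K_def)
      next
        case False
        note ni = odd_nonint [OF False]
        have nz: "Gamma (1 - p) \<noteq> 0" using ni by (simp add: Gamma_eq_zero_iff)
        \<comment> \<open>Passing from Gamma(2-c) Gamma(c-1) to Gamma(1-c) Gamma(c) produces a
          factor -1, which turns the minus sign of the connection formula into the plus sign in
          front of the second series.\<close>
        have g2: "Gamma (2 - c) = (1 - c) * Gamma (1 - c)"
          using Gamma_plus1 [of "1 - c"] ni by simp
        have gc: "Gamma c = (c - 1) * Gamma (c - 1)"
        proof -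
          have "c - 1 \<notin> \<int>\<^sub>\<le>\<^sub>0" using c by auto
          thus ?thesis using Gamma_plus1 [of "c - 1"] by simp
        qed
        have "K = (1 - c) * Gamma (1 - c) * Gamma (c - 1) / (Gamma p * Gamma (1 - p))"
          using False by (simp add: K_def g2 rG)
        also have "\<dots> = - (Gamma (1 - c) * Gamma c / (Gamma p * Gamma (1 - p)))"
          unfolding gc minus_divide_left by (simp add: algebra_simps)
        finally have K': "K = - (Gamma (1 - c) * Gamma c / (Gamma p * Gamma (1 - p)))" .
        have ps2: "pochhammer (s + 2 * p) m = Gamma (s + M + 2 * p) / Gamma (s + 2 * p)"
        proof -
          have "s + 2 * p \<notin> \<int>\<^sub>\<le>\<^sub>0" using s0 p by auto
          thus ?thesis by (simp add: pochhammer_Gamma M_def add_ac)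
        qed
        have B: "- (pre * (K * mB)) = P\<^sup>2 / pochhammer (s + 2 * p) m *
            (Gamma (s + p + 1) * Gamma (s + 4 * p - 1) * Gamma (1 - c)) /
            (Gamma (s - M + p + 1) * Gamma (1 - p) * Gamma (s + M + 4 * p - 1))"
          unfolding pre_def pp g mB' K' ps ps2 using pos nz by (simp add: power2_eq_square divide_simps)
        have c1: "1 - c = 1 - real m - real n / 2" by (simp add: c_def M_def p_def)
        have B_eq: "B_term n m (of_real s) = complex_of_real (- (pre * (K * mB)) * SB)"
          unfolding B c1 using B_term_of_real [of s n m] sB
          by (simp add: p_def M_def numB_def denB_def P_def SB_def)
        show ?thesis using False unfolding I' A_eq B_eq by (simp add: algebra_simps)
      qed
    qed
  qed
qed

subsection \<open>Entire regularizations of the series\<close>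

text \<open>The quotient of consecutive values is (s+a+k) / (s+b+k). Uniformly on \<open>K\<close>
  it is at most (1 + Q/k^2) (k+d)/k in modulus. The first factors have a convergent product, the
  second ones form a real Pochhammer quotient of known growth; the start at \<open>L\<close> is
  controlled by compactness.\<close>

lemma pochhammer_rGamma_bound:
  fixes K :: "complex set" and a b :: real
  assumes K: "compact K"
  obtains C L where "C \<ge> 0"
    "\<And>s l. s \<in> K \<Longrightarrow> l \<ge> L \<Longrightarrow>
       norm (pochhammer (s + of_real a) l * rGamma (s + of_real b + of_nat l)) \<le> C * (real l + 1) powr (a - b)"
proof -
  from compact_imp_bounded [OF K] obtain R where R: "R > 0" "\<And>s. s \<in> K \<Longrightarrow> norm s \<le> R"
    by (auto simp: bounded_pos)
  define d where "d = a - b"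
  \<comment> \<open>From here on |s + b| \<le> k/2 and k + d \<ge> k/2 for all s in
    \<open>K\<close>. The two halves account for the 4 in \<open>Q\<close>.\<close>
  define L where "L = nat \<lceil>2 * (R + \<bar>a\<bar> + \<bar>b\<bar>) + 2\<rceil>"
  have L: "real L \<ge> 2 * (R + \<bar>a\<bar> + \<bar>b\<bar>) + 2" unfolding L_def by (rule real_nat_ceiling_ge)
  define X where "X = (\<lambda>(s :: complex) l. norm (pochhammer (s + of_real a) l * rGamma (s + of_real b + of_nat l)))"
  define Q where "Q = 4 * (R + \<bar>b\<bar>) * \<bar>d\<bar>"
  have Q: "Q \<ge> 0" using R(1) by (simp add: Q_def)
  have step: "X s (Suc k) \<le> X s k * ((1 + Q / (real k)\<^sup>2) * ((real k + d) / real k))" if s: "s \<in> K" and k: "k \<ge> L" for s k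
  proof -
    have k': "real k \<ge> 2 * (R + \<bar>a\<bar> + \<bar>b\<bar>) + 2" using k L by linarith
    have kd: "real k + d \<ge> real k / 2" "real k > 0" using k' R(1) by (auto simp: d_def)
    define z where "z = s + of_real b + of_nat k"
    have "norm (s + of_real b) \<le> R + \<bar>b\<bar>"
      using R(2) [OF s] norm_triangle_ineq [of s "of_real b"] by simp
    moreover have "norm z \<ge> real k - norm (s + of_real b)"
      using norm_triangle_ineq4 [of z "s + of_real b"] by (simp add: z_def)
    ultimately have z: "norm z \<ge> real k / 2" "norm (s + of_real b) \<le> R + \<bar>b\<bar>" using k' by auto
    have z0: "z \<noteq> 0" using z kd by auto
    have nz: "of_real (real k + d) \<noteq> (0 :: complex)" "of_nat k \<noteq> (0 :: complex)"
    proof -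
      have "real k + d \<noteq> 0" using kd by linarith
      thus "of_real (real k + d) \<noteq> (0 :: complex)" by (simp only: of_real_eq_0_iff) simp
      show "of_nat k \<noteq> (0 :: complex)" using kd(2) by simp
    qed
    \<comment> \<open>Comparison with (k+d)/k instead of 1 leaves an error of second order: in
      (s+a+k) k - (s+b+k)(k+d) all powers of k cancel, and -(s+b) d remains.\<close>
    have id: "(s + of_real a + of_nat k) / z =
        (1 - (s + of_real b) * of_real d / (z * of_real (real k + d))) * of_real ((real k + d) / real k)"
    proof -
      have "(s + of_real a + of_nat k) * of_nat k = z * of_real (real k + d) - (s + of_real b) * of_real d"
        by (simp add: z_def d_def algebra_simps)
      hence "(s + of_real a + of_nat k) / z = (z * of_real (real k + d) - (s + of_real b) * of_real d) / (z * of_nat k)"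
        using z0 nz by (simp add: divide_simps)
      also have "\<dots> = (1 - (s + of_real b) * of_real d / (z * of_real (real k + d))) * (of_real (real k + d) / of_nat k)"
        using z0 nz by (simp add: field_simps del: of_real_add)
      finally show ?thesis by simp
    qed
    have "norm ((s + of_real b) * of_real d / (z * of_real (real k + d))) \<le> Q / (real k)\<^sup>2"
    proof -
      have "norm ((s + of_real b) * of_real d / (z * of_real (real k + d))) =
          (norm (s + of_real b) * \<bar>d\<bar>) / (norm z * \<bar>real k + d\<bar>)"
        by (simp add: norm_mult norm_divide del: of_real_add)
      also have "\<dots> \<le> ((R + \<bar>b\<bar>) * \<bar>d\<bar>) / (real k / 2 * (real k / 2))"
        by (intro frac_le mult_mono z) (use kd R(1) z in auto)
      also have "\<dots> = Q / (real k)\<^sup>2" using kd by (simp add: Q_def power2_eq_square field_simps)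
      finally show ?thesis .
    qed
    hence q: "norm (1 - (s + of_real b) * of_real d / (z * of_real (real k + d))) \<le> 1 + Q / (real k)\<^sup>2"
      using norm_triangle_ineq4 [of 1 "(s + of_real b) * of_real d / (z * of_real (real k + d))"] by simp
    have r: "norm ((s + of_real a + of_nat k) / z) \<le> (1 + Q / (real k)\<^sup>2) * ((real k + d) / real k)"
      unfolding id norm_mult norm_of_real using q kd Q by (intro mult_mono) (auto intro!: add_nonneg_nonneg)
    have "rGamma (s + of_real b + of_nat (Suc k)) = rGamma z / z"
      using rGamma_plus1 [of z] z0 by (simp add: z_def field_simps add_ac)
    hence "X s (Suc k) = X s k * norm ((s + of_real a + of_nat k) / z)"
      by (simp add: X_def pochhammer_Suc z_def norm_mult norm_divide)
    also have "\<dots> \<le> X s k * ((1 + Q / (real k)\<^sup>2) * ((real k + d) / real k))"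
      by (intro mult_left_mono r) (simp add: X_def)
    finally show ?thesis .
  qed
  have L1: "real L \<ge> 1" "real L + d > 0" using L R(1) by (auto simp: d_def)
  define A where "A = (\<lambda>j. (\<Prod>i<j. 1 + Q / (real (L + i))\<^sup>2) * (pochhammer (real L + d) j / pochhammer (real L) j))"
  have ind: "X s (L + j) \<le> X s L * A j"
    if s: "s \<in> K" for s j
  proof (induction j)
    case (Suc j)
    have "X s (L + Suc j) \<le> X s (L + j) * ((1 + Q / (real (L + j))\<^sup>2) * ((real (L + j) + d) / real (L + j)))"
      using step [OF s, of "L + j"] by simp
    also have "\<dots> \<le> (X s L * A j) * ((1 + Q / (real (L + j))\<^sup>2) * ((real (L + j) + d) / real (L + j)))"
    proof (intro mult_right_mono)
      show "X s (L + j) \<le> X s L * A j" by (rule Suc.IH)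
      have "real (L + j) + d \<ge> 0" using L1 by simp
      moreover have "1 + Q / (real (L + j))\<^sup>2 \<ge> 0" using Q by (intro add_nonneg_nonneg) auto
      ultimately show "0 \<le> (1 + Q / (real (L + j))\<^sup>2) * ((real (L + j) + d) / real (L + j))"
        by (intro mult_nonneg_nonneg divide_nonneg_nonneg) auto
    qed
    also have "\<dots> = X s L * A (Suc j)"
      by (simp add: A_def pochhammer_Suc add_ac mult_ac)
    finally show ?case .
  qed (simp add: A_def)
  define E where "E = exp (Q * (\<Sum>i. inverse ((real i + 1)\<^sup>2)))"
  have sum_sq: "summable (\<lambda>i. inverse ((real i + 1)\<^sup>2))"
    using inverse_power_summable [of 2, where 'a = real]
          summable_Suc_iff [of "\<lambda>n. inverse ((real n)\<^sup>2)"] by (simp add: add_ac)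
  have prodE: "(\<Prod>i<j. 1 + Q / (real (L + i))\<^sup>2) \<le> E" for j
  proof -
    have "(\<Prod>i<j. 1 + Q / (real (L + i))\<^sup>2) \<le> exp (\<Sum>i<j. Q / (real (L + i))\<^sup>2)"
      by (rule prod_le_exp_sum) (use Q in simp)
    also have "(\<Sum>i<j. Q / (real (L + i))\<^sup>2) \<le> (\<Sum>i<j. Q * inverse ((real i + 1)\<^sup>2))"
    proof (rule sum_mono)
      fix i
      have "(real i + 1)\<^sup>2 \<le> (real (L + i))\<^sup>2" using L1 by (intro power_mono) auto
      hence "inverse ((real (L + i))\<^sup>2) \<le> inverse ((real i + 1)\<^sup>2)" by (intro le_imp_inverse_le) auto
      from mult_left_mono [OF this Q]
      show "Q / (real (L + i))\<^sup>2 \<le> Q * inverse ((real i + 1)\<^sup>2)" by (simp add: divide_inverse)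
    qed
    also have "\<dots> = Q * (\<Sum>i<j. inverse ((real i + 1)\<^sup>2))" by (simp add: sum_distrib_left)
    also have "\<dots> \<le> Q * (\<Sum>i. inverse ((real i + 1)\<^sup>2))"
      by (intro mult_left_mono Q sum_le_suminf sum_sq) auto
    finally show ?thesis by (simp add: E_def)
  qed
  have "real L \<notin> \<int>\<^sub>\<le>\<^sub>0" using L1(1) by auto
  then obtain C1 where C1: "C1 > 0" "\<And>j. \<bar>pochhammer (real L + d) j / pochhammer (real L) j\<bar> \<le> C1 * (real j + 1) powr (real L + d - real L)"
    using pochhammer_quotient_bound by blast
  have "continuous_on K (\<lambda>s. pochhammer (s + of_real a) L * rGamma (s + of_real b + of_nat L))"
    by (intro continuous_intros continuous_on_compose2 [OF continuous_on_rGamma [of UNIV]])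
       (auto simp: pochhammer_prod intro!: continuous_intros)
  from compact_imp_bounded [OF compact_continuous_image [OF this K]]
  obtain B where B: "B > 0" "\<And>s. s \<in> K \<Longrightarrow> X s L \<le> B"
    by (auto simp: bounded_pos X_def)
  show ?thesis
  proof (rule that [of "B * (E * (C1 * (real L + 1) powr \<bar>d\<bar>))" L])
    show "B * (E * (C1 * (real L + 1) powr \<bar>d\<bar>)) \<ge> 0" using B C1 by (simp add: E_def)
    fix s l assume s: "s \<in> K" and l: "l \<ge> L"
    define j where "j = l - L"
    have lj: "l = L + j" using l by (simp add: j_def)
    \<comment> \<open>The bound was obtained in the shifted index j = l - L; replacing j by l costs
      a constant depending only on \<open>L\<close> and \<open>d\<close>.\<close>
    have pw: "(real j + 1) powr d \<le> (real L + 1) powr \<bar>d\<bar> * (real l + 1) powr d"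
    proof (cases "d \<ge> 0")
      case True
      hence "1 * (real j + 1) powr d \<le> (real L + 1) powr \<bar>d\<bar> * (real l + 1) powr d"
        by (intro mult_mono powr_mono2 ge_one_powr_ge_zero) (auto simp: lj)
      thus ?thesis by simp
    next
      case False
      have "(real l + 1) \<le> (real L + 1) * (real j + 1)" by (simp add: lj algebra_simps)
      hence "((real L + 1) * (real j + 1)) powr d \<le> (real l + 1) powr d" using False by (intro powr_mono2') auto
      hence "(real L + 1) powr (-d) * ((real L + 1) powr d * (real j + 1) powr d) \<le> (real L + 1) powr (-d) * (real l + 1) powr d"
        by (intro mult_left_mono) (auto simp: powr_mult)
      thus ?thesis using False by (simp add: powr_minus field_simps)
    qed
    have "X s l \<le> X s L * A j"
      unfolding lj by (rule ind [OF s])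
    also have "\<dots> \<le> B * (E * (C1 * (real j + 1) powr d))"
      unfolding A_def
    proof (intro mult_mono B(2) [OF s] prodE)
      show "pochhammer (real L + d) j / pochhammer (real L) j \<le> C1 * (real j + 1) powr d"
        using abs_le_D1 [OF C1(2) [of j]] by simp
      show "0 \<le> pochhammer (real L + d) j / pochhammer (real L) j"
        by (intro divide_nonneg_nonneg less_imp_le [OF pochhammer_pos]) (use L1 in auto)
      show "0 \<le> (\<Prod>i<j. 1 + Q / (real (L + i))\<^sup>2) * (pochhammer (real L + d) j / pochhammer (real L) j)"
        by (intro mult_nonneg_nonneg prod_nonneg divide_nonneg_nonneg less_imp_le [OF pochhammer_pos])
           (use L1 Q in \<open>auto intro!: add_nonneg_nonneg\<close>)
    qed (use B(1) in \<open>auto simp: E_def\<close>)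
    also have "\<dots> \<le> B * (E * (C1 * ((real L + 1) powr \<bar>d\<bar> * (real l + 1) powr d)))"
      using B(1) C1(1) by (intro mult_left_mono pw) (auto simp: E_def)
    finally show "norm (pochhammer (s + of_real a) l * rGamma (s + of_real b + of_nat l))
        \<le> B * (E * (C1 * (real L + 1) powr \<bar>d\<bar>)) * (real l + 1) powr (a - b)"
      by (simp add: X_def d_def mult_ac)
  qed
qed

text \<open>Multiplying by \<open>1 / (\<Gamma>(s + b1) \<Gamma>(s + b2))\<close> turns the series into an entire function of \<open>s\<close>.\<close>

definition regularized_series :: "(nat \<Rightarrow> real) \<Rightarrow> real \<Rightarrow> real \<Rightarrow> real \<Rightarrow> real \<Rightarrow> nat \<Rightarrow> complex \<Rightarrow> complex" where
  "regularized_series x a1 b1 a2 b2 l s = of_real (x l) *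
     ((pochhammer (s + of_real a1) l * rGamma (s + of_real b1 + of_nat l)) *
      (pochhammer (s + of_real a2) l * rGamma (s + of_real b2 + of_nat l)))"

text \<open>The power of l that dominates the terms does not depend on s, so the Weierstrass test
  applies on every compact set, including the points where the original series has a vanishing
  denominator.\<close>

lemma regularized_series_holomorphic:
  assumes x: "\<And>l. \<bar>x l\<bar> \<le> C * (real l + 1) powr d" and d: "d + (a1 - b1) + (a2 - b2) < -1"
  shows "(\<lambda>s. \<Sum>l. regularized_series x a1 b1 a2 b2 l s) holomorphic_on UNIV"
    and "summable (\<lambda>l. regularized_series x a1 b1 a2 b2 l s)"
proof -
  define X where "X = (\<lambda>a b s l. pochhammer (s + of_real a) l * rGamma (s + of_real b + of_nat l :: complex))"
  define T where "T = regularized_series x a1 b1 a2 b2"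
  have bound: "\<exists>M. summable M \<and> (\<forall>\<^sub>F l in sequentially. \<forall>s\<in>K. norm (T l s) \<le> M l)" if K: "compact K" for K
  proof -
    obtain C1 L1 where 1: "C1 \<ge> 0" "\<And>s l. s \<in> K \<Longrightarrow> l \<ge> L1 \<Longrightarrow>
       norm (X a1 b1 s l) \<le> C1 * (real l + 1) powr (a1 - b1)"
      using pochhammer_rGamma_bound [OF K] unfolding X_def by metis
    obtain C2 L2 where 2: "C2 \<ge> 0" "\<And>s l. s \<in> K \<Longrightarrow> l \<ge> L2 \<Longrightarrow>
       norm (X a2 b2 s l) \<le> C2 * (real l + 1) powr (a2 - b2)"
      using pochhammer_rGamma_bound [OF K] unfolding X_def by metis
    have C: "C \<ge> 0" using x [of 0] by simp
    have "norm (T l s) \<le> C * (C1 * C2) * (real l + 1) powr (d + (a1 - b1) + (a2 - b2))"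
      if "l \<ge> max L1 L2" "s \<in> K" for l s
    proof -
      have Te: "T l s = of_real (x l) * (X a1 b1 s l * X a2 b2 s l)"
        by (simp add: T_def X_def regularized_series_def)
      have "norm (T l s) \<le> (C * (real l + 1) powr d) *
        ((C1 * (real l + 1) powr (a1 - b1)) * (C2 * (real l + 1) powr (a2 - b2)))"
        unfolding Te norm_mult norm_of_real
        by (intro mult_mono x 1(2) 2(2)) (use that C 1(1) 2(1) in auto)
      also have "\<dots> = C * (C1 * C2) * ((real l + 1) powr d * (real l + 1) powr (a1 - b1) * (real l + 1) powr (a2 - b2))"
        by (simp add: mult_ac)
      also have "(real l + 1) powr d * (real l + 1) powr (a1 - b1) * (real l + 1) powr (a2 - b2) =
          (real l + 1) powr (d + (a1 - b1) + (a2 - b2))"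
        by (simp add: powr_add)
      finally show ?thesis .
    qed
    moreover have "summable (\<lambda>l. C * (C1 * C2) * (real l + 1) powr (d + (a1 - b1) + (a2 - b2)))"
      by (intro summable_mult) (use d in \<open>simp add: summable_real_powr_shift\<close>)
    ultimately show ?thesis
      by (intro exI [of _ "\<lambda>l. C * (C1 * C2) * (real l + 1) powr (d + (a1 - b1) + (a2 - b2))"])
         (auto intro!: eventually_mono [OF eventually_ge_at_top [of "max L1 L2"]])
  qed
  show "summable (\<lambda>l. regularized_series x a1 b1 a2 b2 l s)"
    using bound [of "{s}"] summable_comparison_test_ev unfolding T_def [symmetric] by auto
  show "(\<lambda>s. \<Sum>l. regularized_series x a1 b1 a2 b2 l s) holomorphic_on UNIV"
    unfolding T_def [symmetric]
  proof (rule holomorphic_uniform_sequence)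
    show "(\<lambda>s. \<Sum>l<n. T l s) holomorphic_on UNIV" for n
      unfolding T_def regularized_series_def pochhammer_prod by (intro holomorphic_intros)
    fix s :: complex
    obtain M where "summable M" "\<forall>\<^sub>F l in sequentially. \<forall>s\<in>cball s 1. norm (T l s) \<le> M l"
      using bound [of "cball s 1"] by auto
    hence "uniform_limit (cball s 1) (\<lambda>n s. \<Sum>l<n. T l s) (\<lambda>s. \<Sum>l. T l s) sequentially"
      by (intro Weierstrass_m_test_ev)
    thus "\<exists>d>0. cball s d \<subseteq> UNIV \<and> uniform_limit (cball s d) (\<lambda>n s. \<Sum>l<n. T l s) (\<lambda>s. \<Sum>l. T l s) sequentially"
      by (intro exI [of _ 1]) auto
  qed auto
qed

subsection \<open>Analyticity of the integral\<close>

lemma integral_powr_tail: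
  fixes r x :: real
  assumes "r \<le> 1" "x > -1"
  shows "((\<lambda>t. (1 - t) powr x) has_integral ((1 - r) powr (x + 1) / (x + 1))) {r..1}"
proof -
  define U where "U = (\<lambda>t. - ((1 - t) powr (x + 1) / (x + 1)))"
  have "((\<lambda>t. (1 - t) powr x) has_integral (U 1 - U r)) {r..1}"
  proof (rule fundamental_theorem_of_calculus_interior)
    show "continuous_on {r..1} U"
      unfolding U_def using assms by (intro continuous_intros continuous_on_powr') auto
    fix t assume "t \<in> {r<..<1}"
    hence "(U has_real_derivative (1 - t) powr x) (at t)"
      unfolding U_def using assms by (auto intro!: derivative_eq_intros)
    thus "(U has_vector_derivative (1 - t) powr x) (at t)"
      by (simp add: has_real_derivative_iff_has_vector_derivative)
  qed fact
  thus ?thesis by (simp add: U_def)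
qed

text \<open>For Re s < 0 the integrand can be unbounded at t = 1, so differentiation under the
  integral is applied on [0, r N] only. The integrals over the rest tend to 0 uniformly on small
  closed balls, and locally uniform limits are holomorphic.\<close>

lemma holomorphic_on_integral_powr:
  fixes g :: "real \<Rightarrow> real"
  assumes g: "continuous_on {0..1} g"
  shows "(\<lambda>s. LBINT t:{0<..<1}. of_real (g t) * complex_of_real (1 - t) powr s) holomorphic_on {s. Re s > -1}"
proof -
  define f where "f = (\<lambda>s t. of_real (g t) * complex_of_real (1 - t) powr s)"
  obtain K where K: "K > 0" "\<And>t. t \<in> {0..1} \<Longrightarrow> \<bar>g t\<bar> \<le> K"
    using compact_imp_bounded [OF compact_continuous_image [OF g]] by (auto simp: bounded_pos)
  have nf: "norm (f s t) \<le> K * (1 - t) powr Re s" if "t \<in> {0..1}" for s t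
  proof -
    have "norm (f s t) = \<bar>g t\<bar> * (1 - t) powr Re s"
      using that by (simp add: f_def norm_mult norm_powr_real_powr)
    also have "\<dots> \<le> K * (1 - t) powr Re s" by (intro mult_right_mono K that) auto
    finally show ?thesis .
  qed
  have si: "set_integrable lborel {0<..<1} (f s)" if s: "Re s > -1" for s
  proof (rule set_integrable_bound)
    have "set_integrable lborel {0..1} (\<lambda>t. t powr (1 - 1) * (1 - t) powr (Re s + 1 - 1))"
      by (rule integrable_Beta) (use s in auto)
    hence "set_integrable lborel {0<..<1} (\<lambda>t. t powr (1 - 1) * (1 - t) powr (Re s + 1 - 1))"
      by (rule set_integrable_subset) auto
    thus "set_integrable lborel {0<..<1} (\<lambda>t. K * (t powr (1 - 1) * (1 - t) powr (Re s + 1 - 1)))"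
      by simp
    have "continuous_on {0<..<1} (f s)"
      unfolding f_def by (intro continuous_intros continuous_on_subset [OF g]) (auto simp: complex_nonpos_Reals_iff)
    thus "set_borel_measurable lborel {0<..<1} (f s)"
      using borel_measurable_continuous_on_indicator [of "{0<..<1}" "f s"] by (simp add: set_borel_measurable_def)
    show "AE t in lborel. t \<in> {0<..<1} \<longrightarrow> norm (f s t) \<le> norm (K * (t powr (1 - 1) * (1 - t) powr (Re s + 1 - 1)))"
    proof (intro AE_I2 impI)
      fix t :: real assume t: "t \<in> {0<..<1}"
      hence "norm (f s t) \<le> K * (1 - t) powr Re s" by (intro nf) auto
      thus "norm (f s t) \<le> norm (K * (t powr (1 - 1) * (1 - t) powr (Re s + 1 - 1)))"
        using t K(1) by (simp add: abs_mult)
    qed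
  qed
  have int: "f s integrable_on {0..1}" if "Re s > -1" for s
    using set_borel_integral_eq_integral(1) [OF si [OF that]] integrable_on_open_interval_real by blast
  have eq: "(LBINT t:{0<..<1}. f s t) = integral {0..1} (f s)" if "Re s > -1" for s
    using set_borel_integral_eq_integral(2) [OF si [OF that]] by (simp add: integral_open_interval_real)
  define r where "r = (\<lambda>N. 1 - 1 / (real N + 2))"
  have r: "0 \<le> r N" "r N < 1" for N by (auto simp: r_def field_simps)
  have "(\<lambda>s. integral {0..1} (f s)) holomorphic_on {s. Re s > -1}"
  proof (rule holomorphic_uniform_sequence)
    show "open {s. Re s > -1}" by (rule open_halfspace_Re_gt)
    fix N :: nat
    let ?f' = "\<lambda>s t. of_real (g t) * (complex_of_real (1 - t) powr s * Ln (complex_of_real (1 - t)))"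
    have "(\<lambda>s. integral (cbox 0 (r N)) (f s)) holomorphic_on UNIV"
    proof (rule leibniz_rule_holomorphic)
      fix s and t :: real assume t: "t \<in> cbox 0 (r N)"
      hence t1: "1 - t > 0" using r [of N] by auto
      show "((\<lambda>s. f s t) has_field_derivative ?f' s t) (at s within UNIV)"
        unfolding f_def using t1 by (auto intro!: derivative_eq_intros simp: mult_ac)
    next
      fix s :: complex
      show "f s integrable_on cbox 0 (r N)"
        unfolding f_def
        by (intro integrable_continuous continuous_intros continuous_on_subset [OF g])
           (use r [of N] in \<open>auto simp: complex_nonpos_Reals_iff\<close>)
    next
      have g': "continuous_on (UNIV \<times> cbox 0 (r N)) (\<lambda>x. g (snd x))"
        by (rule continuous_on_compose2 [OF g]) (use r [of N] in \<open>auto intro!: continuous_intros\<close>)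
      show "continuous_on (UNIV \<times> cbox 0 (r N)) (\<lambda>(s, t). ?f' s t)"
        unfolding case_prod_unfold
        by (intro continuous_intros g') (use r [of N] in \<open>auto simp: complex_nonpos_Reals_iff\<close>)
    qed auto
    thus "(\<lambda>s. integral {0..r N} (f s)) holomorphic_on {s. Re s > -1}"
      by (auto intro: holomorphic_on_subset)
  next
    fix s :: complex assume s: "s \<in> {s. Re s > -1}"
    \<comment> \<open>Half the distance to the line Re s = -1; the single exponent \<open>x\<close>
      > -1 then dominates the tails on the whole ball.\<close>
    define d where "d = (Re s + 1) / 2"
    define x where "x = Re s - d"
    have d: "d > 0" "x > -1" using s by (auto simp: d_def x_def field_simps)
    have Re_ge: "Re z \<ge> x" if "z \<in> cball s d" for z
      using that abs_Re_le_cmod [of "s - z"] by (auto simp: x_def dist_norm)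
    have sub: "cball s d \<subseteq> {s. Re s > -1}" using Re_ge d by fastforce
    have bound: "norm (integral {0..r N} (f z) - integral {0..1} (f z)) \<le> K * ((1 - r N) powr (x + 1) / (x + 1))"
      if z: "z \<in> cball s d" for z N
    proof -
      have z1: "Re z > -1" using z sub by auto
      have i2: "f z integrable_on {r N..1}"
        by (rule integrable_subinterval_real [OF int [OF z1]]) (use r [of N] in auto)
      have comb: "integral {0..r N} (f z) + integral {r N..1} (f z) = integral {0..1} (f z)"
        by (rule Henstock_Kurzweil_Integration.integral_combine) (use r [of N] int [OF z1] in auto)
      have "norm (integral {r N..1} (f z)) \<le> integral {r N..1} (\<lambda>t. K * (1 - t) powr x)"
      proof (rule integral_norm_bound_integral)
        show "(\<lambda>t. K * (1 - t) powr x) integrable_on {r N..1}"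
          using has_integral_mult_right [OF integral_powr_tail [of "r N" x], of K] r [of N] d
          by (auto simp: integrable_on_def)
        fix t assume t: "t \<in> {r N..1}"
        hence t': "t \<in> {0..1}" using r [of N] by auto
        have "norm (f z t) \<le> K * (1 - t) powr Re z" by (rule nf [OF t'])
        also have "\<dots> \<le> K * (1 - t) powr x"
          using t' Re_ge [OF z] K(1) by (intro mult_left_mono powr_mono') auto
        finally show "norm (f z t) \<le> K * (1 - t) powr x" .
      qed fact
      also have "\<dots> = K * ((1 - r N) powr (x + 1) / (x + 1))"
        using has_integral_mult_right [OF integral_powr_tail [of "r N" x], of K] r [of N] d
        by (intro integral_unique) auto
      finally show ?thesis using comb by (simp add: norm_minus_commute flip: comb)
    qed
    have "(\<lambda>N. K * ((1 - r N) powr (x + 1) / (x + 1))) \<longlonglongrightarrow> K * (0 powr (x + 1) / (x + 1))"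
    proof -
      have "(\<lambda>N. 1 - r N) \<longlonglongrightarrow> 0" unfolding r_def by real_asymp
      thus ?thesis using d by (intro tendsto_intros tendsto_powr') (auto intro!: always_eventually less_imp_le [OF r(2)])
    qed
    hence lim: "(\<lambda>N. K * ((1 - r N) powr (x + 1) / (x + 1))) \<longlonglongrightarrow> 0" using d by simp
    have "uniform_limit (cball s d) (\<lambda>N z. integral {0..r N} (f z)) (\<lambda>z. integral {0..1} (f z)) sequentially"
    proof (rule uniform_limitI)
      fix e :: real assume "e > 0"
      from order_tendstoD(2) [OF lim this]
      show "\<forall>\<^sub>F N in sequentially. \<forall>z\<in>cball s d. dist (integral {0..r N} (f z)) (integral {0..1} (f z)) < e"
        unfolding dist_norm by eventually_elim (use bound le_less_trans in blast)
    qed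
    thus "\<exists>d>0. cball s d \<subseteq> {s. Re s > -1} \<and>
        uniform_limit (cball s d) (\<lambda>N z. integral {0..r N} (f z)) (\<lambda>z. integral {0..1} (f z)) sequentially"
      using d sub by blast
  qed
  thus ?thesis
  proof (rule holomorphic_transform)
    fix s assume "s \<in> {s. Re s > -1}"
    thus "integral {0..1} (f s) = (LBINT t:{0<..<1}. of_real (g t) * complex_of_real (1 - t) powr s)"
      using eq [of s] by (simp only: f_def mem_Collect_eq)
  qed
qed

lemma I_integral_analytic:
  assumes n: "n > 2" and m: "m \<ge> 1"
  shows "I_integral n m analytic_on {s. Re s > -1}"
proof -
  define p where "p = real n / 2"
  have p: "p \<ge> 3/2" using n by (simp add: p_def)
  interpret F: hypergeometric_ode "real m" "1 - p" "real m + p"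
    "hyp_fun (real m) (1 - p) (real m + p)" "hyp_fun1 (real m) (1 - p) (real m + p)" "hyp_fun2 (real m) (1 - p) (real m + p)"
    by (rule hypergeometric_ode_hyp_fun) (use m p in auto)
  define g where "g = (\<lambda>t. t powr (real m + real n / 2 - 1) * (S_fun n m t)\<^sup>2)"
  have g: "continuous_on {0..1} g"
    unfolding g_def S_fun_eq_hyp_fun using m p
    by (intro continuous_intros continuous_on_powr' F.cont_G [unfolded p_def]) (auto simp: p_def)
  have "(\<lambda>s. Gamma (of_nat n / 2 + s + 1) / (Gamma (of_nat n / 2) * Gamma (s + 1)) *
      (LBINT t:{0<..<1}. of_real (g t) * complex_of_real (1 - t) powr s))
      holomorphic_on {s. Re s > -1}" (is "?I holomorphic_on _")
  proof (intro holomorphic_on_mult holomorphic_on_divide holomorphic_on_integral_powr [OF g])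
    have nz: "z \<notin> \<int>\<^sub>\<le>\<^sub>0" if "Re z > 0" for z :: complex using that by (auto elim!: nonpos_Ints_cases)
    show "(\<lambda>s. Gamma (of_nat n / 2 + s + 1)) holomorphic_on {s. Re s > -1}"
      "(\<lambda>s. Gamma (s + 1)) holomorphic_on {s. Re s > -1}"
      by (auto intro!: holomorphic_intros nz)
    show "Gamma (of_nat n / 2) * Gamma (s + 1) \<noteq> (0 :: complex)" if "s \<in> {s. Re s > -1}" for s
      using that n by (auto simp: Gamma_eq_zero_iff intro!: nz)
  qed auto
  moreover have "I_integral n m = ?I"
    by (simp add: I_integral_def fun_eq_iff g_def mult_ac)
  ultimately show ?thesis
    by (subst analytic_on_open) (auto simp: open_halfspace_Re_gt)
qed

subsection \<open>Meromorphic continuation\<close>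

text \<open>The identity theorem makes f and g agree near every point, except possibly at the point
  itself. There niceness decides: both have a pole and the value 0, or both values are the common
  limit.\<close>

lemma nicely_meromorphic_eqI:
  assumes f: "f nicely_meromorphic_on A" and g: "g nicely_meromorphic_on A"
    and A: "open A" "connected A" "z \<in> A" and freq: "\<exists>\<^sub>F w in at z. f w = g w" and w: "w \<in> A"
  shows "f w = g w"
proof -
  \<comment> \<open>The difference of nicely meromorphic functions can have wrong values where poles
    cancel, so its singularities are removed first.\<close>
  define h where "h = remove_sings (\<lambda>z. f z - g z)"
  have mero: "(\<lambda>z. f z - g z) meromorphic_on A"
    using f g by (intro meromorphic_intros) (auto simp: nicely_meromorphic_on_def)
  have h: "h nicely_meromorphic_on A" unfolding h_def by (rule remove_sings_nicely_meromorphic [OF mero])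
  have ev: "\<forall>\<^sub>F v in at u. h v = f v - g v" if "u \<in> A" for u
    unfolding h_def using meromorphic_on_isolated_singularity [OF meromorphic_on_subset [OF mero, of "{u}"]] that
    by (intro eventually_remove_sings_eq_at) auto
  have "\<exists>\<^sub>F v in at z. h v = 0"
    using freq ev [OF A(3)] by (rule frequently_rev_mp [OF _ eventually_mono]) auto
  hence h0: "h v = 0" if "v \<in> A" for v
    using frequently_eq_meromorphic_imp_constant [OF _ h A] that by blast
  have "\<forall>\<^sub>F v in at w. v \<in> A" using A(1) w by (rule eventually_at_in_open')
  with ev [OF w] have eq: "\<forall>\<^sub>F v in at w. f v = g v" by eventually_elim (use h0 in auto)
  hence pole: "is_pole f w \<longleftrightarrow> is_pole g w" by (intro is_pole_cong) auto
  have lim: "f \<midarrow>w\<rightarrow> c \<longleftrightarrow> g \<midarrow>w\<rightarrow> c" for c using eq by (rule tendsto_cong)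
  have fw: "is_pole f w \<and> f w = 0 \<or> f \<midarrow>w\<rightarrow> f w" and gw: "is_pole g w \<and> g w = 0 \<or> g \<midarrow>w\<rightarrow> g w"
    using f g w by (auto simp: nicely_meromorphic_on_def)
  have np: "\<not> (is_pole g w \<and> g \<midarrow>w\<rightarrow> c)" for c
    unfolding is_pole_def using not_tendsto_and_filterlim_at_infinity [of "at w" g c] by auto
  show ?thesis
    using fw gw pole np LIM_unique unfolding lim by metis
qed

lemma meromorphic_Gamma_shift: "(\<lambda>s. Gamma (s + a)) meromorphic_on UNIV"
proof -
  have "(\<lambda>s. inverse (rGamma (s + a))) meromorphic_on UNIV"
    by (intro meromorphic_intros analytic_on_imp_meromorphic_on analytic_intros)
  thus ?thesis by (simp add: Gamma_def)
qed

lemma cosparse_not_nonpos_Ints: "\<forall>\<^sub>\<approx>s. s + a \<notin> (\<int>\<^sub>\<le>\<^sub>0 :: complex set)"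
proof -
  have "(\<lambda>s. rGamma (s + a)) nicely_meromorphic_on UNIV"
    by (intro analytic_on_imp_nicely_meromorphic_on analytic_intros)
  from nicely_meromorphic_imp_constant_or_avoid [OF this, of 0]
  have "(\<forall>s. rGamma (s + a) = 0) \<or> (\<forall>\<^sub>\<approx>s. rGamma (s + a) \<noteq> 0)"
    using connected_UNIV by simp
  moreover have "rGamma ((1 - a) + a) \<noteq> 0" by simp
  ultimately have "\<forall>\<^sub>\<approx>s. rGamma (s + a) \<noteq> 0" by blast
  thus ?thesis by (simp add: rGamma_eq_zero_iff)
qed

lemma open_shift_not_nonpos_Ints: "open {s. s + a \<notin> (\<int>\<^sub>\<le>\<^sub>0 :: complex set)}"
proof -
  have "open ((\<lambda>s. s + a) -` (- (\<int>\<^sub>\<le>\<^sub>0 :: complex set)))"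
    by (intro open_vimage continuous_intros) (simp add: open_Compl)
  thus ?thesis by (simp add: vimage_def)
qed

section \<open>The two balanced series and their Gamma prefactors\<close>

lemma Gamma_mult_rGamma_add_nat:
  assumes "z \<notin> \<int>\<^sub>\<le>\<^sub>0"
  shows "Gamma z * rGamma (z + of_nat l) = 1 / pochhammer (z :: complex) l"
proof -
  have "pochhammer z l \<noteq> 0" using assms pochhammer_eq_0_imp_nonpos_Int by blast
  moreover have "Gamma z * rGamma z = 1" using assms by (simp add: Gamma_def rGamma_eq_zero_iff)
  ultimately show ?thesis using pochhammer_rGamma [of z l] by (simp add: field_simps)
qed

lemma hyp_coeff_growth_A:
  assumes n: "n > 2" and m: "m \<ge> 1"
  defines "p \<equiv> real n / 2"
  shows "\<exists>C. \<forall>l. \<bar>hyp_coeff p (1 - p) (2 - real m - p) l\<bar> \<le> C * (real l + 1) powr (real m + p - 2)"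
proof (cases "even n")
  case False
  have "2 - real m - p \<notin> \<int>\<^sub>\<le>\<^sub>0"
  proof
    assume "2 - real m - p \<in> \<int>\<^sub>\<le>\<^sub>0"
    then obtain i :: int where "2 - real m - p = of_int i" by (auto elim!: nonpos_Ints_cases)
    hence "real n = of_int (2 * (2 - int m - i))" by (simp add: p_def)
    hence "of_int (int n) = (of_int (2 * (2 - int m - i)) :: real)" by simp
    hence "int n = 2 * (2 - int m - i)" by (simp only: of_int_eq_iff)
    thus False using False by (metis dvd_triv_left even_of_nat)
  qed
  then obtain C where C: "\<And>l. \<bar>hyp_coeff p (1 - p) (2 - real m - p) l\<bar> \<le> C * (real l + 1) powr (p + (1 - p) - (2 - real m - p) - 1)"
    using hyp_coeff_bound by blast
  have "p + (1 - p) - (2 - real m - p) - 1 = real m + p - 2" by simp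
  thus ?thesis using C by metis
next
  case True
  then obtain k where k: "n = 2 * k" by auto
  have kp: "p = real (k - 1) + 1" using n k by (auto simp: p_def of_nat_diff)
  define C where "C = (\<Sum>l\<le>k. \<bar>hyp_coeff p (1 - p) (2 - real m - p) l\<bar>)"
  have C: "C \<ge> 0" unfolding C_def by (intro sum_nonneg) auto
  show ?thesis
  proof (intro exI allI)
    fix l
    show "\<bar>hyp_coeff p (1 - p) (2 - real m - p) l\<bar> \<le> C * (real l + 1) powr (real m + p - 2)"
    proof (cases "l \<le> k")
      case True
      hence "\<bar>hyp_coeff p (1 - p) (2 - real m - p) l\<bar> \<le> C"
        unfolding C_def by (intro member_le_sum) auto
      also have "C * 1 \<le> C * (real l + 1) powr (real m + p - 2)"
        using m kp k n C by (intro mult_left_mono ge_one_powr_ge_zero) auto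
      finally show ?thesis by simp
    next
      case False
      hence "pochhammer (1 - p) l = 0" unfolding kp
        using pochhammer_of_nat_eq_0_iff [of "k - 1" l, where 'a = real] by simp
      thus ?thesis using C by (simp add: hyp_coeff_def)
    qed
  qed
qed

text \<open>The regularization of the first 4F3. The coefficients grow with exponent m + n/2 - 2 and
  the two regularized quotients with exponents -m and -n/2, so the terms are O(l^(-2)) for every s;
  the same three exponents occur for \<open>B_entire\<close>.\<close>

definition A_entire :: "nat \<Rightarrow> nat \<Rightarrow> complex \<Rightarrow> complex" where
  "A_entire n m s = (\<Sum>l. regularized_series (hyp_coeff (real n / 2) (1 - real n / 2) (2 - real m - real n / 2))
     (1 - real m + real n / 2) (real n / 2 + 1) (real n) (3 * real n / 2) l s)"

definition B_entire :: "nat \<Rightarrow> nat \<Rightarrow> complex \<Rightarrow> complex" where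
  "B_entire n m s = (\<Sum>l. regularized_series (hyp_coeff (real m) (real m + real n - 1) (real m + real n / 2))
     (real n) (real m + real n) (real m + 3 * real n / 2 - 1) (real m + 2 * real n - 1) l s)"

lemma A_entire_holomorphic:
  assumes "n > 2" "m \<ge> 1"
  shows "A_entire n m holomorphic_on UNIV"
proof -
  obtain C where "\<And>l. \<bar>hyp_coeff (real n / 2) (1 - real n / 2) (2 - real m - real n / 2) l\<bar>
      \<le> C * (real l + 1) powr (real m + real n / 2 - 2)"
    using hyp_coeff_growth_A [OF assms] by blast
  thus ?thesis unfolding A_entire_def [abs_def]
    by (rule regularized_series_holomorphic(1)) simp
qed

lemma B_entire_holomorphic:
  assumes "n > 2" "m \<ge> 1"
  shows "B_entire n m holomorphic_on UNIV"
proof -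
  have "real m + real n / 2 > 0" using assms by simp
  hence "real m + real n / 2 \<notin> \<int>\<^sub>\<le>\<^sub>0" by (rule pos_not_nonpos_Ints)
  then obtain C where "\<And>l. \<bar>hyp_coeff (real m) (real m + real n - 1) (real m + real n / 2) l\<bar>
      \<le> C * (real l + 1) powr (real m + (real m + real n - 1) - (real m + real n / 2) - 1)"
    using hyp_coeff_bound by blast
  thus ?thesis unfolding B_entire_def [abs_def]
    by (rule regularized_series_holomorphic(1)) (simp add: field_simps)
qed

lemma hypergeometric_eq_regularized:
  assumes x: "\<And>l. \<bar>x l\<bar> \<le> C * (real l + 1) powr d" "d + (a1 - b1) + (a2 - b2) < -1"
    and s: "s + of_real b1 \<notin> \<int>\<^sub>\<le>\<^sub>0" "s + of_real b2 \<notin> \<int>\<^sub>\<le>\<^sub>0"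
    and T: "\<And>l. hyper_term as bs l = of_real (x l) * (pochhammer (s + of_real a1) l * pochhammer (s + of_real a2) l /
        (pochhammer (s + of_real b1) l * pochhammer (s + of_real b2) l))"
  shows "hypergeometric as bs 1 =
    Gamma (s + of_real b1) * Gamma (s + of_real b2) * (\<Sum>l. regularized_series x a1 b1 a2 b2 l s)"
proof -
  define G where "G = Gamma (s + of_real b1) * Gamma (s + of_real b2)"
  have "hyper_term as bs l = G * regularized_series x a1 b1 a2 b2 l s" for l
  proof -
    have "G * regularized_series x a1 b1 a2 b2 l s =
        of_real (x l) * (pochhammer (s + of_real a1) l * pochhammer (s + of_real a2) l *
        ((Gamma (s + of_real b1) * rGamma (s + of_real b1 + of_nat l)) *
        (Gamma (s + of_real b2) * rGamma (s + of_real b2 + of_nat l))))"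
      unfolding G_def regularized_series_def by (simp only: mult_ac)
    thus ?thesis
      unfolding Gamma_mult_rGamma_add_nat [OF s(1)] Gamma_mult_rGamma_add_nat [OF s(2)] T by simp
  qed
  thus ?thesis
    using suminf_mult [OF regularized_series_holomorphic(2) [OF x], of G] by (simp add: hypergeometric_eq_suminf G_def)
qed

lemma hypergeometric_A:
  assumes n: "n > 2" and m: "m \<ge> 1"
    and s: "s + 3 * of_nat n / 2 \<notin> \<int>\<^sub>\<le>\<^sub>0" "s + (of_nat n / 2 + 1) \<notin> \<int>\<^sub>\<le>\<^sub>0"
  shows "hypergeometric (A_num n m s) (A_den n m s) 1 =
      Gamma (s + (of_nat n / 2 + 1)) * Gamma (s + 3 * of_nat n / 2) * A_entire n m s"
proof -
  let ?x = "hyp_coeff (real n / 2) (1 - real n / 2) (2 - real m - real n / 2)"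
  obtain C where C: "\<And>l. \<bar>?x l\<bar> \<le> C * (real l + 1) powr (real m + real n / 2 - 2)"
    using hyp_coeff_growth_A [OF n m] by blast
  have x: "complex_of_real (?x l) = pochhammer (of_nat n / 2) l * pochhammer (1 - of_nat n / 2) l /
      (pochhammer (2 - of_nat m - of_nat n / 2) l * fact l)" for l
    by (simp add: hyp_coeff_def flip: pochhammer_of_real)
  have e: "s + complex_of_real (1 - real m + real n / 2) = s - of_nat m + of_nat n / 2 + 1"
    "s + complex_of_real (real n / 2 + 1) = s + (of_nat n / 2 + 1)" "s + complex_of_real (real n) = s + of_nat n"
    "s + complex_of_real (3 * real n / 2) = s + 3 * of_nat n / 2" "s + of_nat n / 2 + 1 = s + (of_nat n / 2 + 1)"
    by simp_all
  show ?thesis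
    unfolding A_entire_def e(2,4) [symmetric]
  proof (rule hypergeometric_eq_regularized [OF C])
    show "s + complex_of_real (real n / 2 + 1) \<notin> \<int>\<^sub>\<le>\<^sub>0" "s + complex_of_real (3 * real n / 2) \<notin> \<int>\<^sub>\<le>\<^sub>0"
      unfolding e using s by auto
  qed (unfold e x hyper_term_def A_num_def A_den_def, simp_all add: field_simps)
qed

lemma hypergeometric_B:
  assumes n: "n > 2"
    and s: "s + (of_nat n + of_nat m) \<notin> \<int>\<^sub>\<le>\<^sub>0" "s + (2 * of_nat n - 1 + of_nat m) \<notin> \<int>\<^sub>\<le>\<^sub>0"
  shows "hypergeometric (B_num n m s) (B_den n m s) 1 =
      Gamma (s + (of_nat n + of_nat m)) * Gamma (s + (2 * of_nat n - 1 + of_nat m)) * B_entire n m s"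
proof -
  let ?x = "hyp_coeff (real m) (real m + real n - 1) (real m + real n / 2)"
  have c: "real m + real n / 2 \<notin> \<int>\<^sub>\<le>\<^sub>0" using n by simp
  obtain C where C: "\<And>l. \<bar>?x l\<bar> \<le> C * (real l + 1) powr (real m + (real m + real n - 1) - (real m + real n / 2) - 1)"
    using hyp_coeff_bound [OF c] by blast
  have x: "complex_of_real (?x l) = pochhammer (of_nat m) l * pochhammer (of_nat m + of_nat n - 1) l /
      (pochhammer (of_nat m + of_nat n / 2) l * fact l)" for l
    by (simp add: hyp_coeff_def flip: pochhammer_of_real)
  have e: "s + complex_of_real (real n) = of_nat n + s"
    "s + complex_of_real (real m + real n) = s + (of_nat n + of_nat m)"
    "s + complex_of_real (real m + 3 * real n / 2 - 1) = of_nat m + s + 3 * of_nat n / 2 - 1"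
    "s + complex_of_real (real m + 2 * real n - 1) = s + (2 * of_nat n - 1 + of_nat m)"
    by simp_all
  have d: "B_den n m s = [s + (of_nat n + of_nat m), of_nat m + of_nat n / 2, s + (2 * of_nat n - 1 + of_nat m)]"
    by (simp add: B_den_def)
  show ?thesis
    unfolding B_entire_def e(2,4) [symmetric]
  proof (rule hypergeometric_eq_regularized [OF C])
    show "s + complex_of_real (real m + real n) \<notin> \<int>\<^sub>\<le>\<^sub>0" "s + complex_of_real (real m + 2 * real n - 1) \<notin> \<int>\<^sub>\<le>\<^sub>0"
      unfolding e using s by auto
  qed (unfold e x hyper_term_def B_num_def d, simp_all add: field_simps)
qed

text \<open>\<open>A_term\<close> after cancelling the factor Gamma(s + 3n/2) of its series against
  the prefactor. What remains is a product of Gamma factors and entire functions, on which all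
  possible poles are visible. In \<open>B_explicit\<close> the cancelled factor is Gamma(m + 2n + s
  - 1).\<close>

definition A_explicit :: "nat \<Rightarrow> nat \<Rightarrow> complex \<Rightarrow> complex" where
  "A_explicit n m s =
    (pochhammer (of_nat n - 1) m)\<^sup>2 * Gamma (of_nat n / 2) * Gamma (of_nat m + of_nat n / 2 - 1) /
    (Gamma (of_nat m) * Gamma (of_nat m + of_nat n - 1)) *
    (Gamma (s + (2 * of_nat n - 1)) * Gamma (s + of_nat n) * rGamma (s + (of_nat m + 3 * of_nat n / 2 - 1)) *
     Gamma (s + (of_nat n / 2 + 1)) * A_entire n m s)"

definition B_explicit :: "nat \<Rightarrow> nat \<Rightarrow> complex \<Rightarrow> complex" where
  "B_explicit n m s =
    (pochhammer (of_nat n - 1) m)\<^sup>2 * Gamma (1 - of_nat m - of_nat n / 2) / Gamma (1 - of_nat n / 2) *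
    (Gamma (s + (of_nat n / 2 + 1)) * Gamma (s + (2 * of_nat n - 1)) * rGamma (s + (of_nat n / 2 + 1 - of_nat m)) *
     Gamma (s + (of_nat n + of_nat m)) * B_entire n m s / pochhammer (s + of_nat n) m)"

lemma A_term_eq_explicit:
  assumes "n > 2" "m \<ge> 1" "s + 3 * of_nat n / 2 \<notin> \<int>\<^sub>\<le>\<^sub>0" "s + (of_nat n / 2 + 1) \<notin> \<int>\<^sub>\<le>\<^sub>0"
  shows "A_term n m s = A_explicit n m s"
proof -
  have e: "s + 2 * of_nat n - 1 = s + (2 * of_nat n - 1)"
    "of_nat m + s + 3 * of_nat n / 2 - 1 = s + (of_nat m + 3 * of_nat n / 2 - 1)" by simp_all
  have h: "hypergeometric (A_num n m s) (A_den n m s) 1 =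
      Gamma (s + (of_nat n / 2 + 1)) * Gamma (s + 3 * of_nat n / 2) * A_entire n m s"
    using hypergeometric_A assms by blast
  have cancel: "P * (a * b * c * d) / (x * y * g * z) * (h * g * E) = P * a * c / (x * y) * (b * d * inverse z * h * E)"
    if "g \<noteq> 0" for P a b c d x y g z h E :: complex
    using that by (simp add: divide_simps)
  have "Gamma (s + 3 * of_nat n / 2) \<noteq> 0" using assms(3) by (simp add: Gamma_eq_zero_iff)
  thus ?thesis
    unfolding A_term_def A_explicit_def rGamma_inverse_Gamma h e by (rule cancel)
qed

lemma B_term_eq_explicit:
  assumes "n > 2" "m \<ge> 1" "s + (of_nat n + of_nat m) \<notin> \<int>\<^sub>\<le>\<^sub>0" "s + (2 * of_nat n - 1 + of_nat m) \<notin> \<int>\<^sub>\<le>\<^sub>0"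
  shows "B_term n m s = B_explicit n m s"
proof -
  have e: "of_nat m + 2 * of_nat n + s - 1 = s + (2 * of_nat n - 1 + of_nat m)" "s + 2 * of_nat n - 1 = s + (2 * of_nat n - 1)"
    "s + of_nat n / 2 + 1 = s + (of_nat n / 2 + 1)" "s - of_nat m + of_nat n / 2 + 1 = s + (of_nat n / 2 + 1 - of_nat m)"
    "of_nat n + s = s + of_nat n"
    by simp_all
  have h: "hypergeometric (B_num n m s) (B_den n m s) 1 =
      Gamma (s + (of_nat n + of_nat m)) * Gamma (s + (2 * of_nat n - 1 + of_nat m)) * B_entire n m s"
    using hypergeometric_B assms by blast
  have cancel: "P / q * (a * b * c) / (d * f * g) * (h * g * E) = P * c / f * (a * b * inverse d * h * E / q)"
    if "g \<noteq> 0" for P q a b c d f g h E :: complex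
    using that by (simp add: divide_simps)
  have "Gamma (s + (2 * of_nat n - 1 + of_nat m)) \<noteq> 0" using assms(4) by (simp add: Gamma_eq_zero_iff)
  thus ?thesis
    unfolding B_term_def B_explicit_def rGamma_inverse_Gamma h unfolding e by (rule cancel)
qed

lemma A_explicit_holomorphic:
  assumes "n > 2" "m \<ge> 1"
  shows "A_explicit n m holomorphic_on
    {s. s + (2 * of_nat n - 1) \<notin> \<int>\<^sub>\<le>\<^sub>0} \<inter> {s. s + of_nat n \<notin> \<int>\<^sub>\<le>\<^sub>0} \<inter> {s. s + (of_nat n / 2 + 1) \<notin> \<int>\<^sub>\<le>\<^sub>0}"
  unfolding A_explicit_def [abs_def]
  by (intro holomorphic_on_mult holomorphic_on_const holomorphic_Gamma' holomorphic_rGamma' holomorphic_on_add holomorphic_on_ident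
        holomorphic_on_subset [OF A_entire_holomorphic [OF assms]]) auto

lemma B_explicit_holomorphic:
  assumes "n > 2" "m \<ge> 1"
  shows "B_explicit n m holomorphic_on
    {s. s + (of_nat n / 2 + 1) \<notin> \<int>\<^sub>\<le>\<^sub>0} \<inter> {s. s + (2 * of_nat n - 1) \<notin> \<int>\<^sub>\<le>\<^sub>0} \<inter> {s. s + (of_nat n + of_nat m) \<notin> \<int>\<^sub>\<le>\<^sub>0} \<inter>
    {s. pochhammer (s + of_nat n) m \<noteq> 0}"
  unfolding B_explicit_def [abs_def]
  by (intro holomorphic_on_mult holomorphic_on_divide holomorphic_on_const holomorphic_Gamma' holomorphic_rGamma' holomorphic_on_add
        holomorphic_on_ident holomorphic_on_subset [OF B_entire_holomorphic [OF assms]])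
     (auto simp: pochhammer_prod intro!: holomorphic_intros)

lemma A_term_meromorphic:
  assumes "n > 2" "m \<ge> 1"
  shows "A_term n m meromorphic_on UNIV"
proof -
  have "\<forall>\<^sub>\<approx>s. A_term n m s = A_explicit n m s"
    using cosparse_not_nonpos_Ints [of "3 * of_nat n / 2"] cosparse_not_nonpos_Ints [of "of_nat n / 2 + 1"]
    by eventually_elim (intro A_term_eq_explicit assms)
  moreover have "A_explicit n m meromorphic_on UNIV"
    unfolding A_explicit_def [abs_def]
    by (intro meromorphic_intros meromorphic_Gamma_shift analytic_on_imp_meromorphic_on analytic_intros
          A_entire_holomorphic [OF assms, THEN analytic_on_open [OF open_UNIV, THEN iffD2]])
  ultimately show ?thesis by (subst meromorphic_on_cong') auto
qed

lemma B_term_meromorphic: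
  assumes "n > 2" "m \<ge> 1"
  shows "B_term n m meromorphic_on UNIV"
proof -
  have "\<forall>\<^sub>\<approx>s. B_term n m s = B_explicit n m s"
    using cosparse_not_nonpos_Ints [of "of_nat n + of_nat m"] cosparse_not_nonpos_Ints [of "2 * of_nat n - 1 + of_nat m"]
    by eventually_elim (intro B_term_eq_explicit assms)
  moreover have "B_explicit n m meromorphic_on UNIV"
    unfolding B_explicit_def [abs_def] pochhammer_prod
    by (intro meromorphic_intros meromorphic_Gamma_shift analytic_on_imp_meromorphic_on analytic_intros
          B_entire_holomorphic [OF assms, THEN analytic_on_open [OF open_UNIV, THEN iffD2]])
  ultimately show ?thesis by (subst meromorphic_on_cong') auto
qed

section \<open>Absence of poles at the regular points\<close>

lemma nonpos_Ints_iff_of_nat: "(z :: complex) \<in> \<int>\<^sub>\<le>\<^sub>0 \<longleftrightarrow> (\<exists>M. z = - of_nat M)"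
  by (auto elim: nonpos_Ints_cases')

lemma nonpos_Ints_diff_of_nat: "(z :: complex) \<in> \<int>\<^sub>\<le>\<^sub>0 \<Longrightarrow> z - of_nat k \<in> \<int>\<^sub>\<le>\<^sub>0"
  by (metis nonpos_Ints_diff_Nats of_nat_in_Nats)

text \<open>If s + n/2 + 1 = -M, the symbol is meaningful only with a numerator parameter -N, N
  \<le> M. Here n/2 is positive, s - m + n/2 + 1 = -M - m is too small, s + n is excluded by
  assumption, and 1 - n/2 = -N would give s + n = -(M - N). The second claim follows by subtracting
  n - 1.\<close>

lemma A_regular_imp:
  assumes n: "n > 2" and m: "m \<ge> 1" and reg: "A_regular n m s"
  shows "s + of_nat n / 2 + 1 \<notin> \<int>\<^sub>\<le>\<^sub>0" "s + 3 * of_nat n / 2 \<notin> \<int>\<^sub>\<le>\<^sub>0"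
proof -
  have sn: "s + of_nat n \<notin> \<int>\<^sub>\<le>\<^sub>0" and def: "hypergeometric_defined (A_num n m s) (A_den n m s)"
    using reg by (auto simp: A_regular_def)
  show *: "s + of_nat n / 2 + 1 \<notin> \<int>\<^sub>\<le>\<^sub>0"
  proof
    assume "s + of_nat n / 2 + 1 \<in> \<int>\<^sub>\<le>\<^sub>0"
    then obtain M where M: "s + of_nat n / 2 + 1 = - of_nat M" by (auto simp: nonpos_Ints_iff_of_nat)
    hence "- of_nat M \<in> set (A_den n m s)" by (simp add: A_den_def)
    then obtain N where N: "N \<le> M" "- of_nat N \<in> set (A_num n m s)"
      using def unfolding hypergeometric_defined_def by blast
    have s: "s = - of_nat M - of_nat n / 2 - 1" using M by (simp add: algebra_simps)
    consider "- complex_of_nat N = of_nat n / 2" | "- complex_of_nat N = - of_nat M - of_nat m"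
      | "- complex_of_nat N = s + of_nat n" | "- complex_of_nat N = 1 - of_nat n / 2"
      using N(2) by (auto simp: A_num_def s)
    thus False
    proof cases
      case 1
      from arg_cong [OF this, of Re] show False using n by simp
    next
      case 2
      from arg_cong [OF this, of Re] show False using N(1) m by simp
    next
      case 3
      thus False using sn by (metis nonpos_Ints_iff_of_nat)
    next
      case 4
      hence h: "of_nat n / 2 = complex_of_nat N + 1" by (simp add: algebra_simps)
      have "s + of_nat n = - of_nat M - 1 + of_nat n / 2" by (simp add: s field_simps)
      also have "\<dots> = - of_nat (M - N)" unfolding h using N(1) by (simp add: of_nat_diff)
      finally show False using sn by (metis nonpos_Ints_iff_of_nat)
    qed
  qed
  show "s + 3 * of_nat n / 2 \<notin> \<int>\<^sub>\<le>\<^sub>0"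
  proof
    assume "s + 3 * of_nat n / 2 \<in> \<int>\<^sub>\<le>\<^sub>0"
    from nonpos_Ints_diff_of_nat [OF this, of "n - 1"]
    have "s + 3 * of_nat n / 2 - of_nat (n - 1) \<in> \<int>\<^sub>\<le>\<^sub>0" .
    also have "s + 3 * of_nat n / 2 - of_nat (n - 1) = s + of_nat n / 2 + 1"
      using n by (simp add: of_nat_diff field_simps)
    finally show False using * by simp
  qed
qed

text \<open>If s + n + m = -M, the parameter n + s = -M - m is too small, two others are positive,
  and m + s + 3n/2 - 1 = n/2 - M - 1 is not an integer for odd \<open>n\<close>. The other claim
  follows by subtracting m.\<close>

lemma B_regular_imp:
  assumes n: "n > 2" "odd n" and m: "m \<ge> 1" and reg: "B_regular n m s"
  shows "s + (of_nat n + of_nat m) \<notin> \<int>\<^sub>\<le>\<^sub>0" "s + (2 * of_nat n - 1 + of_nat m) \<notin> \<int>\<^sub>\<le>\<^sub>0"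
proof -
  have s2: "s + 2 * of_nat n - 1 \<notin> \<int>\<^sub>\<le>\<^sub>0" and def: "hypergeometric_defined (B_num n m s) (B_den n m s)"
    using reg by (auto simp: B_regular_def)
  show "s + (2 * of_nat n - 1 + of_nat m) \<notin> \<int>\<^sub>\<le>\<^sub>0"
  proof
    assume "s + (2 * of_nat n - 1 + of_nat m) \<in> \<int>\<^sub>\<le>\<^sub>0"
    from nonpos_Ints_diff_of_nat [OF this, of m] show False using s2 by (simp add: algebra_simps)
  qed
  show "s + (of_nat n + of_nat m) \<notin> \<int>\<^sub>\<le>\<^sub>0"
  proof
    assume "s + (of_nat n + of_nat m) \<in> \<int>\<^sub>\<le>\<^sub>0"
    then obtain M where M: "s + (of_nat n + of_nat m) = - of_nat M" by (auto simp: nonpos_Ints_iff_of_nat)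
    hence s: "s = - of_nat M - of_nat n - of_nat m" by (simp add: algebra_simps)
    have "- of_nat M \<in> set (B_den n m s)" by (simp add: B_den_def s)
    then obtain N where N: "N \<le> M" "- of_nat N \<in> set (B_num n m s)"
      using def unfolding hypergeometric_defined_def by blast
    consider "- complex_of_nat N = - of_nat M - of_nat m" | "- complex_of_nat N = of_nat m + of_nat n - 1"
      | "- complex_of_nat N = of_nat m + s + 3 * of_nat n / 2 - 1" | "- complex_of_nat N = of_nat m"
      using N(2) by (auto simp: B_num_def s)
    thus False
    proof cases
      case 1
      from arg_cong [OF this, of Re] show False using N(1) m by simp
    next
      case 2
      from arg_cong [OF this, of Re] show False using n by simp
    next
      case 3
      hence "complex_of_nat n + of_nat (2 * N) = of_nat (2 * M + 2)" by (simp add: s algebra_simps)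
      hence "n + 2 * N = 2 * M + 2" by (simp only: of_nat_eq_iff flip: of_nat_add)
      hence "even (n + 2 * N)" by simp
      thus False using n by simp
    next
      case 4
      from arg_cong [OF this, of Re] show False using m by simp
    qed
  qed
qed

lemma A_term_analytic_at_regular:
  assumes "n > 2" "m \<ge> 1" and reg: "A_regular n m s"
  shows "A_term n m analytic_on {s}"
proof -
  \<comment> \<open>An open set on which \<open>A_term\<close> coincides with the holomorphic
    \<open>A_explicit\<close>. Agreement at s alone would not give analyticity, hence the
    set.\<close>
  define D where "D = {s. s + (2 * of_nat n - 1) \<notin> (\<int>\<^sub>\<le>\<^sub>0 :: complex set)} \<inter> {s. s + of_nat n \<notin> \<int>\<^sub>\<le>\<^sub>0} \<inter>
     {s. s + (of_nat n / 2 + 1) \<notin> \<int>\<^sub>\<le>\<^sub>0} \<inter> {s. s + 3 * of_nat n / 2 \<notin> \<int>\<^sub>\<le>\<^sub>0}"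
  have op: "open D" unfolding D_def by (intro open_Int open_shift_not_nonpos_Ints)
  have "A_explicit n m holomorphic_on D"
    by (rule holomorphic_on_subset [OF A_explicit_holomorphic [OF assms(1,2)]]) (auto simp: D_def)
  hence "A_term n m holomorphic_on D"
    by (rule holomorphic_transform) (auto simp: D_def A_term_eq_explicit [OF assms(1,2)])
  moreover have "s \<in> D"
    using reg A_regular_imp [OF assms] by (auto simp: D_def A_regular_def algebra_simps)
  ultimately show ?thesis using op analytic_on_open analytic_on_subset by blast
qed

lemma B_term_analytic_at_regular:
  assumes "n > 2" "odd n" "m \<ge> 1" and reg: "B_regular n m s"
  shows "B_term n m analytic_on {s}"
proof -
  define D where "D = {s. s + (of_nat n / 2 + 1) \<notin> (\<int>\<^sub>\<le>\<^sub>0 :: complex set)} \<inter> {s. s + (2 * of_nat n - 1) \<notin> \<int>\<^sub>\<le>\<^sub>0} \<inter>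
     {s. s + (of_nat n + of_nat m) \<notin> \<int>\<^sub>\<le>\<^sub>0} \<inter> {s. s + (2 * of_nat n - 1 + of_nat m) \<notin> \<int>\<^sub>\<le>\<^sub>0} \<inter>
     {s. pochhammer (s + of_nat n) m \<noteq> 0}"
  have "open {s. pochhammer (s + of_nat n) m \<noteq> (0 :: complex)}"
    by (intro open_Collect_neq) (auto simp: pochhammer_prod intro!: continuous_intros)
  hence op: "open D" unfolding D_def by (intro open_Int open_shift_not_nonpos_Ints)
  have "B_explicit n m holomorphic_on D"
    by (rule holomorphic_on_subset [OF B_explicit_holomorphic [OF assms(1,3)]]) (auto simp: D_def)
  hence "B_term n m holomorphic_on D"
    by (rule holomorphic_transform) (auto simp: D_def B_term_eq_explicit [OF assms(1,3)])
  moreover have "s \<in> D"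
    using reg B_regular_imp [OF assms] by (auto simp: D_def B_regular_def algebra_simps)
  ultimately show ?thesis using op analytic_on_open analytic_on_subset by blast
qed

text \<open>Agreement on a real ray propagates to the half-plane by the identity theorem, which
  shows that \<open>remove_sings R\<close> is a continuation. Any other one agrees with it on the
  half-plane, hence everywhere, so the definite description is well defined.\<close>

lemma I_mero_eq_remove_sings:
  assumes n: "n > 2" and m: "m \<ge> 1" and R: "R meromorphic_on UNIV"
    and eq: "\<And>s. s \<ge> s0 \<Longrightarrow> I_integral n m (of_real s) = R (of_real s)"
  shows "I_mero n m = remove_sings R"
  unfolding I_mero_def
proof (rule the_equality)
  define H where "H = {s. Re s > -1}"
  have H: "open H" "connected H"
    unfolding H_def by (auto simp: open_halfspace_Re_gt intro: convex_connected convex_halfspace_Re_gt)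
  have F: "remove_sings R nicely_meromorphic_on UNIV" by (rule remove_sings_nicely_meromorphic [OF R])
  have I: "I_integral n m nicely_meromorphic_on H"
    unfolding H_def by (intro analytic_on_imp_nicely_meromorphic_on I_integral_analytic n m)
  \<comment> \<open>The base point has to lie on the ray of known agreement and inside the
    half-plane of convergence.\<close>
  define s1 where "s1 = max s0 0"
  have ev: "\<forall>\<^sub>F w in at (of_real s1). remove_sings R w = R w"
    using meromorphic_on_isolated_singularity [OF meromorphic_on_subset [OF R, of "{of_real s1}"]]
    by (intro eventually_remove_sings_eq_at) auto
  have lim: "filterlim complex_of_real (at (of_real s1)) (at_right s1)"
  proof (rule filterlim_atI)
    show "(complex_of_real \<longlongrightarrow> of_real s1) (at_right s1)" by (intro tendsto_intros)
    show "\<forall>\<^sub>F x in at_right s1. complex_of_real x \<noteq> of_real s1"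
      by (auto simp: eventually_at_filter)
  qed
  \<comment> \<open>Agreement is known on the real axis only, hence frequently but not eventually
    near the base point; approaching it from the right along the reals suffices for the identity
    theorem.\<close>
  have freq: "\<exists>\<^sub>F w in at (of_real s1). remove_sings R w = I_integral n m w"
  proof (rule ccontr)
    assume "\<not> (\<exists>\<^sub>F w in at (of_real s1). remove_sings R w = I_integral n m w)"
    hence "\<forall>\<^sub>F w in at (of_real s1). remove_sings R w \<noteq> I_integral n m w" by (simp add: not_frequently)
    with ev have "\<forall>\<^sub>F w in at (of_real s1). R w \<noteq> I_integral n m w" by eventually_elim auto
    from eventually_compose_filterlim [OF this lim]
    have "\<forall>\<^sub>F x in at_right s1. R (of_real x) \<noteq> I_integral n m (of_real x)" .
    moreover have "\<forall>\<^sub>F x in at_right s1. R (of_real x) = I_integral n m (of_real x)"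
      using eventually_at_right_less by eventually_elim (use eq in \<open>auto simp: s1_def\<close>)
    ultimately have "\<forall>\<^sub>F x in at_right s1. False" by eventually_elim auto
    thus False by simp
  qed
  have s1H: "of_real s1 \<in> H" by (simp add: H_def s1_def)
  have "remove_sings R s = I_integral n m s" if "Re s > -1" for s
    using nicely_meromorphic_eqI [OF nicely_meromorphic_on_subset [OF F] I H s1H freq, of s] that
    by (auto simp: H_def)
  thus "remove_sings R nicely_meromorphic_on UNIV \<and> (\<forall>s. Re s > -1 \<longrightarrow> remove_sings R s = I_integral n m s)"
    using F by blast
  fix G assume G: "G nicely_meromorphic_on UNIV \<and> (\<forall>s. Re s > -1 \<longrightarrow> G s = I_integral n m s)"
  have "\<forall>\<^sub>F w in at 0. w \<in> H" by (rule eventually_at_in_open' [OF H(1)]) (simp add: H_def)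
  hence "\<forall>\<^sub>F w in at 0. G w = remove_sings R w"
    by eventually_elim (use G \<open>\<And>s. Re s > -1 \<Longrightarrow> remove_sings R s = I_integral n m s\<close> in \<open>auto simp: H_def\<close>)
  hence "\<exists>\<^sub>F w in at 0. G w = remove_sings R w" by (rule eventually_frequently [rotated]) simp
  thus "G = remove_sings R"
    using nicely_meromorphic_eqI [OF _ F open_UNIV connected_UNIV UNIV_I] G by blast
qed

theorem proposition3p1:
  fixes n m :: nat
  assumes "n > 2" and "m \<ge> 1"
  shows "(even n \<longrightarrow>
      A_term n m meromorphic_on UNIV \<and>
      (\<forall>\<^sub>\<approx>s. I_mero n m s = A_term n m s) \<and>
      (\<forall>s. A_regular n m s \<longrightarrow> I_mero n m s = A_term n m s)) \<and>
      (odd n \<longrightarrow>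
      (\<lambda>s. B_term n m s + A_term n m s) meromorphic_on UNIV \<and>
      (\<forall>\<^sub>\<approx>s. I_mero n m s = B_term n m s + A_term n m s) \<and>
      (\<forall>s. B_regular n m s \<and> A_regular n m s \<longrightarrow>
      I_mero n m s = B_term n m s + A_term n m s))"
proof -
  obtain s0 where s0: "\<And>s. s \<ge> s0 \<Longrightarrow> I_integral n m (of_real s) =
      (if even n then A_term n m (of_real s) else B_term n m (of_real s) + A_term n m (of_real s))"
    using I_integral_large_real [OF assms] by blast
  have A: "A_term n m meromorphic_on UNIV" by (rule A_term_meromorphic [OF assms])
  have BA: "(\<lambda>s. B_term n m s + A_term n m s) meromorphic_on UNIV"
    by (intro meromorphic_on_add A B_term_meromorphic [OF assms])
  have "(\<forall>\<^sub>\<approx>s. I_mero n m s = A_term n m s) \<and> (\<forall>s. A_regular n m s \<longrightarrow> I_mero n m s = A_term n m s)" if "even n"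
  proof -
    \<comment> \<open>Removing singularities changes a meromorphic function only on a sparse set,
      and not at all where it is analytic; the first fact gives the generic identity, the second the
      one at regular points.\<close>
    have "I_mero n m = remove_sings (A_term n m)"
      by (rule I_mero_eq_remove_sings [OF assms A, of s0]) (use s0 that in auto)
    thus ?thesis
      using eventually_remove_sings_eq [OF A] A_term_analytic_at_regular [OF assms] by simp
  qed
  moreover have "(\<forall>\<^sub>\<approx>s. I_mero n m s = B_term n m s + A_term n m s) \<and>
      (\<forall>s. B_regular n m s \<and> A_regular n m s \<longrightarrow> I_mero n m s = B_term n m s + A_term n m s)" if "odd n"
  proof -
    have "I_mero n m = remove_sings (\<lambda>s. B_term n m s + A_term n m s)"
      by (rule I_mero_eq_remove_sings [OF assms BA, of s0]) (use s0 that in auto)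
    moreover have "(\<lambda>s. B_term n m s + A_term n m s) analytic_on {s}" if "B_regular n m s" "A_regular n m s" for s
      by (intro analytic_on_add B_term_analytic_at_regular A_term_analytic_at_regular assms \<open>odd n\<close> that)
    ultimately show ?thesis using eventually_remove_sings_eq [OF BA] by simp
  qed
  ultimately show ?thesis using A BA by blast
qed

end
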